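(* Let $h>0$ and $\tau>0$. Let $x_0\in\mathbb{R}^d$ and let $(u_n)_{n\ge1}$ be a real sequence such that $$n\,\mu(B_n)\to\tau\quad (n\to\infty),\qquad\text{where } B_n:=B(x_0,e^{-u_n}).$$ Set $t_k:=kh$. Then $$\lim_{n\to\infty}\mathbb{P}\otimes\mu\Big(\Big\{(\omega,x)\ :\ \max_{k=0,\dots,n-1} g_{x_0}\big(X^x_{t_k}(\omega)\big)\le u_n\Big\}\Big)=e^{-\tau}.$$
   Context: Consider on $\mathbb{R}^d$ the stochastic differential equation $dX_t=b(X_t)\,dt+dW_t$, $X_0=x$, where $W$ is a standard $d$-dimensional Brownian motion on a probability space $(\Omega,\mathcal{F},\mathbb{P})$ and $b:\mathbb{R}^d\to\mathbb{R}^d$ satisfies: (H) there is $K$ with $|b(x)-b(y)|\le K|x-y|$ for all $x,y$; (AD) there are constants $R_1\in\mathbb{R}$, $R_2>0$ with $\langle b(x),x\rangle\le R_1-R_2\|x\|^2$ for all $x\in\mathbb{R}^d$. $X^x_t$ denotes the (unique strong) solution started at $x$. Under these assumptions the process has a unique invariant (stationary) probability measure $\mu$, which is absolutely continuous with respect to Lebesgue measure. For $x_0\in\mathbb{R}^d$, $g_{x_0}(x):=-\log d(x,x_0)$ for $x\neq x_0$, where $d$ is the Euclidean distance. $\mathbb{P}\otimes\mu$ is the product measure on $\Omega\times\mathbb{R}^d$ (initial condition $x$ distributed according to $\mu$, independently of the noise); $B(x_0,r)$ is the open Euclidean ball. *)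

theory Defs
  imports "HOL-Probability.Probability"
begin

definition brownian_motion :: "'w measure \<Rightarrow> (real \<Rightarrow> 'w \<Rightarrow> 'a::euclidean_space) \<Rightarrow> bool" where
  "brownian_motion M W \<longleftrightarrow>
     prob_space M \<and>
     (\<forall>\<omega>\<in>space M. W 0 \<omega> = 0 \<and> continuous_on {0..} (\<lambda>t. W t \<omega>)) \<and>
     (\<forall>(ts::nat \<Rightarrow> real) (n::nat). 0 \<le> ts 0 \<and> (\<forall>k<n. ts k < ts (Suc k)) \<longrightarrow>
        prob_space.indep_vars M (\<lambda>_. borel)
           (\<lambda>(k, i) \<omega>. (W (ts (Suc k)) \<omega> - W (ts k) \<omega>) \<bullet> i) ({..<n} \<times> Basis) \<and>
        (\<forall>k<n. \<forall>i\<in>Basis. distributed M lborel (\<lambda>\<omega>. (W (ts (Suc k)) \<omega> - W (ts k) \<omega>) \<bullet> i)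
                                 (normal_density 0 (sqrt (ts (Suc k) - ts k)))))"

text \<open>X x t \<omega> is the (pathwise, hence strong) solution of dX = b(X) dt + dW, X_0 = x,
  i.e. X_t = x + \<integral>_0^t b(X_s) ds + W_t with continuous paths.\<close>
definition sde_solution ::
  "'w measure \<Rightarrow> ('a::euclidean_space \<Rightarrow> 'a) \<Rightarrow> (real \<Rightarrow> 'w \<Rightarrow> 'a) \<Rightarrow> ('a \<Rightarrow> real \<Rightarrow> 'w \<Rightarrow> 'a) \<Rightarrow> bool" where
  "sde_solution M b W X \<longleftrightarrow>
     (\<forall>x. \<forall>\<omega>\<in>space M. continuous_on {0..} (\<lambda>t. X x t \<omega>) \<and>
        (\<forall>t\<ge>0. X x t \<omega> = x + integral {0..t} (\<lambda>s. b (X x s \<omega>)) + W t \<omega>))"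

text \<open>Invariant probability measure of the process (initial point drawn from \<mu>,
  independently of the noise).\<close>
definition invariant_measure ::
  "'w measure \<Rightarrow> ('a::euclidean_space \<Rightarrow> real \<Rightarrow> 'w \<Rightarrow> 'a) \<Rightarrow> 'a measure \<Rightarrow> bool" where
  "invariant_measure M X \<mu> \<longleftrightarrow>
     prob_space \<mu> \<and> sets \<mu> = sets borel \<and>
     (\<forall>t\<ge>0. distr (M \<Otimes>\<^sub>M \<mu>) borel (\<lambda>(\<omega>, x). X x t \<omega>) = \<mu>)"

definition g_obs :: "'a::euclidean_space \<Rightarrow> 'a \<Rightarrow> ereal" where
  "g_obs x0 x = (if x = x0 then \<infinity> else ereal (- ln (dist x x0)))"

end

theory Submission
  imports Defs
begin

text \<open>
  The chain observed at the times k h has kernel P and stationary law mu, and P charges a ball of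
  radius r with mass at most C r^d from every starting point and at least a r^d locally. These two
  bounds come from the Euler scheme: shifting the noise of a short time interval by a constant drift c
  moves the endpoint by a small perturbation of a multiple of c, while the law of the noise changes
  by an explicit Cameron--Martin density, so averaging over c compares the law of the endpoint with
  Lebesgue measure. By a Vitali covering, ball bounds yield domination of P(x, .) by mu and
  conversely on large balls, hence a Doeblin-type contraction in L1(mu) and mixing from
  deterministic starting points. If q n is the probability of avoiding B for n steps, then
  q n - q (n + 1) is the integral over B of the probability of surviving n further steps, which by
  mixing and the upper ball bound is mu(B) (q n + o(1)). Thus q n is close to (1 - mu(B))^n.
\<close>

section \<open>The Euler scheme\<close>

text \<open>Two features make the bounds survive the passage from the scheme to the solution. A
  constant drift shift over a time \<delta> produces the weight \<open>exp (c \<bullet> W \<delta>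
  \<omega> - \<delta> * (norm c)\<^sup>2 / 2)\<close>, which sees the noise only through its
  endpoint and so does not depend on the step size. The map from the shift to the endpoint is close
  to \<delta> times the identity as soon as \<open>K * \<delta> \<le> 1/3\<close>, again for every
  step size; longer times are reached by making only the last short step carry the estimate.
  Averaged mixing cannot suffice for the recursion: one step of it is an integral over B, whose mass
  is of order 1/n, and n such errors are summed. The mixing error must therefore be small for each
  start in B, so that the errors add up to at most n times mu(B) times something small. The number
  of steps granted for mixing is fixed before n grows, and the visits to B during these steps cost
  at most a fixed multiple of the radius to the power d.\<close>

primrec euler :: "('a::real_normed_vector \<Rightarrow> 'a) \<Rightarrow> real \<Rightarrow> 'a \<Rightarrow> (nat \<Rightarrow> 'a) \<Rightarrow> nat \<Rightarrow> 'a" where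
  "euler b \<eta> x z 0 = x"
| "euler b \<eta> x z (Suc k) = euler b \<eta> x z k + \<eta> *\<^sub>R b (euler b \<eta> x z k) + z k"

definition increments :: "(real \<Rightarrow> 'a::real_normed_vector) \<Rightarrow> real \<Rightarrow> nat \<Rightarrow> 'a" where
  "increments w \<eta> k = w (real (Suc k) * \<eta>) - w (real k * \<eta>)"

text \<open>The discrete flow property: restarting after p steps means reading the noise from index
  p on. Together with the independence of noise blocks it becomes the Markov property.\<close>

lemma euler_add:
  "euler b \<eta> x z (p + k) = euler b \<eta> (euler b \<eta> x z p) (\<lambda>j. z (p + j)) k"
  by (induction k) auto

lemma euler_cong: "(\<And>j. j < k \<Longrightarrow> z j = z' j) \<Longrightarrow> euler b \<eta> x z k = euler b \<eta> x z' k"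
  by (induction k) auto

lemma sum_increments: "(\<Sum>k<n. increments w \<eta> k) = w (real n * \<eta>) - w 0"
  unfolding increments_def by (subst sum_lessThan_telescope) simp

lemma lipschitz_constant_nonneg:
  fixes b :: "'a::euclidean_space \<Rightarrow> 'b::real_normed_vector"
  assumes "\<And>x y. norm (b x - b y) \<le> K * norm (x - y)"
  shows "0 \<le> K"
proof -
  obtain i :: 'a where "i \<in> Basis" using nonempty_Basis by blast
  then show ?thesis
    using order_trans[OF norm_ge_zero assms[of i 0]] by simp
qed

lemma lipschitz_imp_continuous_on:
  fixes b :: "'a::euclidean_space \<Rightarrow> 'b::real_normed_vector"
  assumes "\<And>x y. norm (b x - b y) \<le> K * norm (x - y)"
  shows "continuous_on S b"
proof -
  have "K-lipschitz_on S b"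
    using assms lipschitz_constant_nonneg[OF assms]
    by (intro lipschitz_onI) (auto simp: dist_norm)
  then show ?thesis by (rule lipschitz_on_continuous_on)
qed

lemma one_plus_power_le_exp:
  fixes K \<eta> :: real
  assumes "0 \<le> K" "0 \<le> \<eta>"
  shows "(1 + \<eta> * K) ^ k \<le> exp (K * (real k * \<eta>))"
proof -
  have "(1 + \<eta> * K) ^ k \<le> exp (\<eta> * K) ^ k"
    using assms by (intro power_mono exp_ge_add_one_self) auto
  also have "\<dots> = exp (K * (real k * \<eta>))"
    by (simp add: exp_of_nat_mult[symmetric] mult_ac)
  finally show ?thesis .
qed

section \<open>Discrete Gronwall estimates for a Lipschitz drift\<close>

context
  fixes b :: "'a::euclidean_space \<Rightarrow> 'a" and K :: real
  assumes lip: "\<And>x y. norm (b x - b y) \<le> K * norm (x - y)"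
begin

lemma euler_perturbed_step:
  assumes "0 \<le> \<eta>"
  shows "norm ((x + \<eta> *\<^sub>R b x + u) - (y + \<eta> *\<^sub>R b y + v))
           \<le> (1 + \<eta> * K) * norm (x - y) + norm (u - v)"
proof -
  have "(x + \<eta> *\<^sub>R b x + u) - (y + \<eta> *\<^sub>R b y + v) = (x - y) + \<eta> *\<^sub>R (b x - b y) + (u - v)"
    by (simp add: algebra_simps)
  then have "norm ((x + \<eta> *\<^sub>R b x + u) - (y + \<eta> *\<^sub>R b y + v))
      \<le> norm (x - y) + \<eta> * norm (b x - b y) + norm (u - v)"
    using assms by (metis (no_types, lifting) norm_triangle_le norm_scaleR abs_of_nonneg
        add_right_mono norm_triangle_ineq)
  also have "\<dots> \<le> norm (x - y) + \<eta> * (K * norm (x - y)) + norm (u - v)"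
    using mult_left_mono[OF lip assms] by simp
  finally show ?thesis by (simp add: algebra_simps)
qed

lemma euler_dist_start:
  assumes "0 \<le> \<eta>"
  shows "norm (euler b \<eta> x z k - euler b \<eta> y z k) \<le> exp (K * (real k * \<eta>)) * norm (x - y)"
proof -
  note K0 = lipschitz_constant_nonneg[OF lip]
  have "norm (euler b \<eta> x z k - euler b \<eta> y z k) \<le> (1 + \<eta> * K) ^ k * norm (x - y)"
  proof (induction k)
    case (Suc k)
    have "norm (euler b \<eta> x z (Suc k) - euler b \<eta> y z (Suc k))
        \<le> (1 + \<eta> * K) * norm (euler b \<eta> x z k - euler b \<eta> y z k)"
      using euler_perturbed_step[OF assms, of _ "z k" _ "z k"] by simp
    also have "\<dots> \<le> (1 + \<eta> * K) * ((1 + \<eta> * K) ^ k * norm (x - y))"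
      using assms K0 by (intro mult_left_mono Suc) auto
    finally show ?case by (simp add: mult_ac)
  qed simp
  also have "\<dots> \<le> exp (K * (real k * \<eta>)) * norm (x - y)"
    using one_plus_power_le_exp[OF K0 assms] by (intro mult_right_mono) auto
  finally show ?thesis .
qed

text \<open>Discrete Gronwall argument: defects of size \<eta> * \<epsilon> accumulate linearly, and
  the Lipschitz step amplifies each of them by at most \<open>(1 + \<eta> * K) ^ k\<close>. It is
  applied to the exact solution sampled on the grid.\<close>

lemma euler_dist_approximate_orbit:
  assumes "0 \<le> \<eta>" "0 \<le> \<epsilon>" and start: "y 0 = x"
    and step: "\<And>j. j < k \<Longrightarrow> norm (y (Suc j) - (y j + \<eta> *\<^sub>R b (y j) + z j)) \<le> \<eta> * \<epsilon>"
  shows "norm (euler b \<eta> x z k - y k) \<le> real k * \<eta> * \<epsilon> * exp (K * (real k * \<eta>))"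
proof -
  note K0 = lipschitz_constant_nonneg[OF lip]
  have *: "j \<le> k \<Longrightarrow> norm (euler b \<eta> x z j - y j) \<le> real j * \<eta> * \<epsilon> * (1 + \<eta> * K) ^ j" for j
  proof (induction j)
    case 0 then show ?case using start by simp
  next
    case (Suc j)
    define v where "v = y (Suc j) - (y j + \<eta> *\<^sub>R b (y j))"
    have v: "y (Suc j) = y j + \<eta> *\<^sub>R b (y j) + v" by (simp add: v_def)
    have nv: "norm (z j - v) \<le> \<eta> * \<epsilon>"
      using step[of j] Suc.prems by (simp add: v_def norm_minus_commute algebra_simps)
    have "norm (euler b \<eta> x z (Suc j) - y (Suc j))
        \<le> (1 + \<eta> * K) * norm (euler b \<eta> x z j - y j) + norm (z j - v)"
      unfolding v euler.simps by (rule euler_perturbed_step[OF assms(1)])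
    also have "\<dots> \<le> (1 + \<eta> * K) * (real j * \<eta> * \<epsilon> * (1 + \<eta> * K) ^ j) + \<eta> * \<epsilon>"
      using assms K0 Suc nv by (intro add_mono mult_left_mono) auto
    \<comment> \<open>The fresh defect is enlarged by a power of \<open>1 + \<eta> * K\<close>,
      which is at least 1, so that it merges with the accumulated error.\<close>
    also have "\<dots> \<le> (1 + \<eta> * K) * (real j * \<eta> * \<epsilon> * (1 + \<eta> * K) ^ j)
        + \<eta> * \<epsilon> * (1 + \<eta> * K) ^ Suc j"
      using mult_left_mono[OF one_le_power[of "1 + \<eta> * K" "Suc j"], of "\<eta> * \<epsilon>"] assms K0 by simp
    also have "\<dots> = real (Suc j) * \<eta> * \<epsilon> * (1 + \<eta> * K) ^ Suc j"
      by (simp add: algebra_simps)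
    finally show ?case .
  qed
  have "norm (euler b \<eta> x z k - y k) \<le> real k * \<eta> * \<epsilon> * (1 + \<eta> * K) ^ k"
    by (rule *) simp
  also have "\<dots> \<le> real k * \<eta> * \<epsilon> * exp (K * (real k * \<eta>))"
    using assms one_plus_power_le_exp[OF K0 assms(1)] by (intro mult_left_mono) auto
  finally show ?thesis .
qed

text \<open>Without drift the shift would move the endpoint by exactly
  \<open>real L * \<eta>\<close> times c. By induction the displacement after j steps is at most 3/2
  of its ideal size, so the drift changes by at most \<open>K * 3/2 * (real j * \<eta>)\<close>
  times the norm of c - c'; the bound 1/3 turns this factor into 1/2. The factor below 1 makes the
  endpoint an invertible function of c.\<close>

lemma euler_shifted_noise:
  assumes "0 \<le> \<eta>" and small: "K * (real L * \<eta>) \<le> 1/3"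
  shows "norm (euler b \<eta> x (\<lambda>k. z k + \<eta> *\<^sub>R c) L - euler b \<eta> x (\<lambda>k. z k + \<eta> *\<^sub>R c') L
               - (real L * \<eta>) *\<^sub>R (c - c')) \<le> real L * \<eta> / 2 * norm (c - c')"
proof -
  note K0 = lipschitz_constant_nonneg[OF lip]
  let ?e = "\<lambda>c. euler b \<eta> x (\<lambda>k. z k + \<eta> *\<^sub>R c)"
  have "j \<le> L \<Longrightarrow> norm (?e c j - ?e c' j - (real j * \<eta>) *\<^sub>R (c - c')) \<le> real j * \<eta> / 2 * norm (c - c')" for j
  proof (induction j)
    case (Suc j)
    let ?D = "?e c j - ?e c' j - (real j * \<eta>) *\<^sub>R (c - c')"
    have D: "norm ?D \<le> real j * \<eta> / 2 * norm (c - c')" using Suc by simp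
    have "norm (?e c j - ?e c' j) = norm (?D + (real j * \<eta>) *\<^sub>R (c - c'))" by simp
    also have "\<dots> \<le> norm ?D + norm ((real j * \<eta>) *\<^sub>R (c - c'))" by (rule norm_triangle_ineq)
    also have "\<dots> \<le> real j * \<eta> / 2 * norm (c - c') + real j * \<eta> * norm (c - c')"
      using D assms(1) by (intro add_mono) auto
    also have "\<dots> = 3/2 * (real j * \<eta>) * norm (c - c')" by (simp add: algebra_simps)
    finally have d: "norm (?e c j - ?e c' j) \<le> 3/2 * (real j * \<eta>) * norm (c - c')" .
    have "K * (real j * \<eta>) \<le> K * (real L * \<eta>)"
      using Suc.prems assms(1) K0 by (intro mult_left_mono mult_right_mono) auto
    then have Kj: "K * (real j * \<eta>) \<le> 1/3" using small by linarith
    have "norm (b (?e c j) - b (?e c' j)) \<le> K * (3/2 * (real j * \<eta>) * norm (c - c'))"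
      using lip[of "?e c j" "?e c' j"] mult_left_mono[OF d K0] by linarith
    also have "\<dots> = 3/2 * (K * (real j * \<eta>)) * norm (c - c')" by simp
    also have "\<dots> \<le> 3/2 * (1/3) * norm (c - c')"
      using Kj by (intro mult_right_mono mult_left_mono) auto
    finally have bb: "norm (b (?e c j) - b (?e c' j)) \<le> norm (c - c') / 2" by simp
    have "?e c (Suc j) - ?e c' (Suc j) - (real (Suc j) * \<eta>) *\<^sub>R (c - c')
        = ?D + \<eta> *\<^sub>R (b (?e c j) - b (?e c' j))"
      by (simp add: algebra_simps)
    then have "norm (?e c (Suc j) - ?e c' (Suc j) - (real (Suc j) * \<eta>) *\<^sub>R (c - c'))
        \<le> norm ?D + norm (\<eta> *\<^sub>R (b (?e c j) - b (?e c' j)))"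
      using norm_triangle_ineq by metis
    also have "\<dots> \<le> real j * \<eta> / 2 * norm (c - c') + \<eta> * (norm (c - c') / 2)"
      using D mult_left_mono[OF bb assms(1)] assms(1) by (intro add_mono) auto
    finally show ?case by (simp add: algebra_simps)
  qed simp
  then show ?thesis by simp
qed

text \<open>The grid is chosen so that \<open>j * Suc N\<close> steps end exactly at time j h. The
  local error is controlled by the modulus of continuity of the path alone. The start may move with
  N because the Markov property is proved by restarting the scheme at an approximate
  endpoint.\<close>

lemma euler_tendsto_solution:
  fixes X w :: "real \<Rightarrow> 'a"
  assumes cont: "continuous_on {0..} X"
    and eq: "\<And>t. 0 \<le> t \<Longrightarrow> X t = x + integral {0..t} (\<lambda>s. b (X s)) + w t"
    and w0: "w 0 = 0" and h: "0 < h" and xs: "xs \<longlonglongrightarrow> x"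
  shows "(\<lambda>N. euler b (h / Suc N) (xs N) (increments w (h / Suc N)) (j * Suc N))
           \<longlonglongrightarrow> X (real j * h)"
proof -
  note K0 = lipschitz_constant_nonneg[OF lip]
  define T where "T = real j * h"
  have T0: "0 \<le> T" using h by (simp add: T_def)
  have bcont: "continuous_on {0..} (\<lambda>s. b (X s))"
    by (rule continuous_on_compose2[OF lipschitz_imp_continuous_on[OF lip, of UNIV] cont]) auto
  have uc: "uniformly_continuous_on {0..T} X"
    by (rule compact_uniformly_continuous) (auto intro: continuous_on_subset[OF cont])
  let ?E = "\<lambda>N. euler b (h / Suc N) x (increments w (h / Suc N)) (j * Suc N)"
  have err: "\<exists>N0. \<forall>N\<ge>N0. norm (?E N - X T) \<le> T * (K * \<epsilon>) * exp (K * T)" if "\<epsilon> > 0" for \<epsilon>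
  proof -
    obtain d where d: "d > 0" "\<And>s t. s \<in> {0..T} \<Longrightarrow> t \<in> {0..T} \<Longrightarrow> dist s t < d \<Longrightarrow> dist (X s) (X t) < \<epsilon>"
      by (rule uniformly_continuous_onE[OF uc \<open>\<epsilon> > 0\<close>]) (metis dist_commute)
    have "(\<lambda>N. h / real (Suc N)) \<longlonglongrightarrow> 0"
      by (rule LIMSEQ_Suc[OF lim_const_over_n])
    then obtain N0 where N0: "\<And>N. N \<ge> N0 \<Longrightarrow> h / real (Suc N) < d"
      using order_tendstoD(2)[OF _ d(1)] eventually_sequentially by force
    show ?thesis
    proof (intro exI allI impI)
      fix N assume "N0 \<le> N"
      define \<eta> where "\<eta> = h / Suc N"
      have \<eta>: "0 < \<eta>" "\<eta> < d" using N0[OF \<open>N0 \<le> N\<close>] h by (auto simp: \<eta>_def)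
      have T: "real (j * Suc N) * \<eta> = T" unfolding T_def \<eta>_def by (simp add: field_simps)
      have "norm (euler b \<eta> x (increments w \<eta>) (j * Suc N) - X (real (j * Suc N) * \<eta>))
          \<le> real (j * Suc N) * \<eta> * (K * \<epsilon>) * exp (K * (real (j * Suc N) * \<eta>))"
      proof (rule euler_dist_approximate_orbit[where y = "\<lambda>k. X (real k * \<eta>)"])
        show "X (real 0 * \<eta>) = x" using eq[of 0] w0 by simp
        show "0 \<le> K * \<epsilon>" using K0 that by simp
        fix k assume k: "k < j * Suc N"
        let ?s = "real k * \<eta>" and ?t = "real (Suc k) * \<eta>"
        have st: "0 \<le> ?s" "?s \<le> ?t" "?t - ?s = \<eta>" using \<eta> by (auto simp: algebra_simps)
        have tT: "?t \<le> T" unfolding T[symmetric] using k \<eta> by (intro mult_right_mono of_nat_mono) auto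
        have int: "(\<lambda>s. b (X s)) integrable_on {u..v}" if "0 \<le> u" for u v
          by (rule integrable_continuous_interval) (rule continuous_on_subset[OF bcont], use that in auto)
        have "integral {0..?s} (\<lambda>s. b (X s)) + integral {?s..?t} (\<lambda>s. b (X s))
            = integral {0..?t} (\<lambda>s. b (X s))"
          using st by (intro Henstock_Kurzweil_Integration.integral_combine int) auto
        then have "X ?t - X ?s = integral {?s..?t} (\<lambda>s. b (X s)) + increments w \<eta> k"
          using eq[of ?s] eq[of ?t] st unfolding increments_def by (simp add: algebra_simps)
        moreover have "integral {?s..?t} (\<lambda>s. b (X s) - b (X ?s))
            = integral {?s..?t} (\<lambda>s. b (X s)) - \<eta> *\<^sub>R b (X ?s)"
          using st int by (subst Henstock_Kurzweil_Integration.integral_diff) (auto simp: content_real)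
        \<comment> \<open>The noise increment cancels, so the defect of the exact path is the drift
          integral minus its left-endpoint rectangle.\<close>
        ultimately have "X ?t - (X ?s + \<eta> *\<^sub>R b (X ?s) + increments w \<eta> k)
            = integral {?s..?t} (\<lambda>s. b (X s) - b (X ?s))"
          by (simp add: algebra_simps)
        also have "norm \<dots> \<le> (K * \<epsilon>) * (?t - ?s)"
        proof (rule integral_bound)
          show "continuous_on {?s..?t} (\<lambda>s. b (X s) - b (X ?s))"
            using st by (intro continuous_intros continuous_on_subset[OF bcont]) auto
          fix r assume r: "r \<in> {?s..?t}"
          have "r \<in> {0..T}" "?s \<in> {0..T}" "dist r ?s < d"
            using r st tT \<eta> order_trans[OF st(1), of r] by (auto simp: dist_real_def)
          then have "dist (X r) (X ?s) < \<epsilon>" by (rule d(2))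
          then show "norm (b (X r) - b (X ?s)) \<le> K * \<epsilon>"
            using lip[of "X r" "X ?s"] mult_left_mono[OF less_imp_le K0, of "norm (X r - X ?s)" \<epsilon>]
            by (simp add: dist_norm)
        qed (use st in auto)
        finally show "norm (X ?t - (X ?s + \<eta> *\<^sub>R b (X ?s) + increments w \<eta> k)) \<le> \<eta> * (K * \<epsilon>)"
          using st by (simp add: mult_ac)
      qed (use \<eta> in auto)
      then show "norm (?E N - X T) \<le> T * (K * \<epsilon>) * exp (K * T)"
        unfolding T by (simp add: \<eta>_def)
    qed
  qed
  have "?E \<longlonglongrightarrow> X T"
  proof (rule LIMSEQ_I)
    fix e :: real assume "0 < e"
    define C where "C = T * K * exp (K * T)"
    have C0: "0 \<le> C" using T0 K0 by (simp add: C_def)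
    obtain N0 where N0: "\<And>N. N \<ge> N0 \<Longrightarrow> norm (?E N - X T) \<le> T * (K * (e / (C + 1))) * exp (K * T)"
      using err[of "e / (C + 1)"] C0 \<open>0 < e\<close> by auto
    have "T * (K * (e / (C + 1))) * exp (K * T) = C * (e / (C + 1))" by (simp add: C_def)
    also have "\<dots> < e" using C0 \<open>0 < e\<close> by (simp add: field_simps)
    finally show "\<exists>N0. \<forall>N\<ge>N0. norm (?E N - X T) < e" using N0 by (meson le_less_trans)
  qed
  moreover have "(\<lambda>N. euler b (h / Suc N) (xs N) (increments w (h / Suc N)) (j * Suc N) - ?E N) \<longlonglongrightarrow> 0"
  proof (rule Lim_null_comparison)
    show "\<forall>\<^sub>F N in sequentially. norm (euler b (h / Suc N) (xs N) (increments w (h / Suc N)) (j * Suc N) - ?E N)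
        \<le> exp (K * T) * norm (xs N - x)"
    proof (intro always_eventually allI)
      fix N
      have T: "real (j * Suc N) * (h / Suc N) = T" unfolding T_def by (simp add: field_simps)
      show "norm (euler b (h / Suc N) (xs N) (increments w (h / Suc N)) (j * Suc N) - ?E N)
          \<le> exp (K * T) * norm (xs N - x)"
        using euler_dist_start[of "h / Suc N" "xs N" _ "j * Suc N" x] h unfolding T by simp
    qed
    show "(\<lambda>N. exp (K * T) * norm (xs N - x)) \<longlonglongrightarrow> 0"
      by (intro tendsto_mult_right_zero tendsto_norm_zero LIM_zero xs)
  qed
  ultimately show ?thesis
    using tendsto_add[of "\<lambda>N. euler b (h / Suc N) (xs N) (increments w (h / Suc N)) (j * Suc N) - ?E N" 0 _ ?E "X T"]
    by (simp add: T_def)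
qed

end

section \<open>Comparing measures on balls\<close>

lemma emeasure_UN_countable_le:
  assumes "countable I" and A: "\<And>i. i \<in> I \<Longrightarrow> A i \<in> sets M"
  shows "emeasure M (\<Union>i\<in>I. A i) \<le> (\<integral>\<^sup>+i. emeasure M (A i) \<partial>count_space I)"
proof -
  have UN: "(\<Union>i\<in>I. A i) \<in> sets M" using assms by (intro sets.countable_UN'') auto
  have "emeasure M (\<Union>i\<in>I. A i) = (\<integral>\<^sup>+x. indicator (\<Union>i\<in>I. A i) x \<partial>M)"
    using UN by simp
  also have "\<dots> \<le> (\<integral>\<^sup>+x. \<integral>\<^sup>+i. indicator (A i) x \<partial>count_space I \<partial>M)"
  proof (rule nn_integral_mono)
    fix x
    show "indicator (\<Union>i\<in>I. A i) x \<le> (\<integral>\<^sup>+i. indicator (A i) x \<partial>count_space I)"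
    proof (cases "x \<in> (\<Union>i\<in>I. A i)")
      case True
      then obtain i where i: "i \<in> I" "x \<in> A i" by blast
      have "1 = (\<integral>\<^sup>+j. indicator {i} j \<partial>count_space I)" using i by simp
      also have "\<dots> \<le> (\<integral>\<^sup>+j. indicator (A j) x \<partial>count_space I)"
        using i by (intro nn_integral_mono) (auto simp: indicator_def)
      finally show ?thesis using True by simp
    qed simp
  qed
  also have "\<dots> = (\<integral>\<^sup>+i. \<integral>\<^sup>+x. indicator (A i) x \<partial>M \<partial>count_space I)"
    using assms by (intro nn_integral_count_space_nn_integral) auto
  also have "\<dots> = (\<integral>\<^sup>+i. emeasure M (A i) \<partial>count_space I)"
    using A by (intro nn_integral_cong) simp
  finally show ?thesis .
qed

text \<open>Vitali covering: disjoint balls inside G, enlarged five times, still cover G. The upper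
  bound is applied to the enlarged balls and the lower bound to the original ones; the powers of the
  radius cancel and leave \<open>5 ^ DIM('a)\<close>.\<close>

lemma emeasure_le_on_open_of_ball_bounds:
  fixes \<nu>1 \<nu>2 :: "'a::euclidean_space measure" and C a :: real
  assumes sets1: "sets \<nu>1 = sets borel" and sets2: "sets \<nu>2 = sets borel"
    and C: "0 \<le> C" and a: "0 < a"
    and upper: "\<And>y r. 0 < r \<Longrightarrow> emeasure \<nu>1 (ball y r) \<le> ennreal (C * r ^ DIM('a))"
    and lower: "\<And>y r. y \<in> G \<Longrightarrow> 0 < r \<Longrightarrow> r \<le> 1 \<Longrightarrow> ennreal (a * r ^ DIM('a)) \<le> emeasure \<nu>2 (ball y r)"
    and G: "open G"
  shows "emeasure \<nu>1 G \<le> ennreal (C * 5 ^ DIM('a) / a) * emeasure \<nu>2 G"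
proof -
  have "\<exists>r. 0 < r \<and> r \<le> 1 \<and> ball x r \<subseteq> G" if x: "x \<in> G" for x
  proof -
    obtain e where "e > 0" "ball x e \<subseteq> G" using G x unfolding open_contains_ball by blast
    \<comment> \<open>Radii are capped at 1 because the lower bound is available only up to that
      radius.\<close>
    then show ?thesis by (intro exI[of _ "min e 1"]) auto
  qed
  then obtain r where r: "\<And>x. x \<in> G \<Longrightarrow> 0 < r x \<and> r x \<le> 1 \<and> ball x (r x) \<subseteq> G"
    by metis
  have cov: "G \<subseteq> (\<Union>x\<in>G. ball x (r x))" using r by force
  have r1: "\<And>x. x \<in> G \<Longrightarrow> 0 < r x \<and> r x \<le> 1" using r by blast
  obtain D where D: "countable D" "D \<subseteq> G"
      "pairwise (\<lambda>i j. disjnt (ball i (r i)) (ball j (r j))) D" "G \<subseteq> (\<Union>i\<in>D. ball i (5 * r i))"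
    by (rule Vitali_covering_lemma_balls[OF cov r1])
  let ?k = "ennreal (C * 5 ^ DIM('a) / a)"
  have G1: "(\<Union>i\<in>D. ball i (5 * r i)) \<in> sets \<nu>1"
    unfolding sets1 by (intro borel_open open_UN) auto
  have "emeasure \<nu>1 G \<le> emeasure \<nu>1 (\<Union>i\<in>D. ball i (5 * r i))"
    by (rule emeasure_mono[OF D(4) G1])
  also have "\<dots> \<le> (\<integral>\<^sup>+i. emeasure \<nu>1 (ball i (5 * r i)) \<partial>count_space D)"
    using D(1) by (intro emeasure_UN_countable_le) (auto simp: sets1)
  also have "\<dots> \<le> (\<integral>\<^sup>+i. ?k * emeasure \<nu>2 (ball i (r i)) \<partial>count_space D)"
  proof (rule nn_integral_mono)
    fix i assume "i \<in> space (count_space D)"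
    then have i: "0 < r i" "r i \<le> 1" "i \<in> G" using r D(2) by auto
    have "emeasure \<nu>1 (ball i (5 * r i)) \<le> ennreal (C * (5 * r i) ^ DIM('a))"
      using i by (intro upper) auto
    also have "\<dots> = ?k * ennreal (a * r i ^ DIM('a))"
      using i C a by (subst ennreal_mult[symmetric]) (auto simp: power_mult_distrib)
    also have "\<dots> \<le> ?k * emeasure \<nu>2 (ball i (r i))"
      using i by (intro mult_left_mono lower) auto
    finally show "emeasure \<nu>1 (ball i (5 * r i)) \<le> ?k * emeasure \<nu>2 (ball i (r i))" .
  qed
  also have "\<dots> = ?k * (\<integral>\<^sup>+i. emeasure \<nu>2 (ball i (r i)) \<partial>count_space D)"
    by (rule nn_integral_cmult) auto
  also have "(\<integral>\<^sup>+i. emeasure \<nu>2 (ball i (r i)) \<partial>count_space D) = emeasure \<nu>2 (\<Union>i\<in>D. ball i (r i))"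
    using D(1,3) by (intro emeasure_UN_countable[symmetric])
      (auto simp: sets2 disjoint_family_on_def pairwise_def disjnt_def)
  also have "?k * \<dots> \<le> ?k * emeasure \<nu>2 G"
    using r D(2) G by (intro mult_left_mono emeasure_mono) (auto simp: sets2)
  finally show ?thesis .
qed

text \<open>Outer regularity of \<nu>2 replaces A by a slightly larger open set, which is then cut
  down to U, where the centres satisfy the lower bound.\<close>

lemma emeasure_le_of_ball_bounds:
  fixes \<nu>1 \<nu>2 :: "'a::euclidean_space measure" and C a :: real
  assumes sets1: "sets \<nu>1 = sets borel" and sets2: "sets \<nu>2 = sets borel"
    and fin: "finite_measure \<nu>2"
    and C: "0 \<le> C" and a: "0 < a"
    and upper: "\<And>y r. 0 < r \<Longrightarrow> emeasure \<nu>1 (ball y r) \<le> ennreal (C * r ^ DIM('a))"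
    and lower: "\<And>y r. y \<in> U \<Longrightarrow> 0 < r \<Longrightarrow> r \<le> 1 \<Longrightarrow> ennreal (a * r ^ DIM('a)) \<le> emeasure \<nu>2 (ball y r)"
    and U: "open U" and A: "A \<in> sets borel" "A \<subseteq> U"
  shows "emeasure \<nu>1 A \<le> ennreal (C * 5 ^ DIM('a) / a) * emeasure \<nu>2 A"
proof -
  let ?k = "ennreal (C * 5 ^ DIM('a) / a)"
  interpret finite_measure \<nu>2 by (rule fin)
  have out: "emeasure \<nu>2 A = (INF V \<in> {V. A \<subseteq> V \<and> open V}. emeasure \<nu>2 V)"
    using A(1) emeasure_finite by (intro outer_regular sets2) (auto simp: top.not_eq_extremum)
  show ?thesis
  proof (rule ennreal_le_epsilon)
    fix e :: real assume e: "0 < e"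
    define k where "k = C * 5 ^ DIM('a) / a"
    have k0: "0 \<le> k" using C a by (simp add: k_def)
    \<comment> \<open>Strictness comes from the finiteness of \<nu>2; the slack e/(k + 1) costs less
      than e once multiplied by k.\<close>
    have "emeasure \<nu>2 A < emeasure \<nu>2 A + ennreal (e / (k + 1))"
      using e k0 by (simp add: emeasure_eq_measure ennreal_plus[symmetric] ennreal_less_iff del: ennreal_plus)
    then have "(INF V \<in> {V. A \<subseteq> V \<and> open V}. emeasure \<nu>2 V) < emeasure \<nu>2 A + ennreal (e / (k + 1))"
      by (subst out[symmetric])
    then obtain V where V: "A \<subseteq> V" "open V" "emeasure \<nu>2 V < emeasure \<nu>2 A + ennreal (e / (k + 1))"
      unfolding INF_less_iff by auto
    have "emeasure \<nu>1 A \<le> emeasure \<nu>1 (V \<inter> U)"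
      using A V U by (intro emeasure_mono) (auto simp: sets1)
    also have "\<dots> \<le> ennreal k * emeasure \<nu>2 (V \<inter> U)"
      unfolding k_def using V(2) U
      by (intro emeasure_le_on_open_of_ball_bounds[OF sets1 sets2 C a upper lower]) auto
    also have "\<dots> \<le> ennreal k * (emeasure \<nu>2 A + ennreal (e / (k + 1)))"
      using V U by (intro mult_left_mono order_trans[OF emeasure_mono less_imp_le[OF V(3)]])
        (auto simp: sets2)
    also have "\<dots> = ennreal k * emeasure \<nu>2 A + ennreal (k * (e / (k + 1)))"
      using k0 e by (subst distrib_left, subst ennreal_mult) simp_all
    also have "\<dots> \<le> ennreal k * emeasure \<nu>2 A + ennreal e"
      using k0 e by (intro add_left_mono ennreal_leI) (simp add: field_simps)
    finally show "emeasure \<nu>1 A \<le> ?k * emeasure \<nu>2 A + ennreal e" unfolding k_def .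
  qed
qed

lemma nn_integral_le_of_ball_bounds:
  fixes \<nu>1 \<nu>2 :: "'a::euclidean_space measure" and C a :: real
  assumes sets1: "sets \<nu>1 = sets borel" and sets2: "sets \<nu>2 = sets borel"
    and fin: "finite_measure \<nu>2"
    and C: "0 \<le> C" and a: "0 < a"
    and upper: "\<And>y r. 0 < r \<Longrightarrow> emeasure \<nu>1 (ball y r) \<le> ennreal (C * r ^ DIM('a))"
    and lower: "\<And>y r. y \<in> U \<Longrightarrow> 0 < r \<Longrightarrow> r \<le> 1 \<Longrightarrow> ennreal (a * r ^ DIM('a)) \<le> emeasure \<nu>2 (ball y r)"
    and U: "open U" and f: "f \<in> borel_measurable borel"
  shows "(\<integral>\<^sup>+x. f x * indicator U x \<partial>\<nu>1)
           \<le> ennreal (C * 5 ^ DIM('a) / a) * (\<integral>\<^sup>+x. f x * indicator U x \<partial>\<nu>2)"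
proof -
  let ?k = "ennreal (C * 5 ^ DIM('a) / a)"
  have U': "U \<in> sets borel" using U by simp
  have ind: "indicator U \<in> borel_measurable \<nu>1" "indicator U \<in> borel_measurable \<nu>2"
    using U' sets1 sets2 by (auto intro!: borel_measurable_indicator)
  have f1: "f \<in> borel_measurable \<nu>1" "f \<in> borel_measurable \<nu>2"
    using f sets1 sets2 by (simp_all cong: measurable_cong_sets)
  have sets12: "sets (density \<nu>1 (indicator U)) = sets (scale_measure ?k (density \<nu>2 (indicator U)))"
    by (simp add: sets1 sets2)
  have "density \<nu>1 (indicator U) \<le> scale_measure ?k (density \<nu>2 (indicator U))"
    unfolding le_measure[OF sets12]
  proof
    fix A assume "A \<in> sets (density \<nu>1 (indicator U))"
    then have A: "A \<in> sets borel" by (simp add: sets1)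
    have e: "(\<integral>\<^sup>+x. indicator U x * indicator A x \<partial>\<nu>) = emeasure \<nu> (A \<inter> U)"
      if "sets \<nu> = sets borel" for \<nu> :: "'a measure"
    proof -
      have "(\<integral>\<^sup>+x. indicator U x * indicator A x \<partial>\<nu>) = (\<integral>\<^sup>+x. indicator (A \<inter> U) x \<partial>\<nu>)"
        by (intro nn_integral_cong) (auto simp: indicator_def)
      then show ?thesis using A U' that by (simp add: sets.Int)
    qed
    have "emeasure \<nu>1 (A \<inter> U) \<le> ?k * emeasure \<nu>2 (A \<inter> U)"
      using emeasure_le_of_ball_bounds[OF sets1 sets2 fin C a upper lower U, of "A \<inter> U"] A U'
      by simp
    then show "emeasure (density \<nu>1 (indicator U)) A
        \<le> emeasure (scale_measure ?k (density \<nu>2 (indicator U))) A"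
      using A by (simp add: emeasure_density ind sets1 sets2 e)
  qed
  then have "(\<integral>\<^sup>+x. f x \<partial>density \<nu>1 (indicator U)) \<le> (\<integral>\<^sup>+x. f x \<partial>scale_measure ?k (density \<nu>2 (indicator U)))"
    by (rule nn_integral_mono_measure[OF sets12])
  also have "\<dots> = ?k * (\<integral>\<^sup>+x. f x \<partial>density \<nu>2 (indicator U))"
    using f1 by (intro nn_integral_scale_measure) auto
  finally show ?thesis
    by (simp add: nn_integral_density[OF ind(1) f1(1)] nn_integral_density[OF ind(2) f1(2)] mult.commute)
qed

section \<open>Hitting small sets by an iterated random map\<close>

text \<open>Bounded Borel functions are stable under the Markov operator and integrable for every
  Borel probability measure, so the integrability conditions below reduce to closure rules.\<close>

definition bfun :: "('a::topological_space \<Rightarrow> real) \<Rightarrow> bool" where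
  "bfun f \<longleftrightarrow> f \<in> borel_measurable borel \<and> (\<exists>c. \<forall>x. \<bar>f x\<bar> \<le> c)"

lemma bfunI: "f \<in> borel_measurable borel \<Longrightarrow> (\<And>x. \<bar>f x\<bar> \<le> c) \<Longrightarrow> bfun f"
  unfolding bfun_def by blast

lemma bfun_measurable: "bfun f \<Longrightarrow> f \<in> borel_measurable borel"
  unfolding bfun_def by blast

lemma bfun_const: "bfun (\<lambda>x. c)"
  by (rule bfunI[of _ "\<bar>c\<bar>"]) auto

lemma bfun_indicator: "A \<in> sets borel \<Longrightarrow> bfun (indicator A)"
  by (rule bfunI[of _ 1]) auto

lemma bfun_abs: assumes "bfun f" shows "bfun (\<lambda>x. \<bar>f x\<bar>)"
  using assms unfolding bfun_def by auto

lemma bfun_add: assumes "bfun f" "bfun g" shows "bfun (\<lambda>x. f x + g x)"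
proof -
  obtain c d where "\<And>x. \<bar>f x\<bar> \<le> c" "\<And>x. \<bar>g x\<bar> \<le> d" using assms unfolding bfun_def by metis
  then have "\<bar>f x + g x\<bar> \<le> c + d" for x by (meson abs_triangle_ineq add_mono order_trans)
  then show ?thesis
    using bfun_measurable[OF assms(1)] bfun_measurable[OF assms(2)] by (intro bfunI[of _ "c + d"]) auto
qed

lemma bfun_mult: assumes "bfun f" "bfun g" shows "bfun (\<lambda>x. f x * g x)"
proof -
  obtain c d where cd: "\<And>x. \<bar>f x\<bar> \<le> c" "\<And>x. \<bar>g x\<bar> \<le> d" using assms unfolding bfun_def by metis
  have "\<bar>f x * g x\<bar> \<le> c * d" for x
    unfolding abs_mult using cd[of x] by (intro mult_mono) auto
  then show ?thesis
    using bfun_measurable[OF assms(1)] bfun_measurable[OF assms(2)] by (intro bfunI[of _ "c * d"]) auto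
qed

lemma bfun_diff: "bfun f \<Longrightarrow> bfun g \<Longrightarrow> bfun (\<lambda>x. f x - g x)"
  using bfun_add[of f "\<lambda>x. (- 1) * g x"] bfun_mult[OF bfun_const[of "- 1"], of g] by simp

lemma bfun_sum: "(\<And>i. i \<in> I \<Longrightarrow> bfun (f i)) \<Longrightarrow> bfun (\<lambda>x. \<Sum>i\<in>I. f i x)"
  by (induction I rule: infinite_finite_induct) (auto intro: bfun_add bfun_const)

lemmas bfun_intros = bfun_const bfun_indicator bfun_abs bfun_add bfun_mult bfun_diff bfun_sum

text \<open>Since 0 \<le> 1 - a \<le> 1, earlier errors are not amplified and the n errors simply
  add.\<close>

lemma recursion_approx_power:
  fixes q :: "nat \<Rightarrow> real"
  assumes "q 0 = 1" "0 \<le> a" "a \<le> 1" and step: "\<And>m. \<bar>q (Suc m) - (1 - a) * q m\<bar> \<le> e"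
  shows "\<bar>q n - (1 - a) ^ n\<bar> \<le> real n * e"
proof (induction n)
  case (Suc n)
  have "\<bar>q (Suc n) - (1 - a) ^ Suc n\<bar>
      \<le> \<bar>q (Suc n) - (1 - a) * q n\<bar> + \<bar>(1 - a) * (q n - (1 - a) ^ n)\<bar>"
    by (simp add: algebra_simps)
  also have "\<dots> \<le> e + 1 * \<bar>q n - (1 - a) ^ n\<bar>"
    unfolding abs_mult using assms by (intro add_mono mult_right_mono step) auto
  also have "\<dots> \<le> e + real n * e" using Suc by simp
  finally show ?case by (simp add: algebra_simps)
qed (simp add: assms)

lemma one_minus_power_tendsto_exp:
  fixes a :: "nat \<Rightarrow> real"
  assumes lim: "(\<lambda>n. real n * a n) \<longlonglongrightarrow> \<tau>" and nonneg: "\<And>n. 0 \<le> a n"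
  shows "(\<lambda>n. (1 - a n) ^ n) \<longlonglongrightarrow> exp (- \<tau>)"
proof -
  have a0: "a \<longlonglongrightarrow> 0"
  proof -
    have "(\<lambda>n. (real n * a n) * (1 / real n)) \<longlonglongrightarrow> \<tau> * 0"
      by (intro tendsto_mult lim lim_1_over_n)
    moreover have "\<forall>\<^sub>F n in sequentially. (real n * a n) * (1 / real n) = a n"
      using eventually_gt_at_top[of 0] by eventually_elim simp
    ultimately show ?thesis by (simp add: Lim_transform_eventually)
  qed
  \<comment> \<open>The range in which the quadratic lower bound for \<open>ln (1 - a)\<close>
    holds, and in which the logarithm has a positive argument.\<close>
  then have small: "\<forall>\<^sub>F n in sequentially. a n < 1/2" by (rule order_tendstoD) simp
  have lnlim: "(\<lambda>n. real n * ln (1 - a n)) \<longlonglongrightarrow> - \<tau>"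
  proof (rule tendsto_sandwich)
    show "\<forall>\<^sub>F n in sequentially. - (real n * a n) - 2 * (real n * a n) * a n \<le> real n * ln (1 - a n)"
      using small
    proof eventually_elim
      case (elim n)
      then have "- a n - 2 * (a n)\<^sup>2 \<le> ln (1 - a n)"
        using nonneg[of n] by (intro ln_one_minus_pos_lower_bound) auto
      then have "real n * (- a n - 2 * (a n)\<^sup>2) \<le> real n * ln (1 - a n)"
        by (rule mult_left_mono) simp
      then show ?case by (simp add: algebra_simps power2_eq_square)
    qed
    show "\<forall>\<^sub>F n in sequentially. real n * ln (1 - a n) \<le> - (real n * a n)"
      using small
    proof eventually_elim
      case (elim n)
      then have "ln (1 - a n) \<le> - a n" using ln_le_minus_one[of "1 - a n"] by simp
      then have "real n * ln (1 - a n) \<le> real n * - a n" by (rule mult_left_mono) simp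
      then show ?case by simp
    qed
    have "(\<lambda>n. - (real n * a n) - 2 * (real n * a n) * a n) \<longlonglongrightarrow> - \<tau> - 2 * \<tau> * 0"
      by (intro tendsto_intros lim a0)
    then show "(\<lambda>n. - (real n * a n) - 2 * (real n * a n) * a n) \<longlonglongrightarrow> - \<tau>" by simp
    show "(\<lambda>n. - (real n * a n)) \<longlonglongrightarrow> - \<tau>" by (intro tendsto_intros lim)
  qed
  have "(\<lambda>n. exp (real n * ln (1 - a n))) \<longlonglongrightarrow> exp (- \<tau>)"
    by (intro tendsto_exp lnlim)
  then show ?thesis
  proof (rule Lim_transform_eventually)
    show "\<forall>\<^sub>F n in sequentially. exp (real n * ln (1 - a n)) = (1 - a n) ^ n"
      using small by eventually_elim (simp add: exp_of_nat_mult)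
  qed
qed

section \<open>Stationary chains generated by a random map, and their Markov operator\<close>

locale random_map = prob_space M for M :: "'w measure" +
  fixes \<mu> :: "'a::euclidean_space measure" and \<Phi> :: "'a \<Rightarrow> 'w \<Rightarrow> 'a"
  assumes prob_mu: "prob_space \<mu>" and sets_mu: "sets \<mu> = sets borel"
    and measurable_map: "(\<lambda>(x, \<omega>). \<Phi> x \<omega>) \<in> borel \<Otimes>\<^sub>M M \<rightarrow>\<^sub>M borel"
    and invariant: "distr (M \<Otimes>\<^sub>M \<mu>) borel (\<lambda>(\<omega>, x). \<Phi> x \<omega>) = \<mu>"
begin

sublocale mu: prob_space \<mu> by (rule prob_mu)

text \<open>The transition kernel acting on functions. Its powers stand for several steps of the
  chain, so the abstract argument never constructs a path space; paths reappear only when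
  \<open>survive\<close> is identified for the solution.\<close>

definition Op :: "('a \<Rightarrow> real) \<Rightarrow> 'a \<Rightarrow> real" where
  "Op f x = (\<integral>\<omega>. f (\<Phi> x \<omega>) \<partial>M)"

lemma space_mu: "space \<mu> = UNIV"
  using sets_eq_imp_space_eq[OF sets_mu] by simp

lemma measurable_section: "\<Phi> x \<in> M \<rightarrow>\<^sub>M borel"
  using measurable_compose[OF measurable_Pair1' measurable_map, of x] by simp

lemma bfun_integrable_mu: "bfun f \<Longrightarrow> integrable \<mu> f"
  unfolding bfun_def
  using mu.integrable_const_bound[of f] measurable_cong_sets[OF sets_mu refl, of borel]
  by (metis (no_types, lifting) AE_I2 real_norm_def)

lemma bfun_integrable_section:
  assumes "bfun f" shows "integrable M (\<lambda>\<omega>. f (\<Phi> x \<omega>))"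
proof -
  obtain c where c: "\<And>x. \<bar>f x\<bar> \<le> c" using assms unfolding bfun_def by blast
  show ?thesis
    using c measurable_compose[OF measurable_section bfun_measurable[OF assms]]
    by (intro integrable_const_bound[of _ c]) auto
qed

lemma Op_abs_le: assumes "bfun f" "\<And>x. \<bar>f x\<bar> \<le> c" shows "\<bar>Op f x\<bar> \<le> c"
proof -
  have "\<bar>Op f x\<bar> \<le> (\<integral>\<omega>. \<bar>f (\<Phi> x \<omega>)\<bar> \<partial>M)" unfolding Op_def by (rule integral_abs_bound)
  also have "\<dots> \<le> (\<integral>\<omega>. c \<partial>M)"
    using assms by (intro integral_mono bfun_integrable_section[OF bfun_abs]) auto
  finally show ?thesis by (simp add: prob_space)
qed

lemma bfun_Op: assumes "bfun f" shows "bfun (Op f)"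
proof -
  obtain c where c: "\<And>x. \<bar>f x\<bar> \<le> c" using assms unfolding bfun_def by blast
  have "(\<lambda>(x, \<omega>). f (\<Phi> x \<omega>)) \<in> borel_measurable (borel \<Otimes>\<^sub>M M)"
    using measurable_compose[OF measurable_map bfun_measurable[OF assms]]
    by (simp add: case_prod_beta')
  then have "(\<lambda>x. \<integral>\<omega>. f (\<Phi> x \<omega>) \<partial>M) \<in> borel_measurable borel"
    by (rule borel_measurable_lebesgue_integral)
  then have "Op f \<in> borel_measurable borel" unfolding Op_def[abs_def] .
  then show ?thesis using Op_abs_le[OF assms c] by (rule bfunI)
qed

lemma bfun_Op_pow: "bfun f \<Longrightarrow> bfun ((Op ^^ l) f)"
  by (induction l) (auto intro: bfun_Op)

lemma Op_mono: "bfun f \<Longrightarrow> bfun g \<Longrightarrow> (\<And>y. f y \<le> g y) \<Longrightarrow> Op f x \<le> Op g x"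
  unfolding Op_def by (intro integral_mono bfun_integrable_section) auto

lemma Op_const: "Op (\<lambda>y. c) x = c"
  unfolding Op_def by (simp add: prob_space)

lemma Op_add: "bfun f \<Longrightarrow> bfun g \<Longrightarrow> Op (\<lambda>y. f y + g y) x = Op f x + Op g x"
  unfolding Op_def by (intro Bochner_Integration.integral_add bfun_integrable_section)

lemma Op_diff: "bfun f \<Longrightarrow> bfun g \<Longrightarrow> Op (\<lambda>y. f y - g y) x = Op f x - Op g x"
  unfolding Op_def by (intro Bochner_Integration.integral_diff bfun_integrable_section)

lemma Op_sum: "(\<And>i. i \<in> I \<Longrightarrow> bfun (f i)) \<Longrightarrow> Op (\<lambda>y. \<Sum>i\<in>I. f i y) x = (\<Sum>i\<in>I. Op (f i) x)"
  unfolding Op_def by (intro Bochner_Integration.integral_sum bfun_integrable_section)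

lemma Op_pow_const: "(Op ^^ l) (\<lambda>y. c) = (\<lambda>y. c)"
  by (induction l) (auto simp: Op_const)

lemma Op_pow_diff_const: "bfun f \<Longrightarrow> (Op ^^ l) (\<lambda>y. f y - c) = (\<lambda>x. (Op ^^ l) f x - c)"
  by (induction l) (auto simp: Op_diff Op_const bfun_Op_pow bfun_const)

lemma Op_pow_le: assumes "bfun f" "\<And>x. f x \<le> c" shows "(Op ^^ l) f x \<le> c"
proof (induction l arbitrary: x)
  case (Suc l)
  have "Op ((Op ^^ l) f) x \<le> Op (\<lambda>y. c) x"
    using assms Suc by (intro Op_mono bfun_intros bfun_Op_pow) auto
  then show ?case by (simp add: Op_const)
qed (simp add: assms)

lemma Op_pow_abs_le: "bfun f \<Longrightarrow> (\<And>x. \<bar>f x\<bar> \<le> c) \<Longrightarrow> \<bar>(Op ^^ l) f x\<bar> \<le> c"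
  by (induction l arbitrary: x) (auto intro: Op_abs_le bfun_Op_pow)

lemma Op_indicator: "A \<in> sets borel \<Longrightarrow> Op (indicator A) x = measure (distr M borel (\<Phi> x)) A"
proof -
  assume A: "A \<in> sets borel"
  have "Op (indicator A) x = (\<integral>y. indicator A y \<partial>distr M borel (\<Phi> x))"
    unfolding Op_def using A by (intro integral_distr[symmetric] measurable_section) simp
  then show ?thesis using A by simp
qed

text \<open>Invariance in its dual form: the image measure formula followed by Fubini on the product
  of noise and stationary start.\<close>

lemma integral_Op: assumes "bfun f" shows "(\<integral>x. Op f x \<partial>\<mu>) = (\<integral>x. f x \<partial>\<mu>)"
proof -
  interpret P: pair_prob_space M \<mu> by unfold_locales
  obtain c where c: "\<And>x. \<bar>f x\<bar> \<le> c" using assms unfolding bfun_def by blast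
  have "(\<lambda>(\<omega>, x). \<Phi> x \<omega>) = (\<lambda>(x, \<omega>). \<Phi> x \<omega>) \<circ> (\<lambda>(\<omega>, x). (x, \<omega>))" by auto
  also have "\<dots> \<in> M \<Otimes>\<^sub>M borel \<rightarrow>\<^sub>M borel"
    by (rule measurable_comp[OF _ measurable_map]) measurable
  finally have m: "(\<lambda>(\<omega>, x). \<Phi> x \<omega>) \<in> M \<Otimes>\<^sub>M \<mu> \<rightarrow>\<^sub>M borel"
    using sets_pair_measure_cong[OF refl sets_mu, of M] by (simp cong: measurable_cong_sets)
  have mf: "(\<lambda>(\<omega>, x). f (\<Phi> x \<omega>)) \<in> borel_measurable (M \<Otimes>\<^sub>M \<mu>)"
    using measurable_compose[OF m bfun_measurable[OF assms]] by (simp add: case_prod_beta')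
  have "(\<integral>x. f x \<partial>\<mu>) = (\<integral>x. f x \<partial>distr (M \<Otimes>\<^sub>M \<mu>) borel (\<lambda>(\<omega>, x). \<Phi> x \<omega>))"
    by (simp add: invariant)
  also have "\<dots> = (\<integral>z. f ((\<lambda>(\<omega>, x). \<Phi> x \<omega>) z) \<partial>(M \<Otimes>\<^sub>M \<mu>))"
    by (rule integral_distr[OF m bfun_measurable[OF assms]])
  also have "\<dots> = (\<integral>(\<omega>, x). f (\<Phi> x \<omega>) \<partial>(M \<Otimes>\<^sub>M \<mu>))"
    by (simp add: case_prod_beta')
  also have "\<dots> = (\<integral>x. \<integral>\<omega>. f (\<Phi> x \<omega>) \<partial>M \<partial>\<mu>)"
    using c by (intro P.integral_snd[symmetric] P.integrable_const_bound[of _ c] mf) auto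
  finally show ?thesis unfolding Op_def by simp
qed

lemma integral_Op_pow: "bfun f \<Longrightarrow> (\<integral>x. (Op ^^ l) f x \<partial>\<mu>) = (\<integral>x. f x \<partial>\<mu>)"
  by (induction l) (auto simp: integral_Op bfun_Op_pow)

lemma integral_indicator_mu: "A \<in> sets borel \<Longrightarrow> (\<integral>x. indicator A x \<partial>\<mu>) = measure \<mu> A"
  using sets_mu by simp

subsection \<open>Survival probabilities\<close>

text \<open>The probability that the chain started at x avoids B at the times 0, ..., n - 1. Time 0
  is included, so there are n constraints and \<open>survive B 0\<close> is constantly 1.\<close>

primrec survive :: "'a set \<Rightarrow> nat \<Rightarrow> 'a \<Rightarrow> real" where
  "survive B 0 = (\<lambda>x. 1)"
| "survive B (Suc n) = (\<lambda>x. indicator (- B) x * Op (survive B n) x)"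

context
  fixes B :: "'a set" assumes B: "B \<in> sets borel"
begin

lemma B_compl: "- B \<in> sets borel" using B by auto

lemma bfun_survive: "bfun (survive B n)"
  by (induction n) (auto intro!: bfun_intros bfun_Op B_compl)

lemma survive_bounds: "0 \<le> survive B n x \<and> survive B n x \<le> 1"
proof (induction n arbitrary: x)
  case (Suc n)
  have "Op (\<lambda>y. 0) x \<le> Op (survive B n) x" "Op (survive B n) x \<le> Op (\<lambda>y. 1) x"
    using Suc by (intro Op_mono bfun_survive bfun_const; simp)+
  then show ?case by (auto simp: Op_const indicator_def)
qed simp

lemma Op_survive_bounds: "0 \<le> Op (survive B n) x \<and> Op (survive B n) x \<le> 1"
proof -
  have "Op (\<lambda>y. 0) x \<le> Op (survive B n) x" "Op (survive B n) x \<le> Op (\<lambda>y. 1) x"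
    using survive_bounds by (intro Op_mono bfun_survive bfun_const; simp)+
  then show ?thesis by (simp add: Op_const)
qed

text \<open>The power of \<open>Op\<close> lets the first l steps pass without the constraints at
  the times 0, ..., l - 1; removing constraints can only raise the probability.\<close>

lemma survive_le_Op_pow: "survive B (n + l) x \<le> (Op ^^ l) (survive B n) x"
proof (induction l arbitrary: x)
  case (Suc l)
  have "survive B (n + Suc l) x \<le> Op (survive B (n + l)) x"
    using Op_survive_bounds[of "n + l" x] by (auto simp: indicator_def)
  also have "\<dots> \<le> Op ((Op ^^ l) (survive B n)) x"
    using Suc by (intro Op_mono bfun_survive bfun_Op_pow)
  finally show ?case by simp
qed simp

text \<open>Union bound for the converse: what is gained by ignoring the first l constraints is at
  most the expected number of visits to B during them.\<close>

lemma Op_pow_le_survive: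
  "(Op ^^ l) (survive B n) x \<le> survive B (n + l) x + (\<Sum>j<l. (Op ^^ j) (indicator B) x)"
proof (induction l arbitrary: x)
  case (Suc l)
  have "(Op ^^ Suc l) (survive B n) x \<le> Op (\<lambda>x. survive B (n + l) x + (\<Sum>j<l. (Op ^^ j) (indicator B) x)) x"
    using Suc by (simp, intro Op_mono bfun_intros bfun_survive bfun_Op_pow B)
  also have "\<dots> = Op (survive B (n + l)) x + (\<Sum>j<l. (Op ^^ Suc j) (indicator B) x)"
    by (subst Op_add, intro bfun_survive, intro bfun_intros bfun_Op_pow B)
      (subst Op_sum, auto intro: bfun_intros bfun_Op_pow B)
  also have "Op (survive B (n + l)) x \<le> survive B (n + Suc l) x + indicator B x"
    using Op_survive_bounds[of "n + l" x] by (auto simp: indicator_def)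
  finally show ?case by (simp add: sum.lessThan_Suc_shift del: sum.lessThan_Suc)
qed simp

text \<open>The extra application of \<open>Op\<close> moves the ignored constraints to the times 1,
  ..., l, where every visit has probability at most \<beta> from any start. Without it the start
  itself, which will lie in B, would count as a visit.\<close>

lemma Op_survive_approx:
  assumes \<beta>: "\<And>x. Op (indicator B) x \<le> \<beta>"
  shows "\<bar>Op (survive B (n + l)) x - (Op ^^ Suc l) (survive B n) x\<bar> \<le> real l * \<beta>"
proof -
  have "Op (survive B (n + l)) x \<le> (Op ^^ Suc l) (survive B n) x"
    using survive_le_Op_pow by (simp, intro Op_mono bfun_survive bfun_Op_pow)
  moreover have "(Op ^^ Suc l) (survive B n) x \<le> Op (survive B (n + l)) x + (\<Sum>j<l. (Op ^^ Suc j) (indicator B) x)"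
  proof -
    have "(Op ^^ Suc l) (survive B n) x \<le> Op (\<lambda>x. survive B (n + l) x + (\<Sum>j<l. (Op ^^ j) (indicator B) x)) x"
      using Op_pow_le_survive by (simp, intro Op_mono bfun_intros bfun_survive bfun_Op_pow B)
    also have "\<dots> = Op (survive B (n + l)) x + (\<Sum>j<l. (Op ^^ Suc j) (indicator B) x)"
      by (subst Op_add, intro bfun_survive, intro bfun_intros bfun_Op_pow B)
        (subst Op_sum, auto intro: bfun_intros bfun_Op_pow B)
    finally show ?thesis .
  qed
  moreover have "(\<Sum>j<l. (Op ^^ Suc j) (indicator B) x) \<le> real l * \<beta>"
  proof -
    have "(Op ^^ Suc j) (indicator B) x \<le> \<beta>" for j
      using Op_pow_le[of "Op (indicator B)" \<beta> j x] \<beta> bfun_Op[OF bfun_indicator[OF B]]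
      by (simp add: funpow_Suc_right del: funpow.simps)
    then have "(\<Sum>j<l. (Op ^^ Suc j) (indicator B) x) \<le> real (card {..<l}) * \<beta>"
      by (intro sum_bounded_above) auto
    then show ?thesis by simp
  qed
  ultimately show ?thesis by linarith
qed

text \<open>Under the stationary law each of the l ignored visits has probability exactly
  mu(B).\<close>

lemma integral_survive_approx:
  "\<bar>(\<integral>x. survive B (n + l) x \<partial>\<mu>) - (\<integral>x. survive B n x \<partial>\<mu>)\<bar> \<le> real l * measure \<mu> B"
proof -
  have "(\<integral>x. survive B (n + l) x \<partial>\<mu>) \<le> (\<integral>x. (Op ^^ l) (survive B n) x \<partial>\<mu>)"
    using survive_le_Op_pow by (intro integral_mono bfun_integrable_mu bfun_survive bfun_Op_pow)
  moreover have "(\<integral>x. (Op ^^ l) (survive B n) x \<partial>\<mu>)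
      \<le> (\<integral>x. survive B (n + l) x + (\<Sum>j<l. (Op ^^ j) (indicator B) x) \<partial>\<mu>)"
    using Op_pow_le_survive
    by (intro integral_mono bfun_integrable_mu bfun_intros bfun_survive bfun_Op_pow B)
  moreover have "\<dots> = (\<integral>x. survive B (n + l) x \<partial>\<mu>) + real l * measure \<mu> B"
    by (subst Bochner_Integration.integral_add, (intro bfun_integrable_mu bfun_intros bfun_survive bfun_Op_pow B)+)
      (subst Bochner_Integration.integral_sum, auto intro!: bfun_integrable_mu bfun_intros bfun_Op_pow B
        simp: integral_Op_pow bfun_indicator B space_mu)
  ultimately show ?thesis by (simp add: integral_Op_pow bfun_survive)
qed

text \<open>The loss in one step is an integral over B, so each error carries a factor mu(B), which
  n steps turn into n * mu(B). Hence a fixed l and a small \<theta> suffice, and mixing is required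
  only for starts in B.\<close>

lemma integral_survive_approx_power:
  assumes \<beta>: "\<And>x. Op (indicator B) x \<le> \<beta>" and "0 \<le> \<theta>"
    and mix: "\<And>f x. bfun f \<Longrightarrow> (\<And>y. 0 \<le> f y \<and> f y \<le> 1) \<Longrightarrow> x \<in> B \<Longrightarrow>
                \<bar>(Op ^^ Suc l) f x - (\<integral>y. f y \<partial>\<mu>)\<bar> \<le> \<theta>"
  shows "\<bar>(\<integral>x. survive B n x \<partial>\<mu>) - (1 - measure \<mu> B) ^ n\<bar>
           \<le> real n * (measure \<mu> B * (real l * (\<beta> + measure \<mu> B) + \<theta>))"
proof (rule recursion_approx_power)
  let ?a = "measure \<mu> B" and ?q = "\<lambda>n. \<integral>x. survive B n x \<partial>\<mu>"
  let ?E = "real l * (\<beta> + ?a) + \<theta>"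
  have \<beta>0: "0 \<le> \<beta>"
  proof -
    have "Op (\<lambda>y. 0) undefined \<le> Op (indicator B) undefined"
      by (intro Op_mono bfun_intros B) auto
    then show ?thesis using \<beta>[of undefined] by (simp add: Op_const)
  qed
  \<comment> \<open>A gap of l steps is inserted: forgetting the constraints inside it costs l *
    \<beta> from the point x and l * mu(B) in the mean, and mixing across the gap costs
    \<theta>.\<close>
  have pt: "\<bar>Op (survive B m) x - ?q m\<bar> \<le> ?E" if x: "x \<in> B" for m x
  proof (cases "l \<le> m")
    case True
    then obtain n where n: "m = n + l" by (metis add.commute le_Suc_ex)
    have "\<bar>Op (survive B (n + l)) x - (Op ^^ Suc l) (survive B n) x\<bar> \<le> real l * \<beta>"
      by (rule Op_survive_approx[OF \<beta>])
    moreover have "\<bar>(Op ^^ Suc l) (survive B n) x - ?q n\<bar> \<le> \<theta>"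
      using survive_bounds x by (intro mix bfun_survive)
    moreover have "\<bar>?q (n + l) - ?q n\<bar> \<le> real l * ?a" by (rule integral_survive_approx)
    ultimately show ?thesis unfolding n distrib_left by linarith
  next
    case False
    \<comment> \<open>If m is smaller than l there is no room for the gap, but both quantities are
      then within m visits of 1.\<close>
    have "\<bar>Op (survive B (0 + m)) x - (Op ^^ Suc m) (survive B 0) x\<bar> \<le> real m * \<beta>"
      by (rule Op_survive_approx[OF \<beta>])
    moreover have "(Op ^^ Suc m) (survive B 0) x = 1"
      unfolding survive.simps Op_pow_const ..
    moreover have "\<bar>?q (0 + m) - ?q 0\<bar> \<le> real m * ?a" by (rule integral_survive_approx)
    moreover have "?q 0 = 1" using mu.prob_space by simp
    moreover have "real m * \<beta> \<le> real l * \<beta>" "real m * ?a \<le> real l * ?a"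
      using False \<beta>0 by (intro mult_right_mono; simp)+
    ultimately show ?thesis unfolding distrib_left using \<open>0 \<le> \<theta>\<close> by simp
  qed
  fix m
  have i1: "integrable \<mu> (\<lambda>x. indicator B x * Op (survive B m) x)"
    by (intro bfun_integrable_mu bfun_intros B bfun_Op bfun_survive)
  have i2: "integrable \<mu> (\<lambda>x. indicator B x * ?q m)"
    by (intro bfun_integrable_mu bfun_intros B)
  \<comment> \<open>Invariance inserts one \<open>Op\<close> under the first integral; the two
    integrands then agree outside B.\<close>
  have "?q m - ?q (Suc m) = (\<integral>x. Op (survive B m) x \<partial>\<mu>) - (\<integral>x. survive B (Suc m) x \<partial>\<mu>)"
    by (simp only: integral_Op bfun_survive)
  also have "\<dots> = (\<integral>x. Op (survive B m) x - survive B (Suc m) x \<partial>\<mu>)"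
    by (intro Bochner_Integration.integral_diff[symmetric] bfun_integrable_mu bfun_Op bfun_survive)
  also have "\<dots> = (\<integral>x. indicator B x * Op (survive B m) x \<partial>\<mu>)"
    by (intro Bochner_Integration.integral_cong) (auto simp: indicator_def)
  finally have q1: "?q m - ?q (Suc m) = (\<integral>x. indicator B x * Op (survive B m) x \<partial>\<mu>)" .
  have q2: "?a * ?q m = (\<integral>x. indicator B x * ?q m \<partial>\<mu>)"
    using integral_indicator_mu[OF B] by simp
  have "?a * ?q m - (?q m - ?q (Suc m)) = (\<integral>x. indicator B x * ?q m - indicator B x * Op (survive B m) x \<partial>\<mu>)"
    unfolding q1 q2 by (rule Bochner_Integration.integral_diff[OF i2 i1, symmetric])
  then have "\<bar>?q (Suc m) - (1 - ?a) * ?q m\<bar>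
      = \<bar>\<integral>x. indicator B x * ?q m - indicator B x * Op (survive B m) x \<partial>\<mu>\<bar>"
    by (simp add: algebra_simps)
  also have "\<dots> \<le> (\<integral>x. \<bar>indicator B x * ?q m - indicator B x * Op (survive B m) x\<bar> \<partial>\<mu>)"
    by (rule integral_abs_bound)
  also have "\<dots> \<le> (\<integral>x. indicator B x * ?E \<partial>\<mu>)"
    by (intro integral_mono bfun_integrable_mu bfun_intros B bfun_Op bfun_survive)
      (use pt in \<open>auto simp: indicator_def abs_minus_commute\<close>)
  also have "\<dots> = ?a * ?E" using integral_indicator_mu[OF B] by simp
  finally show "\<bar>?q (Suc m) - (1 - ?a) * ?q m\<bar> \<le> ?a * ?E" .
qed (use mu.prob_space in auto)

end

end

text \<open>The upper bound is uniform over all starts, the lower one and tightness only over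
  bounded sets of starts. The lower bound stops at r = 1 because a probability cannot grow like a
  power of r.\<close>

locale bounded_random_map = random_map M \<mu> \<Phi>
  for M :: "'w measure" and \<mu> :: "'a::euclidean_space measure" and \<Phi> :: "'a \<Rightarrow> 'w \<Rightarrow> 'a" +
  fixes C :: real
  assumes C_pos: "0 < C"
    and upper: "\<And>x y r. 0 < r \<Longrightarrow> measure (distr M borel (\<Phi> x)) (ball y r) \<le> C * r ^ DIM('a)"
    and lower: "\<And>R. \<exists>\<alpha>>0. \<forall>x\<in>ball 0 R. \<forall>y\<in>ball 0 R. \<forall>r. 0 < r \<longrightarrow> r \<le> 1 \<longrightarrow>
                  \<alpha> * r ^ DIM('a) \<le> measure (distr M borel (\<Phi> x)) (ball y r)"
    and tight: "\<And>R \<epsilon>. 0 < \<epsilon> \<Longrightarrow> \<exists>R'. \<forall>x\<in>ball 0 R. measure (distr M borel (\<Phi> x)) (- ball 0 R') \<le> \<epsilon>"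
begin

section \<open>Ball bounds for the stationary law and its comparison with the kernel\<close>

lemma Op_ball_le: "0 < r \<Longrightarrow> Op (indicator (ball y r)) x \<le> C * r ^ DIM('a)"
  using upper by (simp add: Op_indicator)

lemma mu_ball_eq: "measure \<mu> (ball y r) = (\<integral>x. Op (indicator (ball y r)) x \<partial>\<mu>)"
  by (simp only: integral_Op bfun_indicator integral_indicator_mu borel_open open_ball)

lemma mu_ball_le: assumes "0 < r" shows "measure \<mu> (ball y r) \<le> C * r ^ DIM('a)"
proof -
  have "measure \<mu> (ball y r) \<le> (\<integral>x. C * r ^ DIM('a) \<partial>\<mu>)"
    unfolding mu_ball_eq using Op_ball_le[OF assms]
    by (intro integral_mono bfun_integrable_mu bfun_intros bfun_Op) auto
  then show ?thesis using mu.prob_space by simp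
qed

lemma mu_ball_tendsto: "(\<lambda>n. measure \<mu> (ball 0 (real n))) \<longlonglongrightarrow> 1"
proof -
  have "(\<Union>n. ball 0 (real n)) = (UNIV :: 'a set)"
    using reals_Archimedean2 by (auto simp: ball_def)
  moreover have "(\<lambda>n. measure \<mu> (ball 0 (real n))) \<longlonglongrightarrow> measure \<mu> (\<Union>n. ball 0 (real n))"
    by (rule mu.finite_Lim_measure_incseq) (auto simp: sets_mu incseq_def)
  ultimately show ?thesis using mu.prob_space by (simp add: space_mu)
qed

lemma mu_ball_large: assumes "0 < \<epsilon>" obtains R' where "R \<le> R'" "1 - \<epsilon> < measure \<mu> (ball 0 R')"
proof -
  have "\<forall>\<^sub>F n in sequentially. 1 - \<epsilon> < measure \<mu> (ball 0 (real n)) \<and> R \<le> real n"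
    using order_tendstoD(1)[OF mu_ball_tendsto, of "1 - \<epsilon>"] assms eventually_ge_at_top[of "nat \<lceil>R\<rceil>"]
    by (auto simp: eventually_conj_iff nat_ceiling_le_eq)
  then show ?thesis using that eventually_happens'[OF sequentially_bot] by blast
qed

text \<open>By stationarity the mass of a ball is the mean of its one-step hitting probability;
  starts in a ball carrying at least half of the mass already contribute \<alpha>/2 times the power
  of r.\<close>

lemma mu_ball_ge:
  "\<exists>a>0. \<forall>y\<in>ball 0 R. \<forall>r. 0 < r \<longrightarrow> r \<le> 1 \<longrightarrow> a * r ^ DIM('a) \<le> measure \<mu> (ball y r)"
proof -
  \<comment> \<open>R' is at least R, so that the lower bound on the large ball covers the centres y
    as well as the starts.\<close>
  obtain R' where R': "R \<le> R'" "1 - 1/2 < measure \<mu> (ball 0 R')" by (rule mu_ball_large[of "1/2"]) auto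
  obtain \<alpha> where \<alpha>: "\<alpha> > 0" "\<And>x y r. x \<in> ball 0 R' \<Longrightarrow> y \<in> ball 0 R' \<Longrightarrow> 0 < r \<Longrightarrow> r \<le> 1 \<Longrightarrow>
      \<alpha> * r ^ DIM('a) \<le> Op (indicator (ball y r)) x"
    using lower[of R'] by (auto simp: Op_indicator)
  show ?thesis
  proof (intro exI[of _ "\<alpha> / 2"] conjI ballI allI impI)
    fix y :: 'a and r :: real assume y: "y \<in> ball 0 R" and r: "0 < r" "r \<le> 1"
    have nonneg: "0 \<le> Op (indicator (ball y r)) x" for x
      by (simp add: Op_indicator)
    have "\<alpha> / 2 * r ^ DIM('a) \<le> measure \<mu> (ball 0 R') * (\<alpha> * r ^ DIM('a))"
      using R'(2) \<alpha>(1) r by (simp add: field_simps)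
    also have "\<dots> = (\<integral>x. indicator (ball 0 R') x * (\<alpha> * r ^ DIM('a)) \<partial>\<mu>)"
      by (simp add: space_mu)
    also have "\<dots> \<le> measure \<mu> (ball y r)"
      unfolding mu_ball_eq
    proof (intro integral_mono bfun_integrable_mu bfun_intros bfun_Op)
      fix x show "indicator (ball 0 R') x * (\<alpha> * r ^ DIM('a)) \<le> Op (indicator (ball y r)) x"
        using \<alpha>(2)[of x y r] y r R'(1) nonneg[of x] by (cases "x \<in> ball 0 R'") auto
    qed auto
    finally show "\<alpha> / 2 * r ^ DIM('a) \<le> measure \<mu> (ball y r)" .
  qed (use \<alpha> in auto)
qed

lemma nn_integral_bfun_distr:
  assumes "bfun f" "\<And>x. 0 \<le> f x"
  shows "(\<integral>\<^sup>+y. ennreal (f y) \<partial>distr M borel (\<Phi> x)) = ennreal (Op f x)"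
  using assms bfun_measurable[OF assms(1)]
  by (simp add: nn_integral_distr measurable_section Op_def nn_integral_eq_integral bfun_integrable_section)

lemma nn_integral_bfun_mu:
  assumes "bfun f" "\<And>x. 0 \<le> f x"
  shows "(\<integral>\<^sup>+y. ennreal (f y) \<partial>\<mu>) = ennreal (\<integral>x. f x \<partial>\<mu>)"
  using assms by (simp add: nn_integral_eq_integral bfun_integrable_mu)

lemma integral_mu_bounds:
  assumes "bfun f" "\<And>y. 0 \<le> f y \<and> f y \<le> 1"
  shows "0 \<le> (\<integral>y. f y \<partial>\<mu>) \<and> (\<integral>y. f y \<partial>\<mu>) \<le> 1"
proof -
  have "(\<integral>y. f y \<partial>\<mu>) \<le> (\<integral>y. 1 \<partial>\<mu>)"
    using assms by (intro integral_mono bfun_integrable_mu bfun_const) auto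
  then show ?thesis using assms mu.prob_space by (auto intro!: Bochner_Integration.integral_nonneg)
qed

text \<open>Domination of the kernel by the stationary law inside a ball, with one constant for all
  starts: the upper ball bound does not depend on x, and the lower bound is that of \<mu>. This
  turns mean bounds into pointwise ones.\<close>

lemma Op_le_mu:
  "\<exists>c\<ge>0. \<forall>x f. bfun f \<longrightarrow> (\<forall>y. 0 \<le> f y) \<longrightarrow>
     Op (\<lambda>y. f y * indicator (ball 0 R) y) x \<le> c * (\<integral>y. f y * indicator (ball 0 R) y \<partial>\<mu>)"
proof -
  obtain a where a: "a > 0" "\<And>y r. y \<in> ball 0 R \<Longrightarrow> 0 < r \<Longrightarrow> r \<le> 1 \<Longrightarrow> a * r ^ DIM('a) \<le> measure \<mu> (ball y r)"
    using mu_ball_ge[of R] by blast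
  let ?c = "C * 5 ^ DIM('a) / a"
  have c0: "0 \<le> ?c" using C_pos a(1) by simp
  show ?thesis
  proof (intro exI[of _ ?c] conjI allI impI c0)
    fix x :: 'a and f :: "'a \<Rightarrow> real" assume f: "bfun f" "\<forall>y. 0 \<le> f y"
    interpret D: prob_space "distr M borel (\<Phi> x)" by (rule prob_space_distr[OF measurable_section])
    let ?g = "\<lambda>y. f y * indicator (ball 0 R) y"
    have g: "bfun ?g" "\<And>y. 0 \<le> ?g y" using f by (auto intro!: bfun_intros)
    have "(\<integral>\<^sup>+y. ennreal (f y) * indicator (ball 0 R) y \<partial>distr M borel (\<Phi> x))
        \<le> ennreal ?c * (\<integral>\<^sup>+y. ennreal (f y) * indicator (ball 0 R) y \<partial>\<mu>)"
      by (rule nn_integral_le_of_ball_bounds)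
        (use upper a C_pos sets_mu mu.finite_measure_axioms bfun_measurable[OF f(1)]
          in \<open>auto simp: D.emeasure_eq_measure mu.emeasure_eq_measure ennreal_leI\<close>)
    then have "ennreal (Op ?g x) \<le> ennreal ?c * ennreal (\<integral>y. ?g y \<partial>\<mu>)"
      unfolding nn_integral_bfun_distr[OF g, symmetric] nn_integral_bfun_mu[OF g, symmetric]
      using f(2) by (simp add: ennreal_mult'' ennreal_indicator)
    then have "ennreal (Op ?g x) \<le> ennreal (?c * (\<integral>y. ?g y \<partial>\<mu>))"
      using c0 g by (subst ennreal_mult) (auto intro!: Bochner_Integration.integral_nonneg)
    then show "Op ?g x \<le> ?c * (\<integral>y. ?g y \<partial>\<mu>)"
      using mult_nonneg_nonneg[OF c0 Bochner_Integration.integral_nonneg[OF g(2)]]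
      by (subst (asm) ennreal_le_iff) auto
  qed
qed

text \<open>The reverse comparison, with starts confined to the ball: a minorization of the kernel
  by the restricted stationary law. The constant is raised to at least 1, which later makes \<gamma>
  a number in (0, 1].\<close>

lemma mu_le_Op:
  "\<exists>c\<ge>1. \<forall>x\<in>ball 0 R. \<forall>f. bfun f \<longrightarrow> (\<forall>y. 0 \<le> f y) \<longrightarrow>
     (\<integral>y. f y * indicator (ball 0 R) y \<partial>\<mu>) \<le> c * Op (\<lambda>y. f y * indicator (ball 0 R) y) x"
proof -
  obtain a where a: "a > 0" "\<And>x y r. x \<in> ball 0 R \<Longrightarrow> y \<in> ball 0 R \<Longrightarrow> 0 < r \<Longrightarrow> r \<le> 1 \<Longrightarrow>
      a * r ^ DIM('a) \<le> measure (distr M borel (\<Phi> x)) (ball y r)"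
    using lower[of R] by auto
  let ?c = "C * 5 ^ DIM('a) / a"
  have c0: "0 \<le> ?c" using C_pos a(1) by simp
  show ?thesis
  proof (intro exI[of _ "max 1 ?c"] conjI ballI allI impI)
    fix x :: 'a and f :: "'a \<Rightarrow> real" assume x: "x \<in> ball 0 R" and f: "bfun f" "\<forall>y. 0 \<le> f y"
    interpret D: prob_space "distr M borel (\<Phi> x)" by (rule prob_space_distr[OF measurable_section])
    let ?g = "\<lambda>y. f y * indicator (ball 0 R) y"
    have g: "bfun ?g" "\<And>y. 0 \<le> ?g y" using f by (auto intro!: bfun_intros)
    have Op0: "0 \<le> Op ?g x" unfolding Op_def using g(2) by (intro Bochner_Integration.integral_nonneg) auto
    have "(\<integral>\<^sup>+y. ennreal (f y) * indicator (ball 0 R) y \<partial>\<mu>)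
        \<le> ennreal ?c * (\<integral>\<^sup>+y. ennreal (f y) * indicator (ball 0 R) y \<partial>distr M borel (\<Phi> x))"
      by (rule nn_integral_le_of_ball_bounds)
        (use mu_ball_le a x C_pos sets_mu D.finite_measure_axioms bfun_measurable[OF f(1)]
          in \<open>auto simp: D.emeasure_eq_measure mu.emeasure_eq_measure ennreal_leI\<close>)
    then have "ennreal (\<integral>y. ?g y \<partial>\<mu>) \<le> ennreal ?c * ennreal (Op ?g x)"
      unfolding nn_integral_bfun_distr[OF g, symmetric] nn_integral_bfun_mu[OF g, symmetric]
      using f(2) by (simp add: ennreal_mult'' ennreal_indicator)
    then have "ennreal (\<integral>y. ?g y \<partial>\<mu>) \<le> ennreal (?c * Op ?g x)"
      using c0 Op0 by (subst ennreal_mult) auto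
    then have "(\<integral>y. ?g y \<partial>\<mu>) \<le> ?c * Op ?g x"
      using mult_nonneg_nonneg[OF c0 Op0] by (subst (asm) ennreal_le_iff) auto
    also have "\<dots> \<le> max 1 ?c * Op ?g x" using Op0 by (intro mult_right_mono) auto
    finally show "(\<integral>y. ?g y \<partial>\<mu>) \<le> max 1 ?c * Op ?g x" .
  qed simp
qed

subsection \<open>Mixing\<close>

lemma abs_Op_le: assumes "bfun g" shows "\<bar>Op g x\<bar> \<le> Op (\<lambda>y. \<bar>g y\<bar>) x"
  unfolding Op_def by (rule integral_abs_bound)

text \<open>Doeblin's argument localized to a ball. For a centred g the minorization is applied to
  the nonnegative functions \<bar>g\<bar> - g and \<bar>g\<bar> + g; starts in the ball then gain a
  fixed fraction of the norm of g. The mass t outside the ball spoils this by 2 t: one t for the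
  part of \<bar>g\<bar> not seen, one because g is no longer centred on the ball.\<close>

lemma integral_abs_Op_contract:
  assumes c: "1 \<le> c" "\<And>x f. x \<in> ball 0 R \<Longrightarrow> bfun f \<Longrightarrow> (\<And>y. 0 \<le> f y) \<Longrightarrow>
      (\<integral>y. f y * indicator (ball 0 R) y \<partial>\<mu>) \<le> c * Op (\<lambda>y. f y * indicator (ball 0 R) y) x"
    and g: "bfun g" "\<And>y. \<bar>g y\<bar> \<le> 1" "(\<integral>y. g y \<partial>\<mu>) = 0"
  defines "t \<equiv> 1 - measure \<mu> (ball 0 R)" and "\<gamma> \<equiv> measure \<mu> (ball 0 R) / c"
  shows "(\<integral>x. \<bar>Op g x\<bar> \<partial>\<mu>) \<le> (1 - \<gamma>) * (\<integral>x. \<bar>g x\<bar> \<partial>\<mu>) + 2 * \<gamma> * t"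
proof -
  let ?U = "ball (0::'a) R" and ?N = "\<integral>x. \<bar>g x\<bar> \<partial>\<mu>"
  let ?I = "indicator ?U :: 'a \<Rightarrow> real"
  have [simp]: "?U \<in> sets borel" by simp
  note bi = bfun_intros bfun_Op g(1) \<open>?U \<in> sets borel\<close>
  have tU: "(\<integral>y. 1 - ?I y \<partial>\<mu>) = t"
    by (subst Bochner_Integration.integral_diff) (auto intro!: bfun_integrable_mu bfun_intros
        simp: t_def space_mu mu.prob_space[unfolded space_mu])
  have out_abs: "\<bar>\<integral>y. g y * ?I y \<partial>\<mu>\<bar> \<le> t"
  proof -
    have "(\<integral>y. g y * ?I y \<partial>\<mu>) = (\<integral>y. g y * ?I y \<partial>\<mu>) - (\<integral>y. g y \<partial>\<mu>)" by (simp add: g(3))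
    also have "\<dots> = (\<integral>y. g y * ?I y - g y \<partial>\<mu>)"
      by (intro Bochner_Integration.integral_diff[symmetric] bfun_integrable_mu bi)
    finally have "\<bar>\<integral>y. g y * ?I y \<partial>\<mu>\<bar> \<le> (\<integral>y. \<bar>g y * ?I y - g y\<bar> \<partial>\<mu>)"
      using integral_abs_bound by metis
    also have "\<dots> \<le> (\<integral>y. 1 - ?I y \<partial>\<mu>)"
      by (intro integral_mono bfun_integrable_mu bi) (use g(2) in \<open>auto simp: indicator_def\<close>)
    finally show ?thesis using tU by simp
  qed
  have in_abs: "?N - t \<le> (\<integral>y. \<bar>g y\<bar> * ?I y \<partial>\<mu>)"
  proof -
    have "?N - (\<integral>y. \<bar>g y\<bar> * ?I y \<partial>\<mu>) = (\<integral>y. \<bar>g y\<bar> - \<bar>g y\<bar> * ?I y \<partial>\<mu>)"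
      by (intro Bochner_Integration.integral_diff[symmetric] bfun_integrable_mu bi)
    also have "\<dots> \<le> (\<integral>y. 1 - ?I y \<partial>\<mu>)"
      by (intro integral_mono bfun_integrable_mu bi) (use g(2) in \<open>auto simp: indicator_def\<close>)
    finally show ?thesis using tU by simp
  qed
  \<comment> \<open>The sign s selects which of the two nonnegative functions is used; s = 1 and s =
    -1 together bound the absolute value of \<open>Op g x\<close>.\<close>
  have sgn: "s * Op g x \<le> Op (\<lambda>y. \<bar>g y\<bar>) x - ((\<integral>y. \<bar>g y\<bar> * ?I y \<partial>\<mu>) - s * (\<integral>y. g y * ?I y \<partial>\<mu>)) / c"
    if x: "x \<in> ?U" and s: "\<bar>s\<bar> = 1" for x s
  proof -
    have p0: "0 \<le> \<bar>g y\<bar> - s * g y" for y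
      using s abs_ge_self[of "s * g y"] by (simp add: abs_mult)
    have "(\<integral>y. \<bar>g y\<bar> * ?I y \<partial>\<mu>) - s * (\<integral>y. g y * ?I y \<partial>\<mu>)
        = (\<integral>y. \<bar>g y\<bar> * ?I y \<partial>\<mu>) - (\<integral>y. s * (g y * ?I y) \<partial>\<mu>)" by simp
    also have "\<dots> = (\<integral>y. \<bar>g y\<bar> * ?I y - s * (g y * ?I y) \<partial>\<mu>)"
      by (intro Bochner_Integration.integral_diff[symmetric] bfun_integrable_mu bi)
    also have "\<dots> = (\<integral>y. (\<bar>g y\<bar> - s * g y) * ?I y \<partial>\<mu>)"
      by (simp add: algebra_simps)
    also have "\<dots> \<le> c * Op (\<lambda>y. (\<bar>g y\<bar> - s * g y) * ?I y) x"
      using p0 by (intro c(2) x bi) auto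
    also have "\<dots> \<le> c * Op (\<lambda>y. \<bar>g y\<bar> - s * g y) x"
      using c(1) p0 by (intro mult_left_mono Op_mono bi) (auto simp: indicator_def)
    also have "Op (\<lambda>y. \<bar>g y\<bar> - s * g y) x = Op (\<lambda>y. \<bar>g y\<bar>) x - s * Op g x"
      by (subst Op_diff) (auto intro: bi simp: Op_def)
    finally show ?thesis using c(1) by (simp add: field_simps)
  qed
  have inside: "\<bar>Op g x\<bar> \<le> Op (\<lambda>y. \<bar>g y\<bar>) x - (?N - 2 * t) / c" if x: "x \<in> ?U" for x
  proof -
    have "((?N - t) - t) / c \<le> ((\<integral>y. \<bar>g y\<bar> * ?I y \<partial>\<mu>) - s * (\<integral>y. g y * ?I y \<partial>\<mu>)) / c"
      if "s = 1 \<or> s = - 1" for s :: real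
      using c(1) out_abs in_abs that by (intro divide_right_mono diff_mono) auto
    from this[of 1] this[of "- 1"] show ?thesis using sgn[OF x, of 1] sgn[OF x, of "- 1"] by simp
  qed
  have "(\<integral>x. \<bar>Op g x\<bar> \<partial>\<mu>) \<le> (\<integral>x. Op (\<lambda>y. \<bar>g y\<bar>) x - ?I x * ((?N - 2 * t) / c) \<partial>\<mu>)"
  proof (intro integral_mono bfun_integrable_mu bi)
    fix x show "\<bar>Op g x\<bar> \<le> Op (\<lambda>y. \<bar>g y\<bar>) x - ?I x * ((?N - 2 * t) / c)"
      using inside[of x] abs_Op_le[OF g(1), of x] by (cases "x \<in> ?U") auto
  qed
  also have "\<dots> = (\<integral>x. Op (\<lambda>y. \<bar>g y\<bar>) x \<partial>\<mu>) - (\<integral>x. ?I x * ((?N - 2 * t) / c) \<partial>\<mu>)"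
    by (intro Bochner_Integration.integral_diff bfun_integrable_mu bi)
  also have "\<dots> = ?N - measure \<mu> ?U * ((?N - 2 * t) / c)"
    by (simp add: integral_Op bi space_mu)
  also have "\<dots> = (1 - \<gamma>) * ?N + 2 * \<gamma> * t"
    using c(1) by (simp add: \<gamma>_def field_simps)
  finally show ?thesis .
qed

text \<open>The affine recursion contracts only down to its fixed point 2 t. So R is chosen from
  \<epsilon>, to make 2 t at most \<epsilon>/2, and then l makes the geometric term smaller than
  \<epsilon>/2; both work for all f at once.\<close>

lemma integral_abs_mixing:
  assumes "0 < \<epsilon>"
  shows "\<exists>l. \<forall>f. bfun f \<longrightarrow> (\<forall>y. 0 \<le> f y \<and> f y \<le> 1) \<longrightarrow>
           (\<integral>x. \<bar>(Op ^^ l) f x - (\<integral>y. f y \<partial>\<mu>)\<bar> \<partial>\<mu>) \<le> \<epsilon>"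
proof -
  obtain R where R: "1 - min (1/2) (\<epsilon> / 4) < measure \<mu> (ball 0 R)"
    by (rule mu_ball_large[of "min (1/2) (\<epsilon> / 4)"]) (use assms in auto)
  obtain c where c: "1 \<le> c" "\<And>x f. x \<in> ball 0 R \<Longrightarrow> bfun f \<Longrightarrow> (\<And>y. 0 \<le> f y) \<Longrightarrow>
      (\<integral>y. f y * indicator (ball 0 R) y \<partial>\<mu>) \<le> c * Op (\<lambda>y. f y * indicator (ball 0 R) y) x"
    using mu_le_Op[of R] by blast
  define t where "t = 1 - measure \<mu> (ball 0 R)"
  define \<gamma> where "\<gamma> = measure \<mu> (ball 0 R) / c"
  have t: "0 \<le> t" "2 * t \<le> \<epsilon> / 2" using R by (auto simp: t_def)
  have \<gamma>: "0 < \<gamma>" "\<gamma> \<le> 1"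
    using R c(1) order_trans[OF mu.prob_le_1 c(1), of "ball 0 R"] by (auto simp: \<gamma>_def field_simps)
  have "(\<lambda>l. (1 - \<gamma>) ^ l) \<longlonglongrightarrow> 0" using \<gamma> by (intro LIMSEQ_realpow_zero) auto
  from order_tendstoD(2)[OF this, of "\<epsilon> / 2"] obtain l where l: "(1 - \<gamma>) ^ l < \<epsilon> / 2"
    using assms by (auto simp: eventually_sequentially)
  show ?thesis
  proof (intro exI[of _ l] allI impI)
    fix f :: "'a \<Rightarrow> real" assume f: "bfun f" "\<forall>y. 0 \<le> f y \<and> f y \<le> 1"
    let ?m = "\<integral>y. f y \<partial>\<mu>"
    have m: "0 \<le> ?m" "?m \<le> 1" using integral_mu_bounds[OF f(1)] f(2) by auto
    define g where "g = (\<lambda>y. f y - ?m)"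
    have g: "bfun g" unfolding g_def using f by (intro bfun_intros)
    have g1: "\<bar>g y\<bar> \<le> 1" for y
      using f(2)[rule_format, of y] m unfolding g_def abs_le_iff by linarith
    have g0: "(\<integral>y. g y \<partial>\<mu>) = 0"
      unfolding g_def using f(1) mu.prob_space
      by (subst Bochner_Integration.integral_diff) (auto intro: bfun_integrable_mu bfun_const)
    \<comment> \<open>2 t is the fixed point of the recursion, so it is carried along unchanged
      while the excess shrinks by 1 - \<gamma>.\<close>
    have N: "(\<integral>x. \<bar>(Op ^^ j) g x\<bar> \<partial>\<mu>) \<le> (1 - \<gamma>) ^ j + 2 * t" for j
    proof (induction j)
      case 0
      have "(\<integral>x. \<bar>g x\<bar> \<partial>\<mu>) \<le> (\<integral>x. 1 \<partial>\<mu>)"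
        using g g1 by (intro integral_mono bfun_integrable_mu bfun_intros)
      then show ?case using mu.prob_space t by simp
    next
      case (Suc j)
      have "(\<integral>x. \<bar>Op ((Op ^^ j) g) x\<bar> \<partial>\<mu>) \<le> (1 - \<gamma>) * (\<integral>x. \<bar>(Op ^^ j) g x\<bar> \<partial>\<mu>) + 2 * \<gamma> * t"
        unfolding t_def \<gamma>_def
        by (rule integral_abs_Op_contract[OF c])
          (use g g1 g0 in \<open>auto intro: bfun_Op_pow Op_pow_abs_le simp: integral_Op_pow\<close>)
      also have "\<dots> \<le> (1 - \<gamma>) * ((1 - \<gamma>) ^ j + 2 * t) + 2 * \<gamma> * t"
        using Suc \<gamma> by (intro add_right_mono mult_left_mono) auto
      finally show ?case by (simp add: algebra_simps)
    qed
    have "(\<integral>x. \<bar>(Op ^^ l) f x - ?m\<bar> \<partial>\<mu>) = (\<integral>x. \<bar>(Op ^^ l) g x\<bar> \<partial>\<mu>)"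
      unfolding g_def Op_pow_diff_const[OF f(1)] ..
    also have "\<dots> \<le> \<epsilon>" using N[of l] l t by simp
    finally show "(\<integral>x. \<bar>(Op ^^ l) f x - ?m\<bar> \<partial>\<mu>) \<le> \<epsilon>" .
  qed
qed

text \<open>One further step from x smooths: inside a large ball the law of that step is at most c
  times \<mu>, so it inherits the mean bound, and outside it has small mass. This is the reason for
  \<open>Suc l\<close>.\<close>

lemma pointwise_mixing:
  assumes "0 < \<epsilon>"
  shows "\<exists>l. \<forall>f. bfun f \<longrightarrow> (\<forall>y. 0 \<le> f y \<and> f y \<le> 1) \<longrightarrow>
           (\<forall>x\<in>ball 0 R. \<bar>(Op ^^ Suc l) f x - (\<integral>y. f y \<partial>\<mu>)\<bar> \<le> \<epsilon>)"
proof -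
  obtain R' where R': "\<And>x. x \<in> ball 0 R \<Longrightarrow> Op (indicator (- ball 0 R')) x \<le> \<epsilon> / 2"
  proof -
    have "- ball (0::'a) R' \<in> sets borel" for R' by auto
    then show thesis
      using tight[of "\<epsilon> / 2" R] assms that by (metis Op_indicator half_gt_zero)
  qed
  obtain c where c: "0 \<le> c" "\<And>x f. bfun f \<Longrightarrow> (\<And>y. 0 \<le> f y) \<Longrightarrow>
     Op (\<lambda>y. f y * indicator (ball 0 R') y) x \<le> c * (\<integral>y. f y * indicator (ball 0 R') y \<partial>\<mu>)"
    using Op_le_mu[of R'] by blast
  \<comment> \<open>R' comes from tightness, c from R', and only then l from c, so that c times the
    mean error stays below \<epsilon>/2.\<close>
  obtain l where l: "\<And>f. bfun f \<Longrightarrow> (\<And>y. 0 \<le> f y \<and> f y \<le> 1) \<Longrightarrow>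
           (\<integral>x. \<bar>(Op ^^ l) f x - (\<integral>y. f y \<partial>\<mu>)\<bar> \<partial>\<mu>) \<le> \<epsilon> / (2 * (c + 1))"
    using integral_abs_mixing[of "\<epsilon> / (2 * (c + 1))"] assms c(1) by auto
  show ?thesis
  proof (intro exI[of _ l] allI impI ballI)
    fix f :: "'a \<Rightarrow> real" and x :: 'a
    assume f: "bfun f" "\<forall>y. 0 \<le> f y \<and> f y \<le> 1" and x: "x \<in> ball 0 R"
    let ?m = "\<integral>y. f y \<partial>\<mu>"
    have m: "0 \<le> ?m" "?m \<le> 1" using integral_mu_bounds[OF f(1)] f(2) by auto
    define g where "g = (Op ^^ l) (\<lambda>y. f y - ?m)"
    have f': "bfun (\<lambda>y. f y - ?m)" using f by (intro bfun_intros)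
    have f'': "\<bar>f y - ?m\<bar> \<le> 1" for y
      using f(2)[rule_format, of y] m unfolding abs_le_iff by linarith
    have g: "bfun g" "\<And>y. \<bar>g y\<bar> \<le> 1"
      unfolding g_def using f' f'' by (auto intro: bfun_Op_pow Op_pow_abs_le)
    have gN: "(\<integral>x. \<bar>g x\<bar> \<partial>\<mu>) \<le> \<epsilon> / (2 * (c + 1))"
      unfolding g_def Op_pow_diff_const[OF f(1)] using l[OF f(1)] f(2) by blast
    let ?I = "indicator (ball 0 R') :: 'a \<Rightarrow> real"
    have "\<bar>(Op ^^ Suc l) f x - ?m\<bar> = \<bar>Op g x\<bar>"
      using Op_pow_diff_const[OF f(1), of "Suc l" ?m] unfolding g_def by (simp add: fun_eq_iff)
    also have "\<dots> \<le> Op (\<lambda>y. \<bar>g y\<bar>) x" by (rule abs_Op_le[OF g(1)])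
    \<comment> \<open>Outside the ball of radius R' the bound \<bar>g\<bar> \<le> 1 is all that is
      used.\<close>
    also have "\<dots> \<le> Op (\<lambda>y. \<bar>g y\<bar> * ?I y + indicator (- ball 0 R') y) x"
      by (intro Op_mono bfun_intros g(1)) (use g(2) in \<open>auto simp: indicator_def\<close>)
    also have "\<dots> = Op (\<lambda>y. \<bar>g y\<bar> * ?I y) x + Op (indicator (- ball 0 R')) x"
      by (intro Op_add bfun_intros g(1)) auto
    also have "\<dots> \<le> c * (\<integral>y. \<bar>g y\<bar> * ?I y \<partial>\<mu>) + \<epsilon> / 2"
      using g(1) x by (intro add_mono c(2) R' bfun_intros) auto
    also have "\<dots> \<le> c * (\<integral>y. \<bar>g y\<bar> \<partial>\<mu>) + \<epsilon> / 2"
      by (intro add_right_mono mult_left_mono c(1) integral_mono bfun_integrable_mu bfun_intros g(1))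
        (auto simp: indicator_def)
    also have "\<dots> \<le> c * (\<epsilon> / (2 * (c + 1))) + \<epsilon> / 2"
      by (intro add_right_mono mult_left_mono c(1) gN)
    also have "\<dots> \<le> \<epsilon>" using c(1) assms by (simp add: field_simps)
    finally show "\<bar>(Op ^^ Suc l) f x - ?m\<bar> \<le> \<epsilon>" .
  qed
qed

theorem survive_shrinking_ball_tendsto:
  assumes r: "\<And>n. 0 < r n" and lim: "(\<lambda>n. real n * measure \<mu> (ball x0 (r n))) \<longlonglongrightarrow> \<tau>"
  shows "(\<lambda>n. \<integral>x. survive (ball x0 (r n)) n x \<partial>\<mu>) \<longlonglongrightarrow> exp (- \<tau>)"
proof -
  let ?a = "\<lambda>n. measure \<mu> (ball x0 (r n))" and ?q = "\<lambda>n. \<integral>x. survive (ball x0 (r n)) n x \<partial>\<mu>"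
  have a0: "?a \<longlonglongrightarrow> 0"
  proof -
    have "(\<lambda>n. (real n * ?a n) * (1 / real n)) \<longlonglongrightarrow> \<tau> * 0"
      by (intro tendsto_mult lim lim_1_over_n)
    moreover have "\<forall>\<^sub>F n in sequentially. (real n * ?a n) * (1 / real n) = ?a n"
      using eventually_gt_at_top[of 0] by eventually_elim simp
    ultimately show ?thesis by (simp add: Lim_transform_eventually)
  qed
  \<comment> \<open>Only the masses are known to vanish; radii follow because every fixed ball
    around x0 has positive mass by \<open>mu_ball_ge\<close>.\<close>
  have r0: "r \<longlonglongrightarrow> 0"
  proof (rule LIMSEQ_I)
    fix e :: real assume e: "0 < e"
    obtain a where a: "a > 0" "\<And>y r. y \<in> ball 0 (norm x0 + 1) \<Longrightarrow> 0 < r \<Longrightarrow> r \<le> 1 \<Longrightarrow> a * r ^ DIM('a) \<le> measure \<mu> (ball y r)"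
      using mu_ball_ge[of "norm x0 + 1"] by blast
    have pos: "0 < measure \<mu> (ball x0 (min e 1))"
      using a(1) e by (intro less_le_trans[OF _ a(2)]) auto
    from order_tendstoD(2)[OF a0 pos] obtain n0 where n0: "\<And>n. n \<ge> n0 \<Longrightarrow> ?a n < measure \<mu> (ball x0 (min e 1))"
      by (auto simp: eventually_sequentially)
    have "r n < e" if "n \<ge> n0" for n
    proof (rule ccontr)
      assume "\<not> r n < e"
      then have "measure \<mu> (ball x0 (min e 1)) \<le> ?a n"
        by (intro mu.finite_measure_mono) (auto simp: sets_mu)
      then show False using n0[OF that] by simp
    qed
    then show "\<exists>n0. \<forall>n\<ge>n0. norm (r n - 0) < e" using r by (auto simp: abs_of_pos)
  qed
  have "(\<lambda>n. ?q n - (1 - ?a n) ^ n) \<longlonglongrightarrow> 0"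
  proof (rule LIMSEQ_I)
    fix e :: real assume e: "0 < e"
    \<comment> \<open>The limit of the error bound will be \<tau> * \<theta>, which this choice
      keeps below e; the added 1 keeps the denominator positive.\<close>
    define \<theta> where "\<theta> = e / (2 * (\<bar>\<tau>\<bar> + 1))"
    have \<theta>: "0 < \<theta>" using e by (simp add: \<theta>_def)
    obtain l where l: "\<And>f x. bfun f \<Longrightarrow> (\<And>y. 0 \<le> f y \<and> f y \<le> 1) \<Longrightarrow> x \<in> ball 0 (norm x0 + 1) \<Longrightarrow>
        \<bar>(Op ^^ Suc l) f x - (\<integral>y. f y \<partial>\<mu>)\<bar> \<le> \<theta>"
      using pointwise_mixing[OF \<theta>, of "norm x0 + 1"] by blast
    \<comment> \<open>With l fixed, both the radius term and the mass term in the gap vanish; the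
      power of the radius tends to 0 since the dimension is positive.\<close>
    let ?b = "\<lambda>n. real n * (?a n * (real l * (C * r n ^ DIM('a) + ?a n) + \<theta>))"
    have "(\<lambda>n. (real n * ?a n) * (real l * (C * r n ^ DIM('a) + ?a n) + \<theta>))
        \<longlonglongrightarrow> \<tau> * (real l * (C * 0 ^ DIM('a) + 0) + \<theta>)"
      by (intro tendsto_intros lim r0 a0)
    then have "?b \<longlonglongrightarrow> \<tau> * \<theta>" by (simp add: mult.assoc zero_power)
    moreover have "\<tau> * \<theta> < e"
    proof -
      have "\<tau> * \<theta> \<le> \<bar>\<tau>\<bar> * \<theta>" using \<theta> by (intro mult_right_mono) auto
      also have "\<dots> < e" using e by (simp add: \<theta>_def field_simps add_nonneg_pos)
      finally show ?thesis .
    qed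
    ultimately have ev: "\<forall>\<^sub>F n in sequentially. ?b n < e" by (rule order_tendstoD(2))
    have "\<forall>\<^sub>F n in sequentially. norm (?q n - (1 - ?a n) ^ n - 0) < e"
      using ev order_tendstoD(2)[OF r0, of 1, OF zero_less_one]
    proof eventually_elim
      case (elim n)
      have sub: "x \<in> ball 0 (norm x0 + 1)" if "x \<in> ball x0 (r n)" for x
        using that elim(2) norm_triangle_ineq2[of x x0] by (auto simp: dist_norm norm_minus_commute)
      have "\<bar>?q n - (1 - ?a n) ^ n\<bar> \<le> ?b n"
        using Op_ball_le[OF r] \<theta> l sub by (intro integral_survive_approx_power) auto
      then show ?case using elim(1) by simp
    qed
    then show "\<exists>n0. \<forall>n\<ge>n0. norm (?q n - (1 - ?a n) ^ n - 0) < e"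
      by (simp add: eventually_sequentially)
  qed
  from tendsto_add[OF this one_minus_power_tendsto_exp[OF lim]] show ?thesis by simp
qed

end

section \<open>Shifting Gaussian noise\<close>

definition centered_normal :: "real \<Rightarrow> real measure" where
  "centered_normal \<eta> = density lborel (\<lambda>x. ennreal (normal_density 0 (sqrt \<eta>) x))"

lemma sets_centered_normal [simp, measurable_cong]: "sets (centered_normal \<eta>) = sets borel"
  by (simp add: centered_normal_def)

lemma space_centered_normal [simp]: "space (centered_normal \<eta>) = UNIV"
  by (simp add: centered_normal_def)

lemma prob_space_centered_normal: "0 < \<eta> \<Longrightarrow> prob_space (centered_normal \<eta>)"
  unfolding centered_normal_def by (rule prob_space_normal_density) simp

lemma normal_density_shift:
  assumes "0 < \<eta>"
  shows "normal_density 0 (sqrt \<eta>) (x - \<eta> * c)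
           = normal_density 0 (sqrt \<eta>) x * exp (c * x - \<eta> * c\<^sup>2 / 2)"
proof -
  have "- ((x - \<eta> * c)\<^sup>2 / (2 * \<eta>)) = - (x\<^sup>2 / (2 * \<eta>)) + (c * x - \<eta> * c\<^sup>2 / 2)"
    using assms by (simp add: power2_eq_square field_simps)
  then show ?thesis
    using assms by (simp add: normal_density_def exp_add[symmetric])
qed

text \<open>Cameron--Martin in one dimension. The shift \<eta> * c is the displacement caused by
  drift c during time \<eta>, the variance being \<eta>.\<close>

lemma distr_centered_normal_shift:
  assumes "0 < \<eta>"
  shows "distr (centered_normal \<eta>) borel (\<lambda>x. x + \<eta> * c)
           = density (centered_normal \<eta>) (\<lambda>x. ennreal (exp (c * x - \<eta> * c\<^sup>2 / 2)))"
proof (rule measure_eqI)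
  fix A assume "A \<in> sets (distr (centered_normal \<eta>) borel (\<lambda>x. x + \<eta> * c))"
  then have A [measurable]: "A \<in> sets borel" by simp
  have "emeasure (distr (centered_normal \<eta>) borel (\<lambda>x. x + \<eta> * c)) A
      = (\<integral>\<^sup>+x. indicator A x \<partial>distr (centered_normal \<eta>) borel (\<lambda>x. x + \<eta> * c))" by simp
  also have "\<dots> = (\<integral>\<^sup>+x. indicator A (x + \<eta> * c) \<partial>centered_normal \<eta>)"
    by (subst nn_integral_distr) auto
  also have "\<dots> = (\<integral>\<^sup>+x. ennreal (normal_density 0 (sqrt \<eta>) x) * indicator A (x + \<eta> * c) \<partial>lborel)"
    unfolding centered_normal_def by (subst nn_integral_density) auto
  also have "\<dots> = (\<integral>\<^sup>+x. ennreal (normal_density 0 (sqrt \<eta>) (x - \<eta> * c)) * indicator A x \<partial>lborel)"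
    by (subst nn_integral_real_affine[where c = 1 and t = "\<eta> * c"
          and f = "\<lambda>x. ennreal (normal_density 0 (sqrt \<eta>) (x - \<eta> * c)) * indicator A x"])
      (auto simp: add.commute)
  also have "\<dots> = (\<integral>\<^sup>+x. ennreal (normal_density 0 (sqrt \<eta>) x)
      * (ennreal (exp (c * x - \<eta> * c\<^sup>2 / 2)) * indicator A x) \<partial>lborel)"
    by (simp add: normal_density_shift[OF assms] ennreal_mult mult.assoc)
  also have "\<dots> = (\<integral>\<^sup>+x. ennreal (exp (c * x - \<eta> * c\<^sup>2 / 2)) * indicator A x \<partial>centered_normal \<eta>)"
    unfolding centered_normal_def by (subst nn_integral_density) auto
  also have "\<dots> = emeasure (density (centered_normal \<eta>) (\<lambda>x. ennreal (exp (c * x - \<eta> * c\<^sup>2 / 2)))) A"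
    by (subst emeasure_density) auto
  finally show "emeasure (distr (centered_normal \<eta>) borel (\<lambda>x. x + \<eta> * c)) A
      = emeasure (density (centered_normal \<eta>) (\<lambda>x. ennreal (exp (c * x - \<eta> * c\<^sup>2 / 2)))) A" .
qed simp

text \<open>The product of the shifted normal laws is computed twice, as an image of the unshifted
  product and as a measure with product density; uniqueness on boxes identifies the two.\<close>

lemma nn_integral_PiM_centered_normal_shift:
  fixes c :: "'i \<Rightarrow> real"
  assumes I: "finite I" and \<eta>: "0 < \<eta>"
    and F [measurable]: "F \<in> borel_measurable (PiM I (\<lambda>_. borel))"
  shows "(\<integral>\<^sup>+y. F (\<lambda>p\<in>I. y p + \<eta> * c p) \<partial>PiM I (\<lambda>_. centered_normal \<eta>))
       = (\<integral>\<^sup>+y. F y * (\<Prod>p\<in>I. ennreal (exp (c p * y p - \<eta> * (c p)\<^sup>2 / 2))) \<partial>PiM I (\<lambda>_. centered_normal \<eta>))"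
proof -
  let ?N = "\<lambda>_::'i. centered_normal \<eta>"
  let ?g = "\<lambda>p x. ennreal (exp (c p * x - \<eta> * (c p)\<^sup>2 / 2))"
  let ?D = "\<lambda>p. distr (centered_normal \<eta>) borel (\<lambda>x. x + \<eta> * c p)"
  let ?s = "\<lambda>y. \<lambda>p\<in>I. y p + \<eta> * c p"
  interpret N: product_prob_space ?N
    unfolding product_prob_space_def product_prob_space_axioms_def product_sigma_finite_def
    using prob_space_centered_normal[OF \<eta>] by (auto simp: prob_space_imp_sigma_finite)
  have pD: "prob_space (?D p)" for p
    using prob_space_centered_normal[OF \<eta>] by (intro prob_space.prob_space_distr) auto
  interpret D: product_prob_space ?D
    unfolding product_prob_space_def product_prob_space_axioms_def product_sigma_finite_def
    using pD by (auto simp: prob_space_imp_sigma_finite)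
  have setsN: "sets (PiM I ?N) = sets (PiM I (\<lambda>_. borel :: real measure))"
    by (intro sets_PiM_cong) auto
  have setsD: "sets (PiM I ?D) = sets (PiM I (\<lambda>_. borel :: real measure))"
    by (intro sets_PiM_cong) auto
  have s [measurable]: "?s \<in> PiM I ?N \<rightarrow>\<^sub>M PiM I (\<lambda>_. borel)"
    by (intro measurable_restrict) auto
  have g [measurable]: "(\<lambda>y. \<Prod>p\<in>I. ?g p (y p)) \<in> borel_measurable (PiM I ?N)"
    by (intro borel_measurable_prod_ennreal) auto
  have 1: "PiM I ?D = distr (PiM I ?N) (PiM I (\<lambda>_. borel)) ?s"
  proof (rule D.PiM_eqI[OF I, symmetric])
    fix A :: "'i \<Rightarrow> real set" assume A: "\<And>i. i \<in> I \<Longrightarrow> A i \<in> sets (?D i)"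
    have pre: "?s -` (Pi\<^sub>E I A) \<inter> space (PiM I ?N) = Pi\<^sub>E I (\<lambda>p. (\<lambda>x. x + \<eta> * c p) -` A p)"
      by (auto simp: space_PiM PiE_iff extensional_def)
    have "emeasure (distr (PiM I ?N) (PiM I (\<lambda>_. borel)) ?s) (Pi\<^sub>E I A)
        = emeasure (PiM I ?N) (Pi\<^sub>E I (\<lambda>p. (\<lambda>x. x + \<eta> * c p) -` A p))"
      using A I by (subst emeasure_distr) (auto simp: pre intro!: sets_PiM_I_finite)
    also have "\<dots> = (\<Prod>p\<in>I. emeasure (centered_normal \<eta>) ((\<lambda>x. x + \<eta> * c p) -` A p))"
      using A I by (subst N.emeasure_PiM) (auto intro!: measurable_sets_borel[where M = borel])
    also have "\<dots> = (\<Prod>p\<in>I. emeasure (?D p) (A p))"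
      using A by (intro prod.cong refl) (subst emeasure_distr, auto)
    finally show "emeasure (distr (PiM I ?N) (PiM I (\<lambda>_. borel)) ?s) (Pi\<^sub>E I A)
        = (\<Prod>p\<in>I. emeasure (?D p) (A p))" .
  qed (simp add: setsD)
  have 2: "PiM I ?D = density (PiM I ?N) (\<lambda>y. \<Prod>p\<in>I. ?g p (y p))"
  proof (rule D.PiM_eqI[OF I, symmetric])
    fix A :: "'i \<Rightarrow> real set" assume A: "\<And>i. i \<in> I \<Longrightarrow> A i \<in> sets (?D i)"
    then have A': "\<And>i. i \<in> I \<Longrightarrow> A i \<in> sets borel" by simp
    have PA: "Pi\<^sub>E I A \<in> sets (PiM I ?N)" using A I by (intro sets_PiM_I_finite) auto
    have "emeasure (density (PiM I ?N) (\<lambda>y. \<Prod>p\<in>I. ?g p (y p))) (Pi\<^sub>E I A)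
        = (\<integral>\<^sup>+y. (\<Prod>p\<in>I. ?g p (y p)) * indicator (Pi\<^sub>E I A) y \<partial>PiM I ?N)"
      using PA by (subst emeasure_density) auto
    also have "\<dots> = (\<integral>\<^sup>+y. (\<Prod>p\<in>I. ?g p (y p) * indicator (A p) (y p)) \<partial>PiM I ?N)"
    proof (rule nn_integral_cong)
      fix y assume y: "y \<in> space (PiM I ?N)"
      have "indicator (Pi\<^sub>E I A) y = (\<Prod>p\<in>I. indicator (A p) (y p) :: ennreal)"
        using y I by (auto simp: indicator_def space_PiM PiE_iff prod_zero_iff)
      then show "(\<Prod>p\<in>I. ?g p (y p)) * indicator (Pi\<^sub>E I A) y = (\<Prod>p\<in>I. ?g p (y p) * indicator (A p) (y p))"
        by (simp add: prod.distrib)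
    qed
    also have "\<dots> = (\<Prod>p\<in>I. \<integral>\<^sup>+x. ?g p x * indicator (A p) x \<partial>centered_normal \<eta>)"
      using A' by (intro N.product_nn_integral_prod I) auto
    also have "\<dots> = (\<Prod>p\<in>I. emeasure (?D p) (A p))"
      unfolding distr_centered_normal_shift[OF \<eta>] using A'
      by (intro prod.cong refl) (subst emeasure_density, auto)
    finally show "emeasure (density (PiM I ?N) (\<lambda>y. \<Prod>p\<in>I. ?g p (y p))) (Pi\<^sub>E I A)
        = (\<Prod>p\<in>I. emeasure (?D p) (A p))" .
  qed (simp add: setsD setsN)
  have F': "F \<in> borel_measurable (PiM I ?N)" using F setsN by (simp cong: measurable_cong_sets)
  have "(\<integral>\<^sup>+y. F (?s y) \<partial>PiM I ?N) = (\<integral>\<^sup>+y. F y \<partial>distr (PiM I ?N) (PiM I (\<lambda>_. borel)) ?s)"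
    by (rule nn_integral_distr[symmetric, OF s]) simp
  also have "\<dots> = (\<integral>\<^sup>+y. F y \<partial>density (PiM I ?N) (\<lambda>y. \<Prod>p\<in>I. ?g p (y p)))"
    unfolding 1[symmetric] 2[symmetric] ..
  also have "\<dots> = (\<integral>\<^sup>+y. F y * (\<Prod>p\<in>I. ?g p (y p)) \<partial>PiM I ?N)"
    by (subst nn_integral_density[OF g F']) (simp add: mult.commute)
  finally show ?thesis .
qed

lemma measurable_euler:
  fixes b :: "'a::euclidean_space \<Rightarrow> 'a"
  assumes b: "b \<in> borel_measurable borel" and x: "x \<in> N \<rightarrow>\<^sub>M borel"
    and z: "\<And>k. k < n \<Longrightarrow> (\<lambda>\<omega>. z \<omega> k) \<in> N \<rightarrow>\<^sub>M borel"
  shows "(\<lambda>\<omega>. euler b \<eta> (x \<omega>) (z \<omega>) n) \<in> N \<rightarrow>\<^sub>M borel"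
  using z
proof (induction n)
  case (Suc n)
  then have [measurable]: "(\<lambda>\<omega>. euler b \<eta> (x \<omega>) (z \<omega>) n) \<in> N \<rightarrow>\<^sub>M borel" "(\<lambda>\<omega>. z \<omega> n) \<in> N \<rightarrow>\<^sub>M borel"
    by auto
  show ?case using b by simp
qed (use x in simp)

subsection \<open>Brownian increments\<close>

locale brownian = prob_space M for M :: "'w measure" +
  fixes W :: "real \<Rightarrow> 'w \<Rightarrow> 'a::euclidean_space"
  assumes BM: "brownian_motion M W"
begin

text \<open>The increments are split into scalar coordinates indexed by step and basis vector, the
  form in which joint independence is given; s is the grid index at which a block of noise begins.
  \<open>noise_vector\<close> reassembles the vectors.\<close>

definition noise :: "real \<Rightarrow> nat \<Rightarrow> 'w \<Rightarrow> nat \<times> 'a \<Rightarrow> real" where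
  "noise \<eta> s \<omega> p = increments (\<lambda>t. W t \<omega>) \<eta> (s + fst p) \<bullet> snd p"

definition noise_vector :: "(nat \<times> 'a \<Rightarrow> real) \<Rightarrow> nat \<Rightarrow> 'a" where
  "noise_vector y k = (\<Sum>i\<in>Basis. y (k, i) *\<^sub>R i)"

lemma W0: "\<omega> \<in> space M \<Longrightarrow> W 0 \<omega> = 0"
  using BM unfolding brownian_motion_def by blast

lemma indep_noise:
  assumes "0 < \<eta>"
  shows "indep_vars (\<lambda>_. borel) (\<lambda>p \<omega>. noise \<eta> s \<omega> p) ({..<n} \<times> Basis)"
proof -
  have "indep_vars (\<lambda>_. borel) (\<lambda>(k, i) \<omega>. (W (real (s + Suc k) * \<eta>) \<omega> - W (real (s + k) * \<eta>) \<omega>) \<bullet> i) ({..<n} \<times> Basis)"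
    using BM[unfolded brownian_motion_def, THEN conjunct2, THEN conjunct2, rule_format,
        of "\<lambda>k. real (s + k) * \<eta>" n, THEN conjunct1] assms by simp
  then show ?thesis
    by (simp add: noise_def increments_def case_prod_beta')
qed

lemma distributed_noise:
  assumes "0 < \<eta>" "i \<in> Basis"
  shows "distributed M lborel (\<lambda>\<omega>. noise \<eta> s \<omega> (k, i)) (normal_density 0 (sqrt \<eta>))"
proof -
  have "distributed M lborel (\<lambda>\<omega>. (W (real (s + Suc k) * \<eta>) \<omega> - W (real (s + k) * \<eta>) \<omega>) \<bullet> i)
      (normal_density 0 (sqrt (real (s + Suc k) * \<eta> - real (s + k) * \<eta>)))"
    using BM[unfolded brownian_motion_def, THEN conjunct2, THEN conjunct2, rule_format,
        of "\<lambda>k. real (s + k) * \<eta>" "Suc k", THEN conjunct2] assms by simp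
  moreover have "real (s + Suc k) * \<eta> - real (s + k) * \<eta> = \<eta>" by (simp add: algebra_simps)
  ultimately show ?thesis by (simp add: noise_def increments_def)
qed

lemma measurable_noise: "0 < \<eta> \<Longrightarrow> snd p \<in> Basis \<Longrightarrow> (\<lambda>\<omega>. noise \<eta> s \<omega> p) \<in> borel_measurable M"
  using distributed_measurable[OF distributed_noise[of \<eta> "snd p" s "fst p"]] by simp

lemma measurable_increments:
  assumes "0 < \<eta>" shows "(\<lambda>\<omega>. increments (\<lambda>t. W t \<omega>) \<eta> k) \<in> M \<rightarrow>\<^sub>M borel"
proof -
  have "(\<lambda>\<omega>. \<Sum>i\<in>Basis. noise \<eta> 0 \<omega> (k, i) *\<^sub>R i) \<in> M \<rightarrow>\<^sub>M borel"
    using measurable_noise[OF assms] by (intro borel_measurable_sum borel_measurable_scaleR) auto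
  then show ?thesis by (simp add: noise_def euclidean_representation)
qed

lemma measurable_W: assumes "0 < t" shows "W t \<in> M \<rightarrow>\<^sub>M borel"
proof -
  have "(\<lambda>\<omega>. increments (\<lambda>t. W t \<omega>) t 0) \<in> M \<rightarrow>\<^sub>M borel" by (rule measurable_increments[OF assms])
  then show ?thesis
    by (rule measurable_cong[THEN iffD1, rotated]) (simp add: increments_def W0)
qed

text \<open>The law on the right does not depend on s: blocks starting at different grid times have
  the same law. A positive n keeps the index set of the product nonempty.\<close>

lemma distr_noise:
  assumes \<eta>: "0 < \<eta>" and n: "0 < n"
  shows "distr M (PiM ({..<n} \<times> Basis) (\<lambda>_. borel)) (\<lambda>\<omega>. \<lambda>p\<in>{..<n} \<times> Basis. noise \<eta> s \<omega> p)
           = PiM ({..<n} \<times> Basis) (\<lambda>_. centered_normal \<eta>)"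
proof -
  let ?I = "{..<n} \<times> (Basis :: 'a set)"
  have "distr M (PiM ?I (\<lambda>_. borel)) (\<lambda>\<omega>. \<lambda>p\<in>?I. noise \<eta> s \<omega> p)
      = PiM ?I (\<lambda>p. distr M borel (\<lambda>\<omega>. noise \<eta> s \<omega> p))"
    using indep_noise[OF \<eta>, of s n] n measurable_noise[OF \<eta>]
    by (subst (asm) indep_vars_iff_distr_eq_PiM') auto
  also have "\<dots> = PiM ?I (\<lambda>_. centered_normal \<eta>)"
  proof (rule PiM_cong[OF refl])
    fix p assume "p \<in> ?I"
    then have "distributed M lborel (\<lambda>\<omega>. noise \<eta> s \<omega> p) (normal_density 0 (sqrt \<eta>))"
      using distributed_noise[OF \<eta>, of "snd p" s "fst p"] by auto
    then have "distr M lborel (\<lambda>\<omega>. noise \<eta> s \<omega> p) = centered_normal \<eta>"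
      unfolding distributed_def centered_normal_def by simp
    then show "distr M borel (\<lambda>\<omega>. noise \<eta> s \<omega> p) = centered_normal \<eta>"
      by (simp cong: distr_cong)
  qed
  finally show ?thesis .
qed

lemma noise_vector_noise:
  assumes "k < n"
  shows "noise_vector (\<lambda>p\<in>{..<n} \<times> Basis. noise \<eta> s \<omega> p) k = increments (\<lambda>t. W t \<omega>) \<eta> (s + k)"
  using assms by (simp add: noise_vector_def noise_def euclidean_representation)

lemma measurable_noise_vector:
  assumes "k < n"
  shows "(\<lambda>y. noise_vector y k) \<in> PiM ({..<n} \<times> Basis) (\<lambda>_. borel) \<rightarrow>\<^sub>M borel"
  unfolding noise_vector_def using assms
  by (intro borel_measurable_sum borel_measurable_scaleR measurable_component_singleton) auto

text \<open>The scheme is a function of finitely many independent Gaussians, so the product formula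
  applies. In the exponent the sums over steps telescope to W at the final time; G is allowed to see
  that value because the lower bound must truncate the weight.\<close>

lemma cameron_martin_euler:
  fixes b :: "'a \<Rightarrow> 'a" and G :: "'a \<times> 'a \<Rightarrow> ennreal"
  assumes \<eta>: "0 < \<eta>" and n: "0 < n" and b [measurable]: "b \<in> borel_measurable borel"
    and G [measurable]: "G \<in> borel_measurable borel"
  defines "z \<equiv> \<lambda>\<omega>. increments (\<lambda>t. W t \<omega>) \<eta>"
  shows "(\<integral>\<^sup>+\<omega>. G (euler b \<eta> x (\<lambda>k. z \<omega> k + \<eta> *\<^sub>R c) n, W (real n * \<eta>) \<omega> + (real n * \<eta>) *\<^sub>R c) \<partial>M)
       = (\<integral>\<^sup>+\<omega>. G (euler b \<eta> x (z \<omega>) n, W (real n * \<eta>) \<omega>)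
            * ennreal (exp (c \<bullet> W (real n * \<eta>) \<omega> - real n * \<eta> * (norm c)\<^sup>2 / 2)) \<partial>M)"
proof -
  let ?I = "{..<n} \<times> (Basis :: 'a set)"
  let ?P = "PiM ?I (\<lambda>_. borel :: real measure)"
  define F where "F y = G (euler b \<eta> x (noise_vector y) n, \<Sum>k<n. noise_vector y k)" for y
  have F [measurable]: "F \<in> borel_measurable ?P"
    unfolding F_def
    by (intro measurable_compose[OF _ G] borel_measurable_Pair measurable_euler b borel_measurable_sum
        measurable_noise_vector) auto
  let ?Y = "\<lambda>\<omega>. \<lambda>p\<in>?I. noise \<eta> 0 \<omega> p"
  have Y [measurable]: "?Y \<in> M \<rightarrow>\<^sub>M ?P"
    using measurable_noise[OF \<eta>] by (intro measurable_restrict) auto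
  have sumz: "(\<Sum>k<n. z \<omega> k) = W (real n * \<eta>) \<omega>" if "\<omega> \<in> space M" for \<omega>
    unfolding z_def sum_increments using W0[OF that] by simp
  let ?c = "\<lambda>p. c \<bullet> snd p :: real"
  have "(\<integral>\<^sup>+\<omega>. G (euler b \<eta> x (\<lambda>k. z \<omega> k + \<eta> *\<^sub>R c) n, W (real n * \<eta>) \<omega> + (real n * \<eta>) *\<^sub>R c) \<partial>M)
      = (\<integral>\<^sup>+\<omega>. F (\<lambda>p\<in>?I. ?Y \<omega> p + \<eta> * ?c p) \<partial>M)"
  proof (rule nn_integral_cong)
    fix \<omega> assume \<omega>: "\<omega> \<in> space M"
    have v: "noise_vector (\<lambda>p\<in>?I. ?Y \<omega> p + \<eta> * ?c p) k = z \<omega> k + \<eta> *\<^sub>R c" if "k < n" for k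
    proof -
      have "noise_vector (\<lambda>p\<in>?I. ?Y \<omega> p + \<eta> * ?c p) k = (\<Sum>i\<in>Basis. ((z \<omega> k + \<eta> *\<^sub>R c) \<bullet> i) *\<^sub>R i)"
        unfolding noise_vector_def using that
        by (intro sum.cong refl) (simp add: noise_def z_def inner_add_left)
      then show ?thesis by (simp add: euclidean_representation)
    qed
    have "(\<Sum>k<n. z \<omega> k + \<eta> *\<^sub>R c) = W (real n * \<eta>) \<omega> + (real n * \<eta>) *\<^sub>R c"
      using sumz[OF \<omega>] by (simp add: sum.distrib sum_constant_scaleR)
    then show "G (euler b \<eta> x (\<lambda>k. z \<omega> k + \<eta> *\<^sub>R c) n, W (real n * \<eta>) \<omega> + (real n * \<eta>) *\<^sub>R c)
        = F (\<lambda>p\<in>?I. ?Y \<omega> p + \<eta> * ?c p)"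
      unfolding F_def using v euler_cong[of n "noise_vector (\<lambda>p\<in>?I. ?Y \<omega> p + \<eta> * ?c p)" "\<lambda>k. z \<omega> k + \<eta> *\<^sub>R c" b \<eta> x]
      by simp
  qed
  also have "\<dots> = (\<integral>\<^sup>+y. F (\<lambda>p\<in>?I. y p + \<eta> * ?c p) \<partial>distr M ?P ?Y)"
    by (subst nn_integral_distr[OF Y])
      (auto intro!: measurable_compose[OF measurable_restrict F] cong: restrict_cong)
  also have "\<dots> = (\<integral>\<^sup>+y. F (\<lambda>p\<in>?I. y p + \<eta> * ?c p) \<partial>PiM ?I (\<lambda>_. centered_normal \<eta>))"
    unfolding distr_noise[OF \<eta> n] ..
  also have "\<dots> = (\<integral>\<^sup>+y. F y * (\<Prod>p\<in>?I. ennreal (exp (?c p * y p - \<eta> * (?c p)\<^sup>2 / 2))) \<partial>PiM ?I (\<lambda>_. centered_normal \<eta>))"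
    by (rule nn_integral_PiM_centered_normal_shift[OF _ \<eta> F]) simp
  also have "\<dots> = (\<integral>\<^sup>+y. F y * (\<Prod>p\<in>?I. ennreal (exp (?c p * y p - \<eta> * (?c p)\<^sup>2 / 2))) \<partial>distr M ?P ?Y)"
    unfolding distr_noise[OF \<eta> n] ..
  also have "\<dots> = (\<integral>\<^sup>+\<omega>. F (?Y \<omega>) * (\<Prod>p\<in>?I. ennreal (exp (?c p * ?Y \<omega> p - \<eta> * (?c p)\<^sup>2 / 2))) \<partial>M)"
    by (rule nn_integral_distr[OF Y]) measurable
  also have "\<dots> = (\<integral>\<^sup>+\<omega>. G (euler b \<eta> x (z \<omega>) n, W (real n * \<eta>) \<omega>)
            * ennreal (exp (c \<bullet> W (real n * \<eta>) \<omega> - real n * \<eta> * (norm c)\<^sup>2 / 2)) \<partial>M)"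
  proof (rule nn_integral_cong)
    fix \<omega> assume \<omega>: "\<omega> \<in> space M"
    have v: "noise_vector (?Y \<omega>) k = z \<omega> k" if "k < n" for k
      using noise_vector_noise[OF that, of \<eta> 0 \<omega>] by (simp add: z_def)
    have 1: "F (?Y \<omega>) = G (euler b \<eta> x (z \<omega>) n, W (real n * \<eta>) \<omega>)"
      unfolding F_def using v euler_cong[of n "noise_vector (?Y \<omega>)" "z \<omega>" b \<eta> x] sumz[OF \<omega>] by simp
    have "(\<Prod>p\<in>?I. ennreal (exp (?c p * ?Y \<omega> p - \<eta> * (?c p)\<^sup>2 / 2)))
        = ennreal (\<Prod>p\<in>?I. exp (?c p * ?Y \<omega> p - \<eta> * (?c p)\<^sup>2 / 2))"
      by (rule prod_ennreal) simp
    also have "\<dots> = ennreal (exp (\<Sum>p\<in>?I. ?c p * ?Y \<omega> p - \<eta> * (?c p)\<^sup>2 / 2))"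
      by (subst exp_sum) auto
    also have "(\<Sum>p\<in>?I. ?c p * ?Y \<omega> p - \<eta> * (?c p)\<^sup>2 / 2)
        = (\<Sum>k<n. \<Sum>i\<in>Basis. (c \<bullet> i) * (z \<omega> k \<bullet> i) - \<eta> * (c \<bullet> i)\<^sup>2 / 2)"
      by (subst sum.cartesian_product) (auto intro!: sum.cong simp: noise_def z_def)
    also have "\<dots> = (\<Sum>k<n. c \<bullet> z \<omega> k - \<eta> * (norm c)\<^sup>2 / 2)"
    proof (rule sum.cong[OF refl])
      fix k
      have "(\<Sum>i\<in>Basis. \<eta> * (c \<bullet> i)\<^sup>2 / 2) = \<eta> / 2 * (\<Sum>i\<in>Basis. (c \<bullet> i) * (c \<bullet> i))"
        by (simp add: sum_distrib_left power2_eq_square)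
      also have "\<dots> = \<eta> * (norm c)\<^sup>2 / 2"
        unfolding euclidean_inner[of c c, symmetric] by (simp add: power2_norm_eq_inner)
      finally show "(\<Sum>i\<in>Basis. (c \<bullet> i) * (z \<omega> k \<bullet> i) - \<eta> * (c \<bullet> i)\<^sup>2 / 2) = c \<bullet> z \<omega> k - \<eta> * (norm c)\<^sup>2 / 2"
        unfolding sum_subtractf euclidean_inner[of c "z \<omega> k", symmetric] by simp
    qed
    also have "\<dots> = c \<bullet> W (real n * \<eta>) \<omega> - real n * \<eta> * (norm c)\<^sup>2 / 2"
      using sumz[OF \<omega>] by (simp add: sum_subtractf inner_sum_right[symmetric])
    finally show "F (?Y \<omega>) * (\<Prod>p\<in>?I. ennreal (exp (?c p * ?Y \<omega> p - \<eta> * (?c p)\<^sup>2 / 2)))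
        = G (euler b \<eta> x (z \<omega>) n, W (real n * \<eta>) \<omega>)
            * ennreal (exp (c \<bullet> W (real n * \<eta>) \<omega> - real n * \<eta> * (norm c)\<^sup>2 / 2))"
      unfolding 1 by simp
  qed
  finally show ?thesis .
qed

end

section \<open>Ball bounds for the Euler scheme\<close>

lemma near_scaling_preimage_subset_cball:
  fixes f :: "'a::real_normed_vector \<Rightarrow> 'a"
  assumes \<delta>: "0 < \<delta>" and f: "\<And>c c'. norm (f c - f c' - \<delta> *\<^sub>R (c - c')) \<le> \<delta> / 2 * norm (c - c')"
    and c0: "f c0 \<in> ball y r"
  shows "{c. f c \<in> ball y r} \<subseteq> cball c0 (4 * r / \<delta>)"
proof
  fix c assume "c \<in> {c. f c \<in> ball y r}"
  then have "dist (f c) (f c0) < 2 * r"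
    using c0 dist_triangle_less_add[of "f c" y r "f c0" r] by (simp add: dist_commute)
  moreover have "\<delta> * norm (c - c0) \<le> norm (f c - f c0) + norm (f c - f c0 - \<delta> *\<^sub>R (c - c0))"
    using norm_triangle_ineq4[of "f c - f c0" "f c - f c0 - \<delta> *\<^sub>R (c - c0)"] \<delta> by simp
  ultimately have "\<delta> / 2 * norm (c - c0) < 2 * r"
    using f[of c c0] by (simp add: dist_norm)
  then show "c \<in> cball c0 (4 * r / \<delta>)"
    using \<delta> by (simp add: dist_norm norm_minus_commute field_simps)
qed

text \<open>The centre y has a preimage c0 by Banach's fixed point theorem, and f has Lipschitz
  constant at most 3/2 * \<delta>, so the ball of radius r/(2 \<delta>) around c0 is mapped to
  within 3/4 * r of y.\<close>

lemma near_scaling_preimage_supset_ball: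
  fixes f :: "'a::banach \<Rightarrow> 'a"
  assumes \<delta>: "0 < \<delta>" and f: "\<And>c c'. norm (f c - f c' - \<delta> *\<^sub>R (c - c')) \<le> \<delta> / 2 * norm (c - c')"
    and r: "0 < r"
  shows "\<exists>c0. norm c0 \<le> 2 * norm (f 0 - y) / \<delta> \<and> ball c0 (r / (2 * \<delta>)) \<subseteq> {c. f c \<in> ball y r}"
proof -
  \<comment> \<open>A simplified Newton step for f c = y, with \<delta> times the identity in place
    of the derivative; it contracts with factor 1/2 and its fixed points are the solutions.\<close>
  define T where "T c = c - (1 / \<delta>) *\<^sub>R (f c - y)" for c
  have "dist (T c) (T c') \<le> 1/2 * dist c c'" for c c'
  proof -
    have "T c - T c' = (- 1 / \<delta>) *\<^sub>R (f c - f c' - \<delta> *\<^sub>R (c - c'))"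
      using \<delta> by (simp add: T_def algebra_simps)
    then have "norm (T c - T c') = 1 / \<delta> * norm (f c - f c' - \<delta> *\<^sub>R (c - c'))"
      using \<delta> by simp
    also have "\<dots> \<le> 1 / \<delta> * (\<delta> / 2 * norm (c - c'))"
      using \<delta> by (intro mult_left_mono f) auto
    finally show ?thesis using \<delta> by (simp add: dist_norm)
  qed
  then have "\<exists>!c. T c = c"
    by (intro banach_fix_type[of "1/2"]) auto
  then obtain c0 where "T c0 = c0" by blast
  then have fc0: "f c0 = y" using \<delta> by (simp add: T_def)
  have "\<delta> * norm c0 \<le> norm (f c0 - f 0) + norm (f c0 - f 0 - \<delta> *\<^sub>R (c0 - 0))"
    using norm_triangle_ineq4[of "f c0 - f 0" "f c0 - f 0 - \<delta> *\<^sub>R (c0 - 0)"] \<delta> by simp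
  also have "\<dots> \<le> norm (f 0 - y) + \<delta> / 2 * norm c0"
    using f[of c0 0] fc0 by (simp add: norm_minus_commute)
  finally have "norm c0 \<le> 2 * norm (f 0 - y) / \<delta>" using \<delta> by (simp add: field_simps)
  moreover have "f c \<in> ball y r" if "c \<in> ball c0 (r / (2 * \<delta>))" for c
  proof -
    have "norm (f c - f c0) \<le> norm (f c - f c0 - \<delta> *\<^sub>R (c - c0)) + norm (\<delta> *\<^sub>R (c - c0))"
      using norm_triangle_ineq[of "f c - f c0 - \<delta> *\<^sub>R (c - c0)" "\<delta> *\<^sub>R (c - c0)"] by simp
    also have "\<dots> \<le> \<delta> / 2 * norm (c - c0) + \<delta> * norm (c - c0)"
      using f[of c c0] \<delta> by simp
    also have "\<dots> = 3/2 * (\<delta> * norm (c - c0))" by simp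
    also have "\<dots> < r"
    proof -
      have "\<delta> * norm (c - c0) < r / 2"
        using that \<delta> by (simp add: dist_norm norm_minus_commute field_simps)
      then show ?thesis using r by simp
    qed
    finally show ?thesis using fc0 by (simp add: dist_norm norm_minus_commute)
  qed
  ultimately show ?thesis by blast
qed

section \<open>Hitting probabilities of balls for the discretised equation\<close>

locale sde = brownian M W for M :: "'w measure" and W :: "real \<Rightarrow> 'w \<Rightarrow> 'a::euclidean_space" +
  fixes b :: "'a \<Rightarrow> 'a" and K :: real and X :: "'a \<Rightarrow> real \<Rightarrow> 'w \<Rightarrow> 'a"
  assumes lip: "\<And>x y. norm (b x - b y) \<le> K * norm (x - y)"
    and sol: "sde_solution M b W X"
begin

abbreviation z :: "real \<Rightarrow> 'w \<Rightarrow> nat \<Rightarrow> 'a" where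
  "z \<eta> \<omega> \<equiv> increments (\<lambda>t. W t \<omega>) \<eta>"

lemma measurable_b: "b \<in> borel_measurable borel"
  by (intro borel_measurable_continuous_onI lipschitz_imp_continuous_on[OF lip])

lemma measurable_euler_start:
  assumes "0 < \<eta>"
  shows "(\<lambda>(x, \<omega>). euler b \<eta> x (z \<eta> \<omega>) n) \<in> borel \<Otimes>\<^sub>M M \<rightarrow>\<^sub>M borel"
proof -
  have "(\<lambda>p. euler b \<eta> (fst p) (z \<eta> (snd p)) n) \<in> borel \<Otimes>\<^sub>M M \<rightarrow>\<^sub>M borel"
    by (intro measurable_euler measurable_b measurable_fst measurable_compose[OF measurable_snd] measurable_increments assms)
  then show ?thesis by (simp add: case_prod_beta')
qed

lemma measurable_euler_z:
  assumes "0 < \<eta>" shows "(\<lambda>\<omega>. euler b \<eta> x (z \<eta> \<omega>) n) \<in> M \<rightarrow>\<^sub>M borel"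
  by (intro measurable_euler measurable_b measurable_const measurable_increments assms) auto

lemma measurable_euler_shifted:
  assumes "0 < \<eta>"
  shows "(\<lambda>(c, \<omega>). euler b \<eta> x (\<lambda>k. z \<eta> \<omega> k + \<eta> *\<^sub>R (\<kappa> *\<^sub>R c)) n) \<in> lborel \<Otimes>\<^sub>M M \<rightarrow>\<^sub>M borel"
proof -
  have "(\<lambda>p. euler b \<eta> x (\<lambda>k. z \<eta> (snd p) k + \<eta> *\<^sub>R (\<kappa> *\<^sub>R fst p)) n) \<in> lborel \<Otimes>\<^sub>M M \<rightarrow>\<^sub>M borel"
    by (intro measurable_euler measurable_b measurable_const borel_measurable_add
        measurable_compose[OF measurable_snd] measurable_increments assms
        borel_measurable_scaleR borel_measurable_const measurable_compose[OF measurable_fst]) auto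
  then show ?thesis by (simp add: case_prod_beta')
qed

text \<open>Tonelli: the hitting probability averaged over shifts is the expected Lebesgue measure
  of the set of shifts that steer the endpoint into A. The factor \<kappa> serves for the two signs,
  and E can restrict the noise.\<close>

lemma nn_integral_shift_swap:
  assumes "0 < \<eta>" and D: "D \<in> sets borel" and A: "A \<in> sets borel" and E: "E \<in> sets M"
  shows "(\<integral>\<^sup>+c. indicator D c * (\<integral>\<^sup>+\<omega>. indicator A (euler b \<eta> x (\<lambda>k. z \<eta> \<omega> k + \<eta> *\<^sub>R (\<kappa> *\<^sub>R c)) n)
              * indicator E \<omega> \<partial>M) \<partial>lborel)
       = (\<integral>\<^sup>+\<omega>. indicator E \<omega> * emeasure lborel
            (D \<inter> {c. euler b \<eta> x (\<lambda>k. z \<eta> \<omega> k + \<eta> *\<^sub>R (\<kappa> *\<^sub>R c)) n \<in> A}) \<partial>M)"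
proof -
  interpret P: pair_sigma_finite lborel M ..
  let ?f = "\<lambda>c \<omega>. euler b \<eta> x (\<lambda>k. z \<eta> \<omega> k + \<eta> *\<^sub>R (\<kappa> *\<^sub>R c)) n"
  have f [measurable]: "(\<lambda>(c, \<omega>). ?f c \<omega>) \<in> lborel \<Otimes>\<^sub>M M \<rightarrow>\<^sub>M borel"
    by (rule measurable_euler_shifted[OF assms(1)])
  note [measurable] = D A E
  have fc [measurable]: "(\<lambda>c. ?f c \<omega>) \<in> borel \<rightarrow>\<^sub>M borel" if "\<omega> \<in> space M" for \<omega>
    using measurable_compose[OF measurable_Pair2'[OF that] f] by simp
  have f\<omega> [measurable]: "?f c \<in> M \<rightarrow>\<^sub>M borel" for c
    using measurable_compose[OF measurable_Pair1' f, of c] by simp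
  have "(\<integral>\<^sup>+c. indicator D c * (\<integral>\<^sup>+\<omega>. indicator A (?f c \<omega>) * indicator E \<omega> \<partial>M) \<partial>lborel)
      = (\<integral>\<^sup>+c. \<integral>\<^sup>+\<omega>. indicator D c * (indicator A (?f c \<omega>) * indicator E \<omega>) \<partial>M \<partial>lborel)"
    by (intro nn_integral_cong nn_integral_cmult[symmetric]) measurable
  also have "\<dots> = (\<integral>\<^sup>+\<omega>. \<integral>\<^sup>+c. indicator D c * (indicator A (?f c \<omega>) * indicator E \<omega>) \<partial>lborel \<partial>M)"
    by (rule P.Fubini'[symmetric]) measurable
  also have "\<dots> = (\<integral>\<^sup>+\<omega>. indicator E \<omega> * emeasure lborel (D \<inter> {c. ?f c \<omega> \<in> A}) \<partial>M)"
  proof (rule nn_integral_cong)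
    fix \<omega> assume \<omega>: "\<omega> \<in> space M"
    have s: "D \<inter> {c. ?f c \<omega> \<in> A} \<in> sets lborel"
      using measurable_sets[OF fc[OF \<omega>] A] D by (simp add: vimage_def sets.Int)
    have "(\<integral>\<^sup>+c. indicator D c * (indicator A (?f c \<omega>) * indicator E \<omega>) \<partial>lborel)
        = (\<integral>\<^sup>+c. indicator E \<omega> * indicator (D \<inter> {c. ?f c \<omega> \<in> A}) c \<partial>lborel)"
      by (intro nn_integral_cong) (auto simp: indicator_def)
    also have "\<dots> = indicator E \<omega> * emeasure lborel (D \<inter> {c. ?f c \<omega> \<in> A})"
      using s by (subst nn_integral_cmult) auto
    finally show "(\<integral>\<^sup>+c. indicator D c * (indicator A (?f c \<omega>) * indicator E \<omega>) \<partial>lborel)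
        = indicator E \<omega> * emeasure lborel (D \<inter> {c. ?f c \<omega> \<in> A})" .
  qed
  finally show ?thesis .
qed

text \<open>Averaging over the shifts c and -c turns the unbounded Cameron--Martin weight into
  a hyperbolic cosine, which is bounded below.\<close>

lemma euler_ball_upper:
  assumes \<eta>: "0 < \<eta>" and n: "0 < n" and small: "K * (real n * \<eta>) \<le> 1/3" and r: "0 < r"
  defines "\<delta> \<equiv> real n * \<eta>"
  shows "emeasure M {\<omega> \<in> space M. euler b \<eta> x (z \<eta> \<omega>) n \<in> ball y r}
           \<le> ennreal (exp (\<delta> / 2) * (4 / \<delta>) ^ DIM('a) * r ^ DIM('a))"
proof -
  have \<delta>: "0 < \<delta>" using \<eta> n by (simp add: \<delta>_def)
  let ?f = "\<lambda>c \<omega>. euler b \<eta> x (\<lambda>k. z \<eta> \<omega> k + \<eta> *\<^sub>R c) n"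
  let ?S = "\<lambda>\<omega>. W \<delta> \<omega>" and ?A = "ball y r"
  let ?I = "\<lambda>\<omega>. indicator ?A (euler b \<eta> x (z \<eta> \<omega>) n) :: ennreal"
  let ?e = "\<lambda>c. \<integral>\<^sup>+\<omega>. indicator ?A (?f c \<omega>) \<partial>M"
  let ?p = "emeasure M {\<omega> \<in> space M. euler b \<eta> x (z \<eta> \<omega>) n \<in> ?A}"
  let ?v = "unit_ball_vol (real DIM('a))"
  have v: "0 < ?v" by simp
  note [measurable] = measurable_euler_z[OF \<eta>, of x n] measurable_W[OF \<delta>] measurable_b
  have mI [measurable]: "?I \<in> borel_measurable M"
    by (rule measurable_compose[OF measurable_euler_z[OF \<eta>] borel_measurable_indicator]) auto
  have pI: "?p = (\<integral>\<^sup>+\<omega>. ?I \<omega> \<partial>M)"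
  proof -
    have "(\<integral>\<^sup>+\<omega>. ?I \<omega> \<partial>M) = (\<integral>\<^sup>+\<omega>. indicator {\<omega> \<in> space M. euler b \<eta> x (z \<eta> \<omega>) n \<in> ?A} \<omega> \<partial>M)"
      by (intro nn_integral_cong) (auto simp: indicator_def)
    then show ?thesis by simp
  qed
  have fst: "(\<lambda>p. indicator ?A (fst p) :: ennreal) \<in> borel_measurable (borel :: ('a \<times> 'a) measure)"
    by (intro measurable_compose[OF _ borel_measurable_indicator[where M = borel]] borel_measurable_continuous_onI
        continuous_intros) auto
  have cm: "?e c = (\<integral>\<^sup>+\<omega>. ?I \<omega> * ennreal (exp (c \<bullet> ?S \<omega> - \<delta> * (norm c)\<^sup>2 / 2)) \<partial>M)" for c
    using cameron_martin_euler[OF \<eta> n measurable_b fst, of x c] by (simp add: \<delta>_def)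
  have sym: "ennreal (2 * exp (- \<delta> / 2)) * ?p \<le> ?e c + ?e (- c)" if c: "norm c \<le> 1" for c
  proof -
    have "ennreal (2 * exp (- \<delta> / 2)) * ?p = (\<integral>\<^sup>+\<omega>. ?I \<omega> * ennreal (2 * exp (- \<delta> / 2)) \<partial>M)"
      unfolding pI by (subst nn_integral_multc[OF mI]) (simp add: mult.commute)
    also have "\<dots> \<le> (\<integral>\<^sup>+\<omega>. ?I \<omega> * ennreal (exp (c \<bullet> ?S \<omega> - \<delta> * (norm c)\<^sup>2 / 2))
        + ?I \<omega> * ennreal (exp (- c \<bullet> ?S \<omega> - \<delta> * (norm (- c))\<^sup>2 / 2)) \<partial>M)"
    proof (rule nn_integral_mono)
      fix \<omega>
      let ?t = "c \<bullet> ?S \<omega>"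
      have "(norm c)\<^sup>2 \<le> 1" using c by (simp add: power_le_one)
      then have "exp (- \<delta> / 2) \<le> exp (- (\<delta> * (norm c)\<^sup>2 / 2))" using \<delta> by simp
      moreover have "2 \<le> exp ?t + exp (- ?t)"
        using exp_ge_add_one_self[of ?t] exp_ge_add_one_self[of "- ?t"] by linarith
      ultimately have "2 * exp (- \<delta> / 2) \<le> (exp ?t + exp (- ?t)) * exp (- (\<delta> * (norm c)\<^sup>2 / 2))"
        by (intro mult_mono) auto
      also have "\<dots> = exp (?t - \<delta> * (norm c)\<^sup>2 / 2) + exp (- ?t - \<delta> * (norm c)\<^sup>2 / 2)"
        by (simp add: distrib_right exp_add[symmetric])
      finally have "ennreal (2 * exp (- \<delta> / 2))
          \<le> ennreal (exp (?t - \<delta> * (norm c)\<^sup>2 / 2)) + ennreal (exp (- ?t - \<delta> * (norm c)\<^sup>2 / 2))"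
        by (simp add: ennreal_plus[symmetric] ennreal_leI del: ennreal_plus)
      then show "?I \<omega> * ennreal (2 * exp (- \<delta> / 2))
          \<le> ?I \<omega> * ennreal (exp (c \<bullet> ?S \<omega> - \<delta> * (norm c)\<^sup>2 / 2))
            + ?I \<omega> * ennreal (exp (- c \<bullet> ?S \<omega> - \<delta> * (norm (- c))\<^sup>2 / 2))"
        by (simp add: distrib_left[symmetric] mult_left_mono)
    qed
    also have "\<dots> = ?e c + ?e (- c)"
      unfolding cm by (rule nn_integral_add) measurable
    finally show ?thesis .
  qed
  \<comment> \<open>For each realization of the noise, two shifts leading into the ball differ by at
    most 4 r/\<delta>, so a ball of that radius contains them all.\<close>
  have int: "(\<integral>\<^sup>+c. indicator (ball 0 1) c * ?e (\<kappa> *\<^sub>R c) \<partial>lborel) \<le> ennreal (?v * (4 * r / \<delta>) ^ DIM('a))"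
    if \<kappa>: "\<bar>\<kappa>\<bar> = 1" for \<kappa>
  proof -
    have "(\<integral>\<^sup>+c. indicator (ball 0 1) c * ?e (\<kappa> *\<^sub>R c) \<partial>lborel)
        = (\<integral>\<^sup>+\<omega>. indicator (space M) \<omega> * emeasure lborel (ball 0 1 \<inter> {c. ?f (\<kappa> *\<^sub>R c) \<omega> \<in> ?A}) \<partial>M)"
      using nn_integral_shift_swap[OF \<eta>, of "ball 0 1" ?A "space M" x \<kappa> n]
      by (simp cong: nn_integral_cong)
    also have "\<dots> \<le> (\<integral>\<^sup>+\<omega>. ennreal (?v * (4 * r / \<delta>) ^ DIM('a)) \<partial>M)"
    proof (rule nn_integral_mono)
      fix \<omega>
      let ?P = "{c. ?f (\<kappa> *\<^sub>R c) \<omega> \<in> ?A}"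
      have "emeasure lborel (ball 0 1 \<inter> ?P) \<le> ennreal (?v * (4 * r / \<delta>) ^ DIM('a))"
      proof (cases "?P = {}")
        case False
        then obtain c0 where c0: "?f (\<kappa> *\<^sub>R c0) \<omega> \<in> ?A" by blast
        have sub: "{c. ?f c \<omega> \<in> ?A} \<subseteq> cball (\<kappa> *\<^sub>R c0) (4 * r / \<delta>)"
          using euler_shifted_noise[OF lip less_imp_le[OF \<eta>] small, folded \<delta>_def] c0
          by (intro near_scaling_preimage_subset_cball[OF \<delta>]) auto
        have "?P \<subseteq> cball c0 (4 * r / \<delta>)"
        proof
          fix c assume "c \<in> ?P"
          then have "\<kappa> *\<^sub>R c \<in> cball (\<kappa> *\<^sub>R c0) (4 * r / \<delta>)" using sub by blast
          then have "norm (\<kappa> *\<^sub>R c0 - \<kappa> *\<^sub>R c) \<le> 4 * r / \<delta>" by (simp add: dist_norm)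
          then show "c \<in> cball c0 (4 * r / \<delta>)"
            using \<kappa> by (simp add: scaleR_diff_right[symmetric] dist_norm del: scaleR_diff_right)
        qed
        then have "emeasure lborel (ball 0 1 \<inter> ?P) \<le> emeasure lborel (cball c0 (4 * r / \<delta>))"
          by (intro emeasure_mono) auto
        also have "\<dots> = ennreal (?v * (4 * r / \<delta>) ^ DIM('a))"
          using r \<delta> by (intro emeasure_cball) auto
        finally show ?thesis .
      qed simp
      then show "indicator (space M) \<omega> * emeasure lborel (ball 0 1 \<inter> ?P) \<le> ennreal (?v * (4 * r / \<delta>) ^ DIM('a))"
        by (auto simp: indicator_def)
    qed
    also have "\<dots> = ennreal (?v * (4 * r / \<delta>) ^ DIM('a))"
      by (simp add: emeasure_space_1)
    finally show ?thesis .
  qed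
  have me: "(\<lambda>c. ?e (\<kappa> *\<^sub>R c)) \<in> borel_measurable lborel" for \<kappa>
  proof -
    have "(\<lambda>(c, \<omega>). indicator ?A (?f (\<kappa> *\<^sub>R c) \<omega>) :: ennreal) \<in> borel_measurable (lborel \<Otimes>\<^sub>M M)"
      using measurable_compose[OF measurable_euler_shifted[OF \<eta>, of x \<kappa> n]
          borel_measurable_indicator[where M = borel, of ?A]]
      by (simp add: case_prod_beta')
    then show ?thesis by (rule borel_measurable_nn_integral)
  qed
  \<comment> \<open>The symmetrized inequality is integrated over the unit ball of shifts; its
    volume cancels against the same factor in the volume of the ball of steering shifts.\<close>
  have "ennreal (?v * (2 * exp (- \<delta> / 2))) * ?p
      = (\<integral>\<^sup>+c. indicator (ball 0 1) c * (ennreal (2 * exp (- \<delta> / 2)) * ?p) \<partial>(lborel :: 'a measure))"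
    using v by (subst nn_integral_multc) (auto simp: emeasure_ball ennreal_mult mult.assoc intro!: borel_measurable_indicator)
  also have "\<dots> \<le> (\<integral>\<^sup>+c. indicator (ball 0 1) c * ?e (1 *\<^sub>R c) + indicator (ball 0 1) c * ?e ((- 1) *\<^sub>R c) \<partial>lborel)"
    by (intro nn_integral_mono) (use sym in \<open>auto simp: indicator_def\<close>)
  also have "\<dots> = (\<integral>\<^sup>+c. indicator (ball 0 1) c * ?e (1 *\<^sub>R c) \<partial>lborel)
      + (\<integral>\<^sup>+c. indicator (ball 0 1) c * ?e ((- 1) *\<^sub>R c) \<partial>lborel)"
    by (intro nn_integral_add borel_measurable_times_ennreal me borel_measurable_indicator) auto
  also have "\<dots> \<le> ennreal (?v * (4 * r / \<delta>) ^ DIM('a)) + ennreal (?v * (4 * r / \<delta>) ^ DIM('a))"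
    by (intro add_mono int) auto
  also have "\<dots> = ennreal (2 * (?v * (4 * r / \<delta>) ^ DIM('a)))"
    using r \<delta> v by (simp add: ennreal_plus[symmetric] del: ennreal_plus)
  finally have "?v * (2 * exp (- \<delta> / 2)) * measure M {\<omega> \<in> space M. euler b \<eta> x (z \<eta> \<omega>) n \<in> ?A}
      \<le> 2 * (?v * (4 * r / \<delta>) ^ DIM('a))"
    using v r \<delta> by (simp add: emeasure_eq_measure ennreal_mult[symmetric])
  then have "exp (- \<delta> / 2) * measure M {\<omega> \<in> space M. euler b \<eta> x (z \<eta> \<omega>) n \<in> ?A} \<le> (4 * r / \<delta>) ^ DIM('a)"
    using v by (simp add: mult_ac)
  then have "measure M {\<omega> \<in> space M. euler b \<eta> x (z \<eta> \<omega>) n \<in> ?A} \<le> exp (\<delta> / 2) * (4 * r / \<delta>) ^ DIM('a)"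
    by (simp add: exp_minus field_simps)
  then show ?thesis
    by (simp add: emeasure_eq_measure ennreal_leI power_mult_distrib power_divide)
qed

text \<open>If the unshifted endpoint is bounded, a whole ball of bounded shifts steers it into the
  target. Undoing the shift costs the Cameron--Martin weight, which is bounded above only while W
  stays bounded, hence the second condition in the event. The constant \<kappa> precedes \<eta> and
  n, so it survives refinement of the grid.\<close>

lemma euler_ball_lower:
  assumes \<delta>: "0 < \<delta>" and small: "K * \<delta> \<le> 1/3" and R: "0 \<le> R" and \<rho>: "0 \<le> \<rho>" and s: "0 \<le> s"
  shows "\<exists>\<kappa>>0. \<forall>\<eta> n x y r. 0 < \<eta> \<longrightarrow> real n * \<eta> = \<delta> \<longrightarrow> norm y \<le> R \<longrightarrow> 0 < r \<longrightarrow> r \<le> 1 \<longrightarrow>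
           \<kappa> * r ^ DIM('a) * measure M {\<omega> \<in> space M. norm (euler b \<eta> x (z \<eta> \<omega>) n) \<le> \<rho> \<and> norm (W \<delta> \<omega>) \<le> s}
           \<le> measure M {\<omega> \<in> space M. euler b \<eta> x (z \<eta> \<omega>) n \<in> ball y r}"
proof -
  \<comment> \<open>Equals 2 (R + \<rho>)/\<delta> + 1/(2 \<delta>): the bound for the steering
    shift c0 plus the radius of the ball around it when r = 1.\<close>
  define q where "q = (4 * (R + \<rho>) + 1) / (2 * \<delta>)"
  have q: "0 < q" using R \<rho> \<delta> by (simp add: q_def add_nonneg_pos)
  \<comment> \<open>Bounds the weight for shifts of norm at most q when the shifted noise endpoint
    has norm at most s + \<delta> * q.\<close>
  define E where "E = exp (q * (s + \<delta> * q))"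
  let ?v = "unit_ball_vol (real DIM('a))"
  have v: "0 < ?v" by simp
  define \<kappa> where "\<kappa> = (1 / (2 * \<delta>)) ^ DIM('a) / (q ^ DIM('a) * E)"
  have \<kappa>: "0 < \<kappa>" using q \<delta> by (simp add: \<kappa>_def E_def)
  show ?thesis
  proof (intro exI[of _ \<kappa>] conjI \<kappa> allI impI)
    fix \<eta> n and x y :: 'a and r :: real
    assume \<eta>: "0 < \<eta>" and n\<eta>: "real n * \<eta> = \<delta>" and y: "norm y \<le> R" and r: "0 < r" "r \<le> 1"
    have n: "0 < n" using n\<eta> \<delta> by (cases n) auto
    let ?f = "\<lambda>c \<omega>. euler b \<eta> x (\<lambda>k. z \<eta> \<omega> k + \<eta> *\<^sub>R c) n"
    let ?S = "\<lambda>\<omega>. W \<delta> \<omega>" and ?A = "ball y r"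
    let ?I = "\<lambda>\<omega>. indicator ?A (euler b \<eta> x (z \<eta> \<omega>) n) :: ennreal"
    let ?P = "{\<omega> \<in> space M. euler b \<eta> x (z \<eta> \<omega>) n \<in> ?A}"
    let ?H = "{\<omega> \<in> space M. norm (euler b \<eta> x (z \<eta> \<omega>) n) \<le> \<rho> \<and> norm (?S \<omega>) \<le> s}"
    let ?Q = "{\<omega> \<in> space M. norm (?S \<omega>) \<le> s}"
    note [measurable] = measurable_euler_z[OF \<eta>, of x n] measurable_W[OF \<delta>] measurable_b
    have mI [measurable]: "?I \<in> borel_measurable M"
      by (rule measurable_compose[OF measurable_euler_z[OF \<eta>] borel_measurable_indicator]) auto
    have pI: "emeasure M ?P = (\<integral>\<^sup>+\<omega>. ?I \<omega> \<partial>M)"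
    proof -
      have "(\<integral>\<^sup>+\<omega>. ?I \<omega> \<partial>M) = (\<integral>\<^sup>+\<omega>. indicator ?P \<omega> \<partial>M)"
        by (intro nn_integral_cong) (auto simp: indicator_def)
      then show ?thesis by simp
    qed
    have Qs: "?Q \<in> sets M" by measurable
    have 1: "(\<integral>\<^sup>+\<omega>. indicator ?A (?f c \<omega>) * indicator ?Q \<omega> \<partial>M) \<le> ennreal E * emeasure M ?P"
      if c: "norm c \<le> q" for c
    proof -
      \<comment> \<open>The second factor follows the shifted endpoint: a noise endpoint of norm at
        most s becomes one of norm at most s + \<delta> * q, and after the change of measure it caps
        the weight by E.\<close>
      let ?G = "\<lambda>p :: 'a \<times> 'a. indicator ?A (fst p) * indicator (cball 0 (s + \<delta> * q)) (snd p) :: ennreal"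
      have G: "?G \<in> borel_measurable borel"
        by (intro borel_measurable_times_ennreal
            measurable_compose[OF _ borel_measurable_indicator[where M = borel]] borel_measurable_continuous_onI
            continuous_intros) auto
      have "(\<integral>\<^sup>+\<omega>. indicator ?A (?f c \<omega>) * indicator ?Q \<omega> \<partial>M) \<le> (\<integral>\<^sup>+\<omega>. ?G (?f c \<omega>, ?S \<omega> + \<delta> *\<^sub>R c) \<partial>M)"
      proof (rule nn_integral_mono)
        fix \<omega>
        have "norm (?S \<omega> + \<delta> *\<^sub>R c) \<le> s + \<delta> * q" if "norm (?S \<omega>) \<le> s"
          using norm_triangle_mono[OF that, of "\<delta> *\<^sub>R c" "\<delta> * q"] mult_left_mono[OF c, of \<delta>] \<delta> by simp
        then show "indicator ?A (?f c \<omega>) * indicator ?Q \<omega> \<le> ?G (?f c \<omega>, ?S \<omega> + \<delta> *\<^sub>R c)"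
          by (auto simp: indicator_def)
      qed
      also have "\<dots> = (\<integral>\<^sup>+\<omega>. ?G (euler b \<eta> x (z \<eta> \<omega>) n, ?S \<omega>)
          * ennreal (exp (c \<bullet> ?S \<omega> - \<delta> * (norm c)\<^sup>2 / 2)) \<partial>M)"
        using cameron_martin_euler[OF \<eta> n measurable_b G, of x c] unfolding n\<eta> .
      also have "\<dots> \<le> (\<integral>\<^sup>+\<omega>. ?I \<omega> * ennreal E \<partial>M)"
      proof (rule nn_integral_mono)
        fix \<omega>
        have "exp (c \<bullet> ?S \<omega> - \<delta> * (norm c)\<^sup>2 / 2) \<le> E" if "norm (?S \<omega>) \<le> s + \<delta> * q"
        proof -
          have "c \<bullet> ?S \<omega> \<le> norm c * norm (?S \<omega>)" by (rule norm_cauchy_schwarz)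
          also have "\<dots> \<le> q * (s + \<delta> * q)" using c that q by (intro mult_mono) auto
          finally show ?thesis unfolding E_def
            using mult_nonneg_nonneg[OF less_imp_le[OF \<delta>] zero_le_power2[of "norm c"]]
            by (intro iffD2[OF exp_le_cancel_iff]) linarith
        qed
        then show "?G (euler b \<eta> x (z \<eta> \<omega>) n, ?S \<omega>) * ennreal (exp (c \<bullet> ?S \<omega> - \<delta> * (norm c)\<^sup>2 / 2))
            \<le> ?I \<omega> * ennreal E"
          by (auto simp: indicator_def ennreal_leI)
      qed
      also have "\<dots> = ennreal E * emeasure M ?P"
        unfolding pI by (subst nn_integral_multc[OF mI]) (simp add: mult.commute)
      finally show ?thesis .
    qed
    have "ennreal (?v * (r / (2 * \<delta>)) ^ DIM('a)) * emeasure M ?H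
        = (\<integral>\<^sup>+\<omega>. ennreal (?v * (r / (2 * \<delta>)) ^ DIM('a)) * indicator ?H \<omega> \<partial>M)"
      by (subst nn_integral_cmult_indicator) auto
    also have "\<dots> \<le> (\<integral>\<^sup>+\<omega>. indicator ?Q \<omega> * emeasure lborel (cball 0 q \<inter> {c. ?f (1 *\<^sub>R c) \<omega> \<in> ?A}) \<partial>M)"
    proof (rule nn_integral_mono)
      fix \<omega> assume \<omega>: "\<omega> \<in> space M"
      show "ennreal (?v * (r / (2 * \<delta>)) ^ DIM('a)) * indicator ?H \<omega>
          \<le> indicator ?Q \<omega> * emeasure lborel (cball 0 q \<inter> {c. ?f (1 *\<^sub>R c) \<omega> \<in> ?A})"
      proof (cases "\<omega> \<in> ?H")
        case True
        have "\<exists>c0. norm c0 \<le> 2 * norm (?f 0 \<omega> - y) / \<delta> \<and> ball c0 (r / (2 * \<delta>)) \<subseteq> {c. ?f c \<omega> \<in> ?A}"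
          using euler_shifted_noise[OF lip less_imp_le[OF \<eta>], of n x] small n\<eta> r
          by (intro near_scaling_preimage_supset_ball[OF \<delta>]) auto
        then obtain c0 where c0: "norm c0 \<le> 2 * norm (?f 0 \<omega> - y) / \<delta>" "ball c0 (r / (2 * \<delta>)) \<subseteq> {c. ?f c \<omega> \<in> ?A}"
          by blast
        have "norm (?f 0 \<omega> - y) \<le> R + \<rho>"
          using True y norm_triangle_ineq4[of "?f 0 \<omega>" y] by simp
        then have "2 * norm (?f 0 \<omega> - y) / \<delta> \<le> 2 * (R + \<rho>) / \<delta>"
          using \<delta> by (intro divide_right_mono) auto
        moreover have "r / (2 * \<delta>) \<le> 1 / (2 * \<delta>)" using r \<delta> by (intro divide_right_mono) auto
        moreover have "2 * (R + \<rho>) / \<delta> + 1 / (2 * \<delta>) = q" using \<delta> by (simp add: q_def field_simps)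
        ultimately have c0q: "norm c0 + r / (2 * \<delta>) \<le> q" using c0(1) by linarith
        have "ball c0 (r / (2 * \<delta>)) \<subseteq> cball 0 q"
        proof
          fix c assume "c \<in> ball c0 (r / (2 * \<delta>))"
          then have "norm c \<le> norm c0 + r / (2 * \<delta>)"
            using norm_triangle_ineq2[of c c0] by (simp add: dist_norm norm_minus_commute)
          then show "c \<in> cball 0 q" using c0q by simp
        qed
        then have sub: "ball c0 (r / (2 * \<delta>)) \<subseteq> cball 0 q \<inter> {c. ?f (1 *\<^sub>R c) \<omega> \<in> ?A}" using c0(2) by auto
        have "(\<lambda>c. ?f (1 *\<^sub>R c) \<omega>) \<in> borel \<rightarrow>\<^sub>M borel"
          using measurable_compose[OF measurable_Pair2'[OF \<omega>] measurable_euler_shifted[OF \<eta>, of x 1 n]] by simp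
        from measurable_sets[OF this, of ?A]
        have "cball 0 q \<inter> {c. ?f (1 *\<^sub>R c) \<omega> \<in> ?A} \<in> sets lborel" by (simp add: vimage_def sets.Int)
        then have "emeasure lborel (ball c0 (r / (2 * \<delta>))) \<le> emeasure lborel (cball 0 q \<inter> {c. ?f (1 *\<^sub>R c) \<omega> \<in> ?A})"
          by (rule emeasure_mono[OF sub])
        moreover have "emeasure lborel (ball c0 (r / (2 * \<delta>))) = ennreal (?v * (r / (2 * \<delta>)) ^ DIM('a))"
          using r \<delta> by (intro emeasure_ball) auto
        ultimately show ?thesis using True by simp
      qed simp
    qed
    also have "\<dots> = (\<integral>\<^sup>+c. indicator (cball 0 q) c * (\<integral>\<^sup>+\<omega>. indicator ?A (?f (1 *\<^sub>R c) \<omega>) * indicator ?Q \<omega> \<partial>M) \<partial>lborel)"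
      by (rule nn_integral_shift_swap[OF \<eta> _ _ Qs, symmetric]) auto
    also have "\<dots> \<le> (\<integral>\<^sup>+c. indicator (cball 0 q) c * (ennreal E * emeasure M ?P) \<partial>(lborel :: 'a measure))"
      by (intro nn_integral_mono) (use 1 in \<open>auto simp: indicator_def\<close>)
    also have "\<dots> = ennreal (?v * q ^ DIM('a)) * (ennreal E * emeasure M ?P)"
      using q by (subst nn_integral_multc) (auto simp: emeasure_cball intro!: borel_measurable_indicator)
    finally have "?v * (r / (2 * \<delta>)) ^ DIM('a) * measure M ?H \<le> ?v * q ^ DIM('a) * (E * measure M ?P)"
      using v r \<delta> q by (simp add: emeasure_eq_measure ennreal_mult[symmetric] E_def)
    then have "(r / (2 * \<delta>)) ^ DIM('a) * measure M ?H \<le> q ^ DIM('a) * E * measure M ?P"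
      using v by (simp add: mult.assoc)
    moreover have "0 < q ^ DIM('a) * E" using q by (simp add: E_def)
    ultimately have "(r / (2 * \<delta>)) ^ DIM('a) * measure M ?H / (q ^ DIM('a) * E) \<le> measure M ?P"
      by (simp add: pos_divide_le_eq mult.commute)
    then show "\<kappa> * r ^ DIM('a) * measure M ?H \<le> measure M ?P"
      by (simp add: \<kappa>_def power_divide mult_ac)
  qed
qed

end

section \<open>Passing to the solution\<close>

text \<open>The open-set half of the portmanteau theorem, by Fatou: near a limit inside an open set
  the approximations are eventually inside too.\<close>

lemma (in prob_space) eventually_prob_open:
  fixes Y :: "'a \<Rightarrow> 'b::topological_space"
  assumes U: "open U" and lim: "\<And>\<omega>. \<omega> \<in> space M \<Longrightarrow> (\<lambda>N. Z N \<omega>) \<longlonglongrightarrow> Y \<omega>"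
    and Z: "\<And>N. Z N \<in> M \<rightarrow>\<^sub>M borel" and Y: "Y \<in> M \<rightarrow>\<^sub>M borel"
    and c: "c < prob {\<omega> \<in> space M. Y \<omega> \<in> U}"
  shows "\<forall>\<^sub>F N in sequentially. c < prob {\<omega> \<in> space M. Z N \<omega> \<in> U}"
proof (cases "0 \<le> c")
  case True
  have sZ: "{\<omega> \<in> space M. Z N \<omega> \<in> U} \<in> sets M" for N
    using measurable_sets[OF Z, of U] U by (simp add: vimage_def Int_def conj_commute)
  have sY: "{\<omega> \<in> space M. Y \<omega> \<in> U} \<in> sets M"
    using measurable_sets[OF Y, of U] U by (simp add: vimage_def Int_def conj_commute)
  have "ennreal c < emeasure M {\<omega> \<in> space M. Y \<omega> \<in> U}"
    using c True by (simp add: emeasure_eq_measure ennreal_less_iff)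
  also have "\<dots> = (\<integral>\<^sup>+\<omega>. indicator {\<omega> \<in> space M. Y \<omega> \<in> U} \<omega> \<partial>M)" using sY by simp
  also have "\<dots> \<le> (\<integral>\<^sup>+\<omega>. liminf (\<lambda>N. indicator {\<omega> \<in> space M. Z N \<omega> \<in> U} \<omega>) \<partial>M)"
  proof (rule nn_integral_mono)
    fix \<omega> assume \<omega>: "\<omega> \<in> space M"
    show "indicator {\<omega> \<in> space M. Y \<omega> \<in> U} \<omega> \<le> liminf (\<lambda>N. indicator {\<omega> \<in> space M. Z N \<omega> \<in> U} \<omega> :: ennreal)"
    proof (cases "Y \<omega> \<in> U")
      case True
      then have "\<forall>\<^sub>F N in sequentially. Z N \<omega> \<in> U" using lim[OF \<omega>] U by (auto simp: tendsto_def)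
      then have "\<forall>\<^sub>F N in sequentially. 1 \<le> (indicator {\<omega> \<in> space M. Z N \<omega> \<in> U} \<omega> :: ennreal)"
        by eventually_elim (use \<omega> in simp)
      then have "1 \<le> liminf (\<lambda>N. indicator {\<omega> \<in> space M. Z N \<omega> \<in> U} \<omega> :: ennreal)"
        by (rule Liminf_bounded)
      then show ?thesis using \<omega> True by simp
    qed simp
  qed
  also have "\<dots> \<le> liminf (\<lambda>N. \<integral>\<^sup>+\<omega>. indicator {\<omega> \<in> space M. Z N \<omega> \<in> U} \<omega> \<partial>M)"
    using sZ by (intro nn_integral_liminf) auto
  also have "\<dots> = liminf (\<lambda>N. ennreal (prob {\<omega> \<in> space M. Z N \<omega> \<in> U}))"
    using sZ by (simp add: emeasure_eq_measure)
  finally have "\<forall>\<^sub>F N in sequentially. ennreal c < ennreal (prob {\<omega> \<in> space M. Z N \<omega> \<in> U})"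
    by (rule less_LiminfD)
  then show ?thesis using True by (simp add: ennreal_less_iff)
next
  case False
  then show ?thesis by (intro always_eventually allI less_le_trans[OF _ measure_nonneg]) simp
qed

text \<open>Independence turned into an iterated integral over two copies of M, with B replaced by
  any variable of the same law. For the Markov property, B is a later block of noise and B' the
  block starting at time 0.\<close>

lemma (in prob_space) integral_indep_var:
  fixes F :: "'b \<times> 'b \<Rightarrow> real"
  assumes ind: "indep_var S A T B" and B': "B' \<in> M \<rightarrow>\<^sub>M T" and eq: "distr M T B = distr M T B'"
    and F: "F \<in> borel_measurable (S \<Otimes>\<^sub>M T)" and bd: "\<And>p. \<bar>F p\<bar> \<le> c"
  shows "(\<integral>\<omega>. F (A \<omega>, B \<omega>) \<partial>M) = (\<integral>\<omega>. \<integral>\<omega>'. F (A \<omega>, B' \<omega>') \<partial>M \<partial>M)"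
proof -
  have A: "A \<in> M \<rightarrow>\<^sub>M S" and B: "B \<in> M \<rightarrow>\<^sub>M T"
    and joint: "distr M S A \<Otimes>\<^sub>M distr M T B = distr M (S \<Otimes>\<^sub>M T) (\<lambda>\<omega>. (A \<omega>, B \<omega>))"
    using ind unfolding indep_var_distribution_eq by auto
  interpret DA: prob_space "distr M S A" by (rule prob_space_distr[OF A])
  interpret DB: prob_space "distr M T B'" by (rule prob_space_distr[OF B'])
  interpret P: pair_prob_space "distr M S A" "distr M T B'" ..
  have F': "F \<in> borel_measurable (distr M S A \<Otimes>\<^sub>M distr M T B')"
    using F by (simp cong: measurable_cong_sets add: sets_pair_measure_cong[OF sets_distr sets_distr])
  have Fi: "(\<lambda>a. \<integral>t. F (a, t) \<partial>distr M T B') \<in> borel_measurable S"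
    using DB.borel_measurable_lebesgue_integral[of "\<lambda>a t. F (a, t)" S] F
    by (simp cong: measurable_cong_sets add: sets_pair_measure_cong[OF refl sets_distr])
  have "(\<integral>\<omega>. F (A \<omega>, B \<omega>) \<partial>M) = (\<integral>p. F p \<partial>distr M (S \<Otimes>\<^sub>M T) (\<lambda>\<omega>. (A \<omega>, B \<omega>)))"
    using A B F by (intro integral_distr[symmetric]) measurable
  also have "\<dots> = (\<integral>p. F p \<partial>(distr M S A \<Otimes>\<^sub>M distr M T B'))"
    unfolding joint[symmetric] eq ..
  also have "\<dots> = (\<integral>a. \<integral>t. F (a, t) \<partial>distr M T B' \<partial>distr M S A)"
    using bd by (intro P.integral_fst'[symmetric] P.integrable_const_bound[of _ c] F') auto
  also have "\<dots> = (\<integral>\<omega>. \<integral>t. F (A \<omega>, t) \<partial>distr M T B' \<partial>M)"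
    by (rule integral_distr[OF A Fi])
  also have "\<dots> = (\<integral>\<omega>. \<integral>\<omega>'. F (A \<omega>, B' \<omega>') \<partial>M \<partial>M)"
  proof (rule Bochner_Integration.integral_cong[OF refl])
    fix \<omega> assume "\<omega> \<in> space M"
    then have "A \<omega> \<in> space S" using A by (rule measurable_space[rotated])
    then have "(\<lambda>t. F (A \<omega>, t)) \<in> borel_measurable T"
      using measurable_compose[OF measurable_Pair1' F] by simp
    then show "(\<integral>t. F (A \<omega>, t) \<partial>distr M T B') = (\<integral>\<omega>'. F (A \<omega>, B' \<omega>') \<partial>M)"
      by (rule integral_distr[OF B'])
  qed
  finally show ?thesis .
qed

context sde
begin

section \<open>Regularity, tightness and short-time ball bounds of the solution\<close>

lemma euler_tendsto_X:
  assumes "\<omega> \<in> space M" "0 < h" "xs \<longlonglongrightarrow> x"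
  shows "(\<lambda>N. euler b (h / Suc N) (xs N) (z (h / Suc N) \<omega>) (j * Suc N)) \<longlonglongrightarrow> X x (real j * h) \<omega>"
proof (rule euler_tendsto_solution[OF lip])
  show "continuous_on {0..} (\<lambda>t. X x t \<omega>)"
    "\<And>t. 0 \<le> t \<Longrightarrow> X x t \<omega> = x + integral {0..t} (\<lambda>s. b (X x s \<omega>)) + W t \<omega>"
    using sol assms(1) unfolding sde_solution_def by blast+
qed (use assms W0 in auto)

lemma X_0: "\<omega> \<in> space M \<Longrightarrow> X x 0 \<omega> = x"
  using sol W0 unfolding sde_solution_def by fastforce

lemma measurable_X:
  assumes h: "0 < h"
  shows "(\<lambda>(x, \<omega>). X x (real j * h) \<omega>) \<in> borel \<Otimes>\<^sub>M M \<rightarrow>\<^sub>M borel"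
proof (rule borel_measurable_LIMSEQ_metric)
  fix N
  show "(\<lambda>(x, \<omega>). euler b (h / Suc N) x (z (h / Suc N) \<omega>) (j * Suc N)) \<in> borel \<Otimes>\<^sub>M M \<rightarrow>\<^sub>M borel"
    using h by (intro measurable_euler_start) simp
next
  fix p assume "p \<in> space (borel \<Otimes>\<^sub>M M :: ('a \<times> 'w) measure)"
  then have "snd p \<in> space M" by (auto simp: space_pair_measure)
  from euler_tendsto_X[OF this h tendsto_const, of "fst p" j]
  show "(\<lambda>N. case p of (x, \<omega>) \<Rightarrow> euler b (h / Suc N) x (z (h / Suc N) \<omega>) (j * Suc N))
      \<longlonglongrightarrow> (case p of (x, \<omega>) \<Rightarrow> X x (real j * h) \<omega>)"
    by (simp add: case_prod_beta')
qed

lemma measurable_X_section: "0 < h \<Longrightarrow> X x (real j * h) \<in> M \<rightarrow>\<^sub>M borel"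
  using measurable_compose[OF measurable_Pair1' measurable_X, of x h j] by simp

lemma X_dist_start:
  assumes \<omega>: "\<omega> \<in> space M" and t: "0 < t"
  shows "norm (X x t \<omega> - X y t \<omega>) \<le> exp (K * t) * norm (x - y)"
proof (rule LIMSEQ_le_const2)
  let ?E = "\<lambda>x N. euler b (t / Suc N) x (z (t / Suc N) \<omega>) (1 * Suc N)"
  have "?E u \<longlonglongrightarrow> X u t \<omega>" for u
    using euler_tendsto_X[OF \<omega> t tendsto_const, of u 1] by simp
  then show "(\<lambda>N. norm (?E x N - ?E y N)) \<longlonglongrightarrow> norm (X x t \<omega> - X y t \<omega>)"
    by (intro tendsto_intros)
  have "norm (?E x N - ?E y N) \<le> exp (K * t) * norm (x - y)" for N
    using euler_dist_start[OF lip, of "t / Suc N" x "z (t / Suc N) \<omega>" "1 * Suc N" y] t by simp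
  then show "\<exists>N0. \<forall>N\<ge>N0. norm (?E x N - ?E y N) \<le> exp (K * t) * norm (x - y)" by blast
qed

text \<open>The path from the origin controls all starts in a bounded set at once, by Lipschitz
  dependence on the start. W is included because the lower bound for the scheme conditions on it as
  well.\<close>

lemma X_joint_tight:
  assumes t: "0 < t" and \<epsilon>: "0 < \<epsilon>"
  shows "\<exists>\<rho>>0. \<forall>x. norm x \<le> R \<longrightarrow> 1 - \<epsilon> < prob {\<omega> \<in> space M. X x t \<omega> \<in> ball 0 \<rho> \<and> W t \<omega> \<in> ball 0 \<rho>}"
proof -
  let ?A = "\<lambda>n::nat. {\<omega> \<in> space M. X 0 t \<omega> \<in> ball 0 (real n) \<and> W t \<omega> \<in> ball 0 (real n)}"
  have [measurable]: "\<And>x. X x t \<in> M \<rightarrow>\<^sub>M borel" "W t \<in> M \<rightarrow>\<^sub>M borel"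
    using measurable_X_section[OF t, of _ 1] measurable_W[OF t] by auto
  have "(\<lambda>n. prob (?A n)) \<longlonglongrightarrow> prob (\<Union>n. ?A n)"
    by (rule finite_Lim_measure_incseq) (auto simp: incseq_def)
  moreover have "(\<Union>n. ?A n) = space M"
  proof -
    have "\<exists>n::nat. norm (X 0 t \<omega>) < n \<and> norm (W t \<omega>) < n" for \<omega>
      using reals_Archimedean2[of "max (norm (X 0 t \<omega>)) (norm (W t \<omega>))"] by auto
    then show ?thesis by auto
  qed
  ultimately have "(\<lambda>n. prob (?A n)) \<longlonglongrightarrow> 1" by (simp add: prob_space)
  from order_tendstoD(1)[OF this, of "1 - \<epsilon>"] obtain n where n: "1 - \<epsilon> < prob (?A n)"
    using \<epsilon> by (auto simp: eventually_sequentially)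
  \<comment> \<open>Size of the path from 0 plus the largest displacement due to the start; the 1
    makes it positive.\<close>
  define \<rho> where "\<rho> = real n + exp (K * t) * \<bar>R\<bar> + 1"
  show ?thesis
  proof (intro exI[of _ \<rho>] conjI allI impI)
    show "0 < \<rho>" by (simp add: \<rho>_def add_nonneg_pos)
    fix x :: 'a assume x: "norm x \<le> R"
    have "?A n \<subseteq> {\<omega> \<in> space M. X x t \<omega> \<in> ball 0 \<rho> \<and> W t \<omega> \<in> ball 0 \<rho>}"
    proof safe
      fix \<omega> assume \<omega>: "\<omega> \<in> space M" and X0: "X 0 t \<omega> \<in> ball 0 (real n)" and w: "W t \<omega> \<in> ball 0 (real n)"
      have "norm (X x t \<omega> - X 0 t \<omega>) \<le> exp (K * t) * \<bar>R\<bar>"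
        using X_dist_start[OF \<omega> t, of x 0] x
        by (auto intro: order_trans[OF _ mult_left_mono[of "norm x" "\<bar>R\<bar>" "exp (K * t)"]])
      then show "X x t \<omega> \<in> ball 0 \<rho>"
        using norm_triangle_sub[of "X x t \<omega>" "X 0 t \<omega>"] X0 by (simp add: \<rho>_def)
      have "0 \<le> exp (K * t) * \<bar>R\<bar>" by simp
      then show "W t \<omega> \<in> ball 0 \<rho>" using w unfolding \<rho>_def mem_ball_0 by linarith
    qed
    then have "prob (?A n) \<le> prob {\<omega> \<in> space M. X x t \<omega> \<in> ball 0 \<rho> \<and> W t \<omega> \<in> ball 0 \<rho>}"
      by (intro finite_measure_mono) auto
    then show "1 - \<epsilon> < prob {\<omega> \<in> space M. X x t \<omega> \<in> ball 0 \<rho> \<and> W t \<omega> \<in> ball 0 \<rho>}" using n by simp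
  qed
qed

lemma X_tight:
  assumes t: "0 < t" and \<epsilon>: "0 < \<epsilon>"
  shows "\<exists>\<rho>>0. \<forall>x. norm x \<le> R \<longrightarrow> 1 - \<epsilon> < prob {\<omega> \<in> space M. X x t \<omega> \<in> ball 0 \<rho>}"
proof -
  have [measurable]: "\<And>x. X x t \<in> M \<rightarrow>\<^sub>M borel" using measurable_X_section[OF t, of _ 1] by auto
  obtain \<rho> where \<rho>: "\<rho> > 0" "\<And>x. norm x \<le> R \<Longrightarrow> 1 - \<epsilon> < prob {\<omega> \<in> space M. X x t \<omega> \<in> ball 0 \<rho> \<and> W t \<omega> \<in> ball 0 \<rho>}"
    using X_joint_tight[OF assms, of R] by blast
  have "prob {\<omega> \<in> space M. X x t \<omega> \<in> ball 0 \<rho> \<and> W t \<omega> \<in> ball 0 \<rho>} \<le> prob {\<omega> \<in> space M. X x t \<omega> \<in> ball 0 \<rho>}" for x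
    by (intro finite_measure_mono) auto
  then show ?thesis using \<rho> less_le_trans by blast
qed

text \<open>An open ball can only gain mass along the scheme, so an excess for the solution would
  already be an excess for a fine grid, against the uniform bound.\<close>

lemma X_ball_upper_small:
  assumes \<delta>: "0 < \<delta>" and small: "K * \<delta> \<le> 1/3" and r: "0 < r"
  shows "prob {\<omega> \<in> space M. X x \<delta> \<omega> \<in> ball y r} \<le> exp (\<delta> / 2) * (4 / \<delta>) ^ DIM('a) * r ^ DIM('a)"
proof (rule ccontr)
  let ?c = "exp (\<delta> / 2) * (4 / \<delta>) ^ DIM('a) * r ^ DIM('a)"
  let ?E = "\<lambda>N \<omega>. euler b (\<delta> / Suc N) x (z (\<delta> / Suc N) \<omega>) (1 * Suc N)"
  assume "\<not> prob {\<omega> \<in> space M. X x \<delta> \<omega> \<in> ball y r} \<le> ?c"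
  then have "\<forall>\<^sub>F N in sequentially. ?c < prob {\<omega> \<in> space M. ?E N \<omega> \<in> ball y r}"
    using euler_tendsto_X[OF _ \<delta> tendsto_const, of _ x 1] measurable_X_section[OF \<delta>, of x 1] \<delta>
    by (intro eventually_prob_open[where Y = "X x \<delta>"] measurable_euler_z) auto
  then obtain N where N: "?c < prob {\<omega> \<in> space M. ?E N \<omega> \<in> ball y r}"
    by (auto simp: eventually_sequentially)
  have "real (1 * Suc N) * (\<delta> / Suc N) = \<delta>" by simp
  then have "ennreal (prob {\<omega> \<in> space M. ?E N \<omega> \<in> ball y r}) \<le> ennreal ?c"
    using euler_ball_upper[of "\<delta> / Suc N" "1 * Suc N" r x y] \<delta> small r
    by (simp only: emeasure_eq_measure) simp
  then show False using N \<delta> r by (subst (asm) ennreal_le_iff) auto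
qed

text \<open>Lower bounds pass to the limit on closed sets. The target is therefore the closed ball
  of half the radius, treated through its open complement; halving costs the factor
  \<open>(1/2) ^ DIM('a)\<close>, and the remaining 1/2 is the probability of the bounded
  event.\<close>

lemma X_ball_lower_small:
  assumes \<delta>: "0 < \<delta>" and small: "K * \<delta> \<le> 1/3" and R: "0 \<le> R"
  shows "\<exists>\<alpha>>0. \<forall>x y r. norm x \<le> R \<longrightarrow> norm y \<le> R \<longrightarrow> 0 < r \<longrightarrow> r \<le> 1 \<longrightarrow>
           \<alpha> * r ^ DIM('a) \<le> prob {\<omega> \<in> space M. X x \<delta> \<omega> \<in> ball y r}"
proof -
  obtain \<rho> where \<rho>: "\<rho> > 0" "\<And>x. norm x \<le> R \<Longrightarrow> 1 - 1/2 < prob {\<omega> \<in> space M. X x \<delta> \<omega> \<in> ball 0 \<rho> \<and> W \<delta> \<omega> \<in> ball 0 \<rho>}"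
    using X_joint_tight[OF \<delta>, of "1/2" R] by auto
  obtain \<kappa> where \<kappa>: "\<kappa> > 0" and low: "\<And>\<eta> n x y r. 0 < \<eta> \<Longrightarrow> real n * \<eta> = \<delta> \<Longrightarrow> norm y \<le> R \<Longrightarrow> 0 < r \<Longrightarrow> r \<le> 1 \<Longrightarrow>
           \<kappa> * r ^ DIM('a) * prob {\<omega> \<in> space M. norm (euler b \<eta> x (z \<eta> \<omega>) n) \<le> \<rho> \<and> norm (W \<delta> \<omega>) \<le> \<rho>}
           \<le> prob {\<omega> \<in> space M. euler b \<eta> x (z \<eta> \<omega>) n \<in> ball y r}"
    using euler_ball_lower[OF \<delta> small R, of \<rho> \<rho>] \<rho>(1) by auto
  have mW: "W \<delta> \<in> M \<rightarrow>\<^sub>M borel" by (rule measurable_W[OF \<delta>])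
  show ?thesis
  proof (intro exI[of _ "\<kappa> * (1/2) ^ DIM('a) / 2"] conjI allI impI)
    fix x y :: 'a and r :: real assume x: "norm x \<le> R" and y: "norm y \<le> R" and r: "0 < r" "r \<le> 1"
    let ?E = "\<lambda>N \<omega>. euler b (\<delta> / Suc N) x (z (\<delta> / Suc N) \<omega>) (1 * Suc N)"
    let ?c = "\<kappa> * (r / 2) ^ DIM('a) / 2"
    have mX [measurable]: "X x \<delta> \<in> M \<rightarrow>\<^sub>M borel" using measurable_X_section[OF \<delta>, of x 1] by simp
    have mE [measurable]: "?E N \<in> M \<rightarrow>\<^sub>M borel" for N using \<delta> by (intro measurable_euler_z) auto
    have lim: "(\<lambda>N. ?E N \<omega>) \<longlonglongrightarrow> X x \<delta> \<omega>" if "\<omega> \<in> space M" for \<omega>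
      using euler_tendsto_X[OF that \<delta> tendsto_const, of x 1] by simp
    have "\<forall>\<^sub>F N in sequentially. 1 - 1/2 < prob {\<omega> \<in> space M. (?E N \<omega>, W \<delta> \<omega>) \<in> ball 0 \<rho> \<times> ball 0 \<rho>}"
    proof (rule eventually_prob_open[where Y = "\<lambda>\<omega>. (X x \<delta> \<omega>, W \<delta> \<omega>)"])
      show "1 - 1/2 < prob {\<omega> \<in> space M. (X x \<delta> \<omega>, W \<delta> \<omega>) \<in> ball 0 \<rho> \<times> ball 0 \<rho>}"
        using \<rho>(2)[OF x] by simp
      show "(\<lambda>\<omega>. (?E N \<omega>, W \<delta> \<omega>)) \<in> M \<rightarrow>\<^sub>M borel" for N by (rule borel_measurable_Pair[OF mE mW])
      show "(\<lambda>\<omega>. (X x \<delta> \<omega>, W \<delta> \<omega>)) \<in> M \<rightarrow>\<^sub>M borel" by (rule borel_measurable_Pair[OF mX mW])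
      show "(\<lambda>N. (?E N \<omega>, W \<delta> \<omega>)) \<longlonglongrightarrow> (X x \<delta> \<omega>, W \<delta> \<omega>)" if "\<omega> \<in> space M" for \<omega>
        by (rule tendsto_Pair[OF lim[OF that] tendsto_const])
    qed (auto intro: open_Times)
    then have ev1: "\<forall>\<^sub>F N in sequentially. ?c \<le> prob {\<omega> \<in> space M. ?E N \<omega> \<in> cball y (r / 2)}"
    proof eventually_elim
      case (elim N)
      let ?G = "{\<omega> \<in> space M. norm (?E N \<omega>) \<le> \<rho> \<and> norm (W \<delta> \<omega>) \<le> \<rho>}"
      have "prob {\<omega> \<in> space M. (?E N \<omega>, W \<delta> \<omega>) \<in> ball 0 \<rho> \<times> ball 0 \<rho>} \<le> prob ?G"
      proof (rule finite_measure_mono)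
        show "?G \<in> sets M" using mE[of N] mW by measurable
      qed auto
      then have "1/2 \<le> prob ?G" using elim by simp
      then have "?c \<le> \<kappa> * (r / 2) ^ DIM('a) * prob ?G"
        using mult_left_mono[of "1/2" "prob ?G" "\<kappa> * (r / 2) ^ DIM('a)"] \<kappa> r by simp
      also have "\<dots> \<le> prob {\<omega> \<in> space M. ?E N \<omega> \<in> ball y (r / 2)}"
        using \<delta> r y by (intro low) auto
      also have "\<dots> \<le> prob {\<omega> \<in> space M. ?E N \<omega> \<in> cball y (r / 2)}"
      proof (rule finite_measure_mono)
        show "{\<omega> \<in> space M. ?E N \<omega> \<in> cball y (r / 2)} \<in> sets M"
          using measurable_sets[OF mE[of N], of "cball y (r / 2)"]
          by (simp add: vimage_def Int_def conj_commute del: euler.simps)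
      qed auto
      finally show ?case .
    qed
    have "?c \<le> prob {\<omega> \<in> space M. X x \<delta> \<omega> \<in> cball y (r / 2)}"
    proof (rule ccontr)
      assume neg: "\<not> ?c \<le> prob {\<omega> \<in> space M. X x \<delta> \<omega> \<in> cball y (r / 2)}"
      have compl: "prob {\<omega> \<in> space M. Y \<omega> \<in> - cball y (r / 2)} = 1 - prob {\<omega> \<in> space M. Y \<omega> \<in> cball y (r / 2)}"
        if [measurable]: "Y \<in> M \<rightarrow>\<^sub>M borel" for Y
      proof -
        have "{\<omega> \<in> space M. Y \<omega> \<in> - cball y (r / 2)} = space M - {\<omega> \<in> space M. Y \<omega> \<in> cball y (r / 2)}" by auto
        then show ?thesis by (simp add: prob_compl)
      qed
      have "\<forall>\<^sub>F N in sequentially. 1 - ?c < prob {\<omega> \<in> space M. ?E N \<omega> \<in> - cball y (r / 2)}"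
      proof (rule eventually_prob_open[where Y = "X x \<delta>", OF _ lim mE mX])
        show "1 - ?c < prob {\<omega> \<in> space M. X x \<delta> \<omega> \<in> - cball y (r / 2)}"
          unfolding compl[OF mX] using neg by linarith
      qed auto
      then have "\<forall>\<^sub>F N in sequentially. False"
        using ev1 unfolding compl[OF mE] by eventually_elim linarith
      then show False by simp
    qed
    also have "\<dots> \<le> prob {\<omega> \<in> space M. X x \<delta> \<omega> \<in> ball y r}"
      using r by (intro finite_measure_mono) auto
    finally show "\<kappa> * (1/2) ^ DIM('a) / 2 * r ^ DIM('a) \<le> prob {\<omega> \<in> space M. X x \<delta> \<omega> \<in> ball y r}"
      by (simp add: power_divide)
  qed (use \<kappa> in auto)
qed

end

section \<open>The Markov property\<close>

lemma prod_unit_interval: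
  fixes g :: "'i \<Rightarrow> real"
  assumes "\<And>i. i \<in> I \<Longrightarrow> 0 \<le> g i \<and> g i \<le> 1"
  shows "0 \<le> prod g I" "prod g I \<le> 1" "\<bar>prod g I\<bar> \<le> 1"
  using assms prod_nonneg[of I g] prod_le_1[of I g] by auto

context sde
begin

text \<open>Disjoint blocks of one independent family; the second block is reindexed to start at 0,
  to make it comparable with fresh noise.\<close>

lemma indep_noise_blocks:
  assumes \<eta>: "0 < \<eta>"
  shows "indep_var (PiM ({..<P} \<times> Basis) (\<lambda>_. borel)) (\<lambda>\<omega>. \<lambda>p\<in>{..<P} \<times> Basis. noise \<eta> 0 \<omega> p)
           (PiM ({..<Q} \<times> Basis) (\<lambda>_. borel)) (\<lambda>\<omega>. \<lambda>p\<in>{..<Q} \<times> Basis. noise \<eta> P \<omega> p)"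
proof -
  let ?A = "{..<P} \<times> (Basis :: 'a set)" and ?B = "{P..<P + Q} \<times> (Basis :: 'a set)"
  let ?C = "{..<Q} \<times> (Basis :: 'a set)"
  let ?T = "\<lambda>y :: nat \<times> 'a \<Rightarrow> real. \<lambda>p\<in>?C. y (P + fst p, snd p)"
  have "indep_var (PiM ?A (\<lambda>_. borel)) (\<lambda>\<omega>. restrict (\<lambda>p. noise \<eta> 0 \<omega> p) ?A)
      (PiM ?B (\<lambda>_. borel)) (\<lambda>\<omega>. restrict (\<lambda>p. noise \<eta> 0 \<omega> p) ?B)"
    by (rule indep_var_restrict[OF indep_noise[OF \<eta>, of 0 "P + Q"]]) auto
  then have "indep_var (PiM ?A (\<lambda>_. borel)) ((\<lambda>y. y) \<circ> (\<lambda>\<omega>. restrict (\<lambda>p. noise \<eta> 0 \<omega> p) ?A))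
      (PiM ?C (\<lambda>_. borel)) (?T \<circ> (\<lambda>\<omega>. restrict (\<lambda>p. noise \<eta> 0 \<omega> p) ?B))"
    by (rule indep_var_compose) (auto intro!: measurable_restrict measurable_component_singleton)
  moreover have "?T \<circ> (\<lambda>\<omega>. restrict (\<lambda>p. noise \<eta> 0 \<omega> p) ?B) = (\<lambda>\<omega>. \<lambda>p\<in>?C. noise \<eta> P \<omega> p)"
    by (auto simp: fun_eq_iff noise_def restrict_def)
  ultimately show ?thesis by (simp add: comp_def)
qed

text \<open>The first P increments determine the restarting point and the next Q, which cover all
  times \<sigma> j, drive the rest. A product over several times is kept because survival concerns a
  whole trajectory.\<close>

lemma markov_euler:
  fixes f :: "'a \<Rightarrow> real" and \<sigma> :: "nat \<Rightarrow> nat"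
  assumes \<eta>: "0 < \<eta>" and Q: "0 < Q" and \<sigma>: "\<And>j. j < n \<Longrightarrow> \<sigma> j \<le> Q"
    and f: "f \<in> borel_measurable borel" "\<And>y. 0 \<le> f y \<and> f y \<le> 1"
  shows "(\<integral>\<omega>. (\<Prod>j<n. f (euler b \<eta> x (z \<eta> \<omega>) (P + \<sigma> j))) \<partial>M)
       = (\<integral>\<omega>. \<integral>\<omega>'. (\<Prod>j<n. f (euler b \<eta> (euler b \<eta> x (z \<eta> \<omega>) P) (z \<eta> \<omega>') (\<sigma> j))) \<partial>M \<partial>M)"
proof -
  let ?A = "{..<P} \<times> (Basis :: 'a set)" and ?C = "{..<Q} \<times> (Basis :: 'a set)"
  let ?S = "PiM ?A (\<lambda>_. borel :: real measure)" and ?T = "PiM ?C (\<lambda>_. borel :: real measure)"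
  let ?a = "\<lambda>\<omega>. \<lambda>p\<in>?A. noise \<eta> 0 \<omega> p" and ?c = "\<lambda>s \<omega>. \<lambda>p\<in>?C. noise \<eta> s \<omega> p"
  define F where "F p = (\<Prod>j<n. f (euler b \<eta> (euler b \<eta> x (noise_vector (fst p)) P) (noise_vector (snd p)) (\<sigma> j)))" for p
  have m1: "(\<lambda>p. euler b \<eta> x (noise_vector (fst p)) P) \<in> ?S \<Otimes>\<^sub>M ?T \<rightarrow>\<^sub>M borel"
    by (rule measurable_euler[OF measurable_b measurable_const])
      (auto intro: measurable_compose[OF measurable_fst measurable_noise_vector])
  have m2: "(\<lambda>p. euler b \<eta> (euler b \<eta> x (noise_vector (fst p)) P) (noise_vector (snd p)) (\<sigma> j))
      \<in> ?S \<Otimes>\<^sub>M ?T \<rightarrow>\<^sub>M borel" if "j < n" for j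
  proof (rule measurable_euler[OF measurable_b m1])
    fix k assume "k < \<sigma> j"
    then have "k < Q" using \<sigma>[OF that] by simp
    then show "(\<lambda>p. noise_vector (snd p) k) \<in> ?S \<Otimes>\<^sub>M ?T \<rightarrow>\<^sub>M borel"
      by (rule measurable_compose[OF measurable_snd measurable_noise_vector])
  qed
  have mF: "F \<in> borel_measurable (?S \<Otimes>\<^sub>M ?T)"
    unfolding F_def[abs_def] by (rule borel_measurable_prod) (auto intro: measurable_compose[OF m2 f(1)])
  have F1: "\<bar>F p\<bar> \<le> 1" for p unfolding F_def using f(2) by (intro prod_unit_interval) auto
  have FE: "F (?a \<omega>, ?c s \<omega>') = (\<Prod>j<n. f (euler b \<eta> (euler b \<eta> x (z \<eta> \<omega>) P) (\<lambda>k. z \<eta> \<omega>' (s + k)) (\<sigma> j)))" for \<omega> \<omega>' s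
  proof -
    have 1: "euler b \<eta> x (noise_vector (?a \<omega>)) P = euler b \<eta> x (z \<eta> \<omega>) P"
      using noise_vector_noise[of _ P \<eta> 0 \<omega>] by (intro euler_cong) simp
    have 2: "euler b \<eta> x' (noise_vector (?c s \<omega>')) (\<sigma> j) = euler b \<eta> x' (\<lambda>k. z \<eta> \<omega>' (s + k)) (\<sigma> j)"
      if "j < n" for x' j
      using noise_vector_noise[of _ Q \<eta> s \<omega>'] \<sigma>[OF that] by (intro euler_cong) simp
    show ?thesis unfolding F_def fst_conv snd_conv 1 by (intro prod.cong refl) (simp only: 2 lessThan_iff)
  qed
  have mc: "?c s \<in> M \<rightarrow>\<^sub>M ?T" for s
    using measurable_noise[OF \<eta>] by (intro measurable_restrict) auto
  \<comment> \<open>Stationarity of the increments lets the inner integral use noise from time 0, as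
    in a new run of the scheme.\<close>
  have "distr M ?T (?c P) = distr M ?T (?c 0)"
    unfolding distr_noise[OF \<eta> Q] ..
  from integral_indep_var[OF indep_noise_blocks[OF \<eta>] mc this mF F1]
  show ?thesis unfolding FE by (simp add: euler_add)
qed

text \<open>Continuity of f carries both sides through the limit, with 1 as dominating function. On
  the right the inner expectation is evaluated at a moving start, hence the nested dominated
  convergence.\<close>

lemma markov_continuous:
  fixes f :: "'a \<Rightarrow> real" and \<sigma> :: "nat \<Rightarrow> nat"
  assumes h: "0 < h" and f: "continuous_on UNIV f" "\<And>y. 0 \<le> f y \<and> f y \<le> 1"
  shows "(\<integral>\<omega>. (\<Prod>j<n. f (X x (real (p + \<sigma> j) * h) \<omega>)) \<partial>M)
       = (\<integral>\<omega>. \<integral>\<omega>'. (\<Prod>j<n. f (X (X x (real p * h) \<omega>) (real (\<sigma> j) * h) \<omega>')) \<partial>M \<partial>M)"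
proof -
  have mf: "f \<in> borel_measurable borel" by (rule borel_measurable_continuous_onI[OF f(1)])
  have isc: "isCont f y" for y using f(1) by (simp add: continuous_on_eq_continuous_at)
  let ?\<eta> = "\<lambda>N. h / Suc N"
  have \<eta>: "0 < ?\<eta> N" for N using h by simp
  let ?E = "\<lambda>N x \<omega> j. euler b (?\<eta> N) x (z (?\<eta> N) \<omega>) (j * Suc N)"
  let ?l = "\<lambda>N \<omega>. \<Prod>j<n. f (?E N x \<omega> (p + \<sigma> j))"
  let ?gN = "\<lambda>N x. \<integral>\<omega>'. (\<Prod>j<n. f (?E N x \<omega>' (\<sigma> j))) \<partial>M"
  let ?g = "\<lambda>x. \<integral>\<omega>'. (\<Prod>j<n. f (X x (real (\<sigma> j) * h) \<omega>')) \<partial>M"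
  have mE: "(\<lambda>(x, \<omega>). ?E N x \<omega> j) \<in> borel \<Otimes>\<^sub>M M \<rightarrow>\<^sub>M borel" for N j
    by (rule measurable_euler_start[OF \<eta>])
  have mEs: "(\<lambda>\<omega>. ?E N x \<omega> j) \<in> M \<rightarrow>\<^sub>M borel" for N x j by (rule measurable_euler_z[OF \<eta>])
  have mgN: "?gN N \<in> borel_measurable borel" for N
  proof (rule borel_measurable_lebesgue_integral)
    have "(\<lambda>p. \<Prod>j<n. f (case p of (x, \<omega>) \<Rightarrow> ?E N x \<omega> (\<sigma> j))) \<in> borel_measurable (borel \<Otimes>\<^sub>M M)"
      by (intro borel_measurable_prod measurable_compose[OF mE mf])
    then show "(\<lambda>(x, \<omega>'). \<Prod>j<n. f (?E N x \<omega>' (\<sigma> j))) \<in> borel_measurable (borel \<Otimes>\<^sub>M M)"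
      by (simp add: case_prod_beta')
  qed
  have mg: "?g \<in> borel_measurable borel"
  proof (rule borel_measurable_lebesgue_integral)
    have "(\<lambda>p. \<Prod>j<n. f (case p of (x, \<omega>) \<Rightarrow> X x (real (\<sigma> j) * h) \<omega>)) \<in> borel_measurable (borel \<Otimes>\<^sub>M M)"
      by (intro borel_measurable_prod measurable_compose[OF measurable_X[OF h] mf])
    then show "(\<lambda>(x, \<omega>'). \<Prod>j<n. f (X x (real (\<sigma> j) * h) \<omega>')) \<in> borel_measurable (borel \<Otimes>\<^sub>M M)"
      by (simp add: case_prod_beta')
  qed
  have limp: "(\<lambda>N. \<Prod>j<n. f (?E N (xs N) \<omega> (\<tau> j))) \<longlonglongrightarrow> (\<Prod>j<n. f (X y (real (\<tau> j) * h) \<omega>))"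
    if "\<omega> \<in> space M" "xs \<longlonglongrightarrow> y" for \<omega> xs y \<tau>
    by (intro tendsto_prod isCont_tendsto_compose[OF isc] euler_tendsto_X[OF that(1) h that(2)])
  have "(\<lambda>N. \<integral>\<omega>. ?l N \<omega> \<partial>M) \<longlonglongrightarrow> (\<integral>\<omega>. (\<Prod>j<n. f (X x (real (p + \<sigma> j) * h) \<omega>)) \<partial>M)"
    by (rule integral_dominated_convergence[where w = "\<lambda>_. 1"])
      (auto intro!: borel_measurable_prod measurable_compose[OF mEs mf] measurable_compose[OF measurable_X_section[OF h] mf]
        limp prod_unit_interval f(2) simp del: euler.simps mult_Suc_right of_nat_Suc of_nat_add)
  moreover have "(\<lambda>N. \<integral>\<omega>. ?gN N (?E N x \<omega> p) \<partial>M) \<longlonglongrightarrow> (\<integral>\<omega>. ?g (X x (real p * h) \<omega>) \<partial>M)"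
  proof (rule integral_dominated_convergence[where w = "\<lambda>_. 1"])
    show "AE \<omega> in M. (\<lambda>N. ?gN N (?E N x \<omega> p)) \<longlonglongrightarrow> ?g (X x (real p * h) \<omega>)"
    proof (rule AE_I2)
      fix \<omega> assume \<omega>: "\<omega> \<in> space M"
      show "(\<lambda>N. ?gN N (?E N x \<omega> p)) \<longlonglongrightarrow> ?g (X x (real p * h) \<omega>)"
        by (rule integral_dominated_convergence[where w = "\<lambda>_. 1"])
          (auto intro!: borel_measurable_prod measurable_compose[OF mEs mf] measurable_compose[OF measurable_X_section[OF h] mf]
            limp prod_unit_interval f(2) euler_tendsto_X[OF \<omega> h] simp del: euler.simps mult_Suc_right of_nat_Suc)
    qed
    show "AE \<omega> in M. norm (?gN N (?E N x \<omega> p)) \<le> 1" for N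
    proof (rule AE_I2)
      fix \<omega>
      have "norm (?gN N (?E N x \<omega> p)) \<le> (\<integral>\<omega>'. norm (\<Prod>j<n. f (?E N (?E N x \<omega> p) \<omega>' (\<sigma> j))) \<partial>M)"
        by (rule integral_norm_bound)
      also have "\<dots> \<le> (\<integral>\<omega>'. 1 \<partial>M)"
        using prod_unit_interval(3)[of "{..<n}"] f(2)
        by (intro integral_mono_AE' AE_I2) auto
      finally show "norm (?gN N (?E N x \<omega> p)) \<le> 1" by (simp add: prob_space)
    qed
  qed (auto intro!: measurable_compose[OF mEs mgN] measurable_compose[OF measurable_X_section[OF h] mg]
      simp del: euler.simps mult_Suc_right of_nat_Suc)
  moreover have "(\<integral>\<omega>. ?l N \<omega> \<partial>M) = (\<integral>\<omega>. ?gN N (?E N x \<omega> p) \<partial>M)" for N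
  proof -
    have "(\<integral>\<omega>. (\<Prod>j<n. f (euler b (?\<eta> N) x (z (?\<eta> N) \<omega>) (p * Suc N + \<sigma> j * Suc N))) \<partial>M)
       = (\<integral>\<omega>. \<integral>\<omega>'. (\<Prod>j<n. f (euler b (?\<eta> N) (?E N x \<omega> p) (z (?\<eta> N) \<omega>') (\<sigma> j * Suc N))) \<partial>M \<partial>M)"
      by (rule markov_euler[OF \<eta>, where Q = "Suc (\<Sum>j<n. \<sigma> j * Suc N)"])
        (auto intro!: mf f(2) le_SucI member_le_sum simp del: mult_Suc_right)
    then show ?thesis by (simp only: add_mult_distrib)
  qed
  ultimately show ?thesis using LIMSEQ_unique by (simp only:)
qed

text \<open>The complement of an open ball is closed, so its indicator is a pointwise limit of
  continuous functions with values in [0, 1], for which the Markov property is already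
  known.\<close>

lemma markov_outside_ball:
  fixes x0 :: 'a
  assumes h: "0 < h" and r: "0 < r"
  defines "B \<equiv> ball x0 r"
  shows "(\<integral>\<omega>. (\<Prod>j<n. indicator (- B) (X x (real (Suc j) * h) \<omega>)) \<partial>M)
       = (\<integral>\<omega>. \<integral>\<omega>'. (\<Prod>j<n. indicator (- B) (X (X x h \<omega>) (real j * h) \<omega>') :: real) \<partial>M \<partial>M)"
proof -
  let ?I = "indicator (- B) :: 'a \<Rightarrow> real"
  \<comment> \<open>Equal to 1 outside the ball and to 0 at every point of depth at least 1/m inside
    it, for positive m.\<close>
  define f where "f m y = max 0 (min 1 (1 - real m * (r - dist x0 y)))" for m :: nat and y :: 'a
  have f1: "0 \<le> f m y \<and> f m y \<le> 1" for m y by (simp add: f_def)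
  have fc: "continuous_on UNIV (f m)" for m
    unfolding f_def by (intro continuous_intros)
  have mf: "f m \<in> borel_measurable borel" for m by (rule borel_measurable_continuous_onI[OF fc])
  have mI: "?I \<in> borel_measurable borel" by (intro borel_measurable_indicator) (simp add: B_def)
  have lim: "(\<lambda>m. f m y) \<longlonglongrightarrow> ?I y" for y
  proof (cases "y \<in> B")
    case True
    then have d: "0 < r - dist x0 y" by (simp add: B_def)
    obtain m0 :: nat where m0: "1 / (r - dist x0 y) \<le> real m0" using real_arch_simple by blast
    have "f m y = 0" if "m \<ge> m0" for m
    proof -
      have "1 / (r - dist x0 y) \<le> real m" using m0 that by linarith
      then have "1 \<le> real m * (r - dist x0 y)" using d by (simp add: pos_divide_le_eq)
      then show ?thesis by (simp add: f_def)
    qed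
    then have "\<forall>\<^sub>F m in sequentially. f m y = ?I y"
      using True by (auto simp: eventually_sequentially intro!: exI[of _ m0])
    then show ?thesis by (rule tendsto_eventually)
  next
    case False
    then have "real m * (r - dist x0 y) \<le> 0" for m
      by (intro mult_nonneg_nonpos) (auto simp: B_def)
    then have "f m y = ?I y" for m using False by (simp add: f_def min_def)
    then show ?thesis by simp
  qed
  let ?g = "\<lambda>f y. \<integral>\<omega>'. (\<Prod>j<n. f (X y (real j * h) \<omega>')) \<partial>M"
  have mg: "?g f \<in> borel_measurable borel" if "f \<in> borel_measurable borel" for f :: "'a \<Rightarrow> real"
  proof (rule borel_measurable_lebesgue_integral)
    have "(\<lambda>p. \<Prod>j<n. f (case p of (x, \<omega>) \<Rightarrow> X x (real j * h) \<omega>)) \<in> borel_measurable (borel \<Otimes>\<^sub>M M)"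
      by (intro borel_measurable_prod measurable_compose[OF measurable_X[OF h] that])
    then show "(\<lambda>(x, \<omega>'). \<Prod>j<n. f (X x (real j * h) \<omega>')) \<in> borel_measurable (borel \<Otimes>\<^sub>M M)"
      by (simp add: case_prod_beta')
  qed
  note mXs = measurable_X_section[OF h]
  have "(\<lambda>m. \<integral>\<omega>. (\<Prod>j<n. f m (X x (real (Suc j) * h) \<omega>)) \<partial>M) \<longlonglongrightarrow> (\<integral>\<omega>. (\<Prod>j<n. ?I (X x (real (Suc j) * h) \<omega>)) \<partial>M)"
    by (rule integral_dominated_convergence[where w = "\<lambda>_. 1"])
      (auto intro!: borel_measurable_prod measurable_compose[OF mXs mf] measurable_compose[OF mXs mI]
        tendsto_prod lim prod_unit_interval f1 simp del: of_nat_Suc)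
  moreover have "(\<lambda>m. \<integral>\<omega>. ?g (f m) (X x h \<omega>) \<partial>M) \<longlonglongrightarrow> (\<integral>\<omega>. ?g ?I (X x h \<omega>) \<partial>M)"
  proof (rule integral_dominated_convergence[where w = "\<lambda>_. 1"])
    show "AE \<omega> in M. (\<lambda>m. ?g (f m) (X x h \<omega>)) \<longlonglongrightarrow> ?g ?I (X x h \<omega>)"
    proof (rule AE_I2)
      fix \<omega>
      show "(\<lambda>m. ?g (f m) (X x h \<omega>)) \<longlonglongrightarrow> ?g ?I (X x h \<omega>)"
        by (rule integral_dominated_convergence[where w = "\<lambda>_. 1"])
          (auto intro!: borel_measurable_prod measurable_compose[OF mXs mf] measurable_compose[OF mXs mI]
            tendsto_prod lim prod_unit_interval f1)
    qed
    show "AE \<omega> in M. norm (?g (f m) (X x h \<omega>)) \<le> 1" for m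
    proof (rule AE_I2)
      fix \<omega>
      have "norm (?g (f m) (X x h \<omega>)) \<le> (\<integral>\<omega>'. norm (\<Prod>j<n. f m (X (X x h \<omega>) (real j * h) \<omega>')) \<partial>M)"
        by (rule integral_norm_bound)
      also have "\<dots> \<le> (\<integral>\<omega>'. 1 \<partial>M)"
        using prod_unit_interval(3)[of "{..<n}"] f1 by (intro integral_mono_AE' AE_I2) auto
      finally show "norm (?g (f m) (X x h \<omega>)) \<le> 1" by (simp add: prob_space)
    qed
    have mX1: "X x h \<in> M \<rightarrow>\<^sub>M borel" using mXs[of x 1] by simp
    show "(\<lambda>\<omega>. ?g (f m) (X x h \<omega>)) \<in> borel_measurable M" for m
      by (rule measurable_compose[OF mX1 mg[OF mf]])
    show "(\<lambda>\<omega>. ?g ?I (X x h \<omega>)) \<in> borel_measurable M"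
      by (rule measurable_compose[OF mX1 mg[OF mI]])
  qed auto
  \<comment> \<open>With p = 1 the times (j + 1) h become the times j h of the restarted
    chain.\<close>
  moreover have "(\<integral>\<omega>. (\<Prod>j<n. f m (X x (real (Suc j) * h) \<omega>)) \<partial>M) = (\<integral>\<omega>. ?g (f m) (X x h \<omega>) \<partial>M)" for m
    using markov_continuous[OF h fc f1, where p = 1 and \<sigma> = "\<lambda>j. j" and n = n and x = x] by simp
  ultimately show ?thesis using LIMSEQ_unique by (simp only:)
qed

subsection \<open>Ball bounds for arbitrary time steps\<close>

text \<open>A continuous function between the indicators of the balls of radius r and 2 r: the
  Markov property is available for continuous functions, and the doubling costs only a factor
  \<open>2 ^ DIM('a)\<close> in the bounds.\<close>

definition bump :: "'a \<Rightarrow> real \<Rightarrow> 'a \<Rightarrow> real" where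
  "bump y r u = max 0 (min 1 (2 - dist y u / r))"

lemma bump_bounds: "0 \<le> bump y r u \<and> bump y r u \<le> 1"
  by (simp add: bump_def)

lemma continuous_bump: "continuous_on UNIV (bump y r)"
  unfolding bump_def divide_inverse by (intro continuous_intros)

lemma bump_ge: "0 < r \<Longrightarrow> indicator (ball y r) u \<le> bump y r u"
  by (auto simp: bump_def indicator_def)

lemma bump_le: "0 < r \<Longrightarrow> bump y r u \<le> indicator (ball y (2 * r)) u"
  by (auto simp: bump_def indicator_def field_simps)

lemma measurable_bump: "bump y r \<in> borel_measurable borel"
  by (rule borel_measurable_continuous_onI[OF continuous_bump])

lemma integrable_bump_X: "0 < h \<Longrightarrow> integrable M (\<lambda>\<omega>. bump y r (X x (real j * h) \<omega>))"
  using bump_bounds measurable_compose[OF measurable_X_section measurable_bump]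
  by (intro integrable_const_bound[of _ 1]) auto

lemma integral_indicator_X:
  assumes "0 < h" "A \<in> sets borel"
  shows "integrable M (\<lambda>\<omega>. indicator A (X x (real j * h) \<omega>) :: real)"
    "(\<integral>\<omega>. indicator A (X x (real j * h) \<omega>) \<partial>M) = prob {\<omega> \<in> space M. X x (real j * h) \<omega> \<in> A}"
proof -
  have m: "(\<lambda>\<omega>. indicator A (X x (real j * h) \<omega>) :: real) \<in> borel_measurable M"
    using measurable_compose[OF measurable_X_section[OF assms(1)] borel_measurable_indicator[OF assms(2)]] .
  then show "integrable M (\<lambda>\<omega>. indicator A (X x (real j * h) \<omega>) :: real)"
    by (intro integrable_const_bound[of _ 1]) auto
  have "{\<omega> \<in> space M. X x (real j * h) \<omega> \<in> A} \<in> sets M"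
    using measurable_sets[OF measurable_X_section[OF assms(1)] assms(2), of x j]
    by (simp add: vimage_def Int_def conj_commute)
  moreover have "(\<integral>\<omega>. indicator A (X x (real j * h) \<omega>) \<partial>M) = (\<integral>\<omega>. indicat_real {\<omega> \<in> space M. X x (real j * h) \<omega> \<in> A} \<omega> \<partial>M)"
    by (intro Bochner_Integration.integral_cong) (auto simp: indicator_def)
  ultimately show "(\<integral>\<omega>. indicator A (X x (real j * h) \<omega>) \<partial>M) = prob {\<omega> \<in> space M. X x (real j * h) \<omega> \<in> A}"
    by (simp add: Int_absorb2)
qed

lemma integral_bump_X_bounds:
  assumes "0 < h" "0 < r"
  shows "prob {\<omega> \<in> space M. X x (real j * h) \<omega> \<in> ball y r} \<le> (\<integral>\<omega>. bump y r (X x (real j * h) \<omega>) \<partial>M)"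
    "(\<integral>\<omega>. bump y r (X x (real j * h) \<omega>) \<partial>M) \<le> prob {\<omega> \<in> space M. X x (real j * h) \<omega> \<in> ball y (2 * r)}"
proof -
  have b: "ball y r \<in> sets borel" for r by simp
  show "prob {\<omega> \<in> space M. X x (real j * h) \<omega> \<in> ball y r} \<le> (\<integral>\<omega>. bump y r (X x (real j * h) \<omega>) \<partial>M)"
    unfolding integral_indicator_X(2)[OF assms(1) b, symmetric]
    using bump_ge[OF assms(2)] by (intro integral_mono integral_indicator_X(1) integrable_bump_X assms b)
  show "(\<integral>\<omega>. bump y r (X x (real j * h) \<omega>) \<partial>M) \<le> prob {\<omega> \<in> space M. X x (real j * h) \<omega> \<in> ball y (2 * r)}"
    unfolding integral_indicator_X(2)[OF assms(1) b, symmetric]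
    using bump_le[OF assms(2)] by (intro integral_mono integral_indicator_X(1) integrable_bump_X assms b)
qed

lemma chapman_kolmogorov_bump:
  assumes "0 < \<delta>"
  shows "(\<integral>\<omega>. bump y r (X x (real (Suc p) * \<delta>) \<omega>) \<partial>M)
       = (\<integral>\<omega>. \<integral>\<omega>'. bump y r (X (X x (real p * \<delta>) \<omega>) \<delta> \<omega>') \<partial>M \<partial>M)"
  using markov_continuous[OF assms continuous_bump bump_bounds, where n = 1 and \<sigma> = "\<lambda>_. 1" and p = p and x = x]
  by simp

text \<open>Splits h into equal steps short enough for the shift argument. At least two steps are
  taken, so that the time p \<delta> before the last one is positive, as tightness at that time
  requires.\<close>

lemma small_step:
  assumes "0 < h"
  obtains p \<delta> where "0 < p" "0 < \<delta>" "K * \<delta> \<le> 1/3" "h = real (Suc p) * \<delta>"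
proof -
  obtain p :: nat where p: "max 1 (3 * (K * h)) \<le> real p" using real_arch_simple by blast
  show ?thesis
  proof
    show "0 < p" using p by (cases p) auto
    show "0 < h / real (Suc p)" "h = real (Suc p) * (h / real (Suc p))" using assms by auto
    show "K * (h / real (Suc p)) \<le> 1/3" using p by (simp add: field_simps)
  qed
qed

lemma integral_bump_flow_bounds:
  assumes \<delta>: "0 < \<delta>"
  shows "(\<lambda>u. \<integral>\<omega>'. bump y r (X u \<delta> \<omega>') \<partial>M) \<in> borel_measurable borel"
    "0 \<le> (\<integral>\<omega>'. bump y r (X u \<delta> \<omega>') \<partial>M)" "(\<integral>\<omega>'. bump y r (X u \<delta> \<omega>') \<partial>M) \<le> 1"
proof -
  have "(\<lambda>p. bump y r (case p of (u, \<omega>) \<Rightarrow> X u \<delta> \<omega>)) \<in> borel_measurable (borel \<Otimes>\<^sub>M M)"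
    using measurable_compose[OF measurable_X[OF \<delta>, of 1] measurable_bump] by simp
  then have "(\<lambda>(u, \<omega>). bump y r (X u \<delta> \<omega>)) \<in> borel_measurable (borel \<Otimes>\<^sub>M M)"
    by (simp add: case_prod_beta')
  then show "(\<lambda>u. \<integral>\<omega>'. bump y r (X u \<delta> \<omega>') \<partial>M) \<in> borel_measurable borel"
    by (rule borel_measurable_lebesgue_integral)
  show "0 \<le> (\<integral>\<omega>'. bump y r (X u \<delta> \<omega>') \<partial>M)"
    using bump_bounds by (intro Bochner_Integration.integral_nonneg) auto
  have "(\<integral>\<omega>'. bump y r (X u \<delta> \<omega>') \<partial>M) \<le> (\<integral>\<omega>'. 1 \<partial>M)"
    using bump_bounds integrable_bump_X[OF \<delta>, of y r u 1] by (intro integral_mono) auto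
  then show "(\<integral>\<omega>'. bump y r (X u \<delta> \<omega>') \<partial>M) \<le> 1" by (simp add: prob_space)
qed

text \<open>The short-time bound is uniform in the start, so wherever the solution is at time p
  \<delta>, the last step alone gives the estimate.\<close>

lemma X_ball_upper:
  assumes h: "0 < h"
  shows "\<exists>C>0. \<forall>x y r. 0 < r \<longrightarrow> prob {\<omega> \<in> space M. X x h \<omega> \<in> ball y r} \<le> C * r ^ DIM('a)"
proof -
  obtain p \<delta> where \<delta>: "0 < p" "0 < \<delta>" "K * \<delta> \<le> 1/3" "h = real (Suc p) * \<delta>" by (rule small_step[OF h])
  let ?C = "exp (\<delta> / 2) * (4 / \<delta>) ^ DIM('a)"
  show ?thesis
  proof (intro exI[of _ "?C * 2 ^ DIM('a)"] conjI allI impI)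
    show "0 < ?C * 2 ^ DIM('a)" using \<delta>(2) by simp
    fix x y :: 'a and r :: real assume r: "0 < r"
    let ?G = "\<lambda>u. \<integral>\<omega>'. bump y r (X u \<delta> \<omega>') \<partial>M"
    have G: "?G u \<le> ?C * (2 * r) ^ DIM('a)" for u
      using integral_bump_X_bounds(2)[OF \<delta>(2) r, where x = u and j = 1 and y = y] X_ball_upper_small[OF \<delta>(2,3), of "2 * r" u y] r
      by simp
    have "prob {\<omega> \<in> space M. X x h \<omega> \<in> ball y r} \<le> (\<integral>\<omega>. ?G (X x (real p * \<delta>) \<omega>) \<partial>M)"
      unfolding \<delta>(4) chapman_kolmogorov_bump[OF \<delta>(2), symmetric]
      by (rule integral_bump_X_bounds(1)[OF \<delta>(2) r])
    also have "\<dots> \<le> (\<integral>\<omega>. ?C * (2 * r) ^ DIM('a) \<partial>M)"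
    proof (rule integral_mono)
      show "integrable M (\<lambda>\<omega>. ?G (X x (real p * \<delta>) \<omega>))"
        using integral_bump_flow_bounds(2,3)[OF \<delta>(2)]
          measurable_compose[OF measurable_X_section[OF \<delta>(2)] integral_bump_flow_bounds(1)[OF \<delta>(2)]]
        by (intro integrable_const_bound[of _ 1]) auto
    qed (use G in auto)
    finally show "prob {\<omega> \<in> space M. X x h \<omega> \<in> ball y r} \<le> ?C * 2 ^ DIM('a) * r ^ DIM('a)"
      by (simp add: prob_space power_mult_distrib mult.assoc)
  qed
qed

text \<open>With probability above 1/2 the solution is still in a fixed ball before the last short
  step, and from there that step reaches the target with the short-time lower bound.\<close>

lemma X_ball_lower:
  assumes h: "0 < h" and R: "0 \<le> R"
  shows "\<exists>\<alpha>>0. \<forall>x y r. norm x \<le> R \<longrightarrow> norm y \<le> R \<longrightarrow> 0 < r \<longrightarrow> r \<le> 1 \<longrightarrow>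
           \<alpha> * r ^ DIM('a) \<le> prob {\<omega> \<in> space M. X x h \<omega> \<in> ball y r}"
proof -
  obtain p \<delta> where \<delta>: "0 < p" "0 < \<delta>" "K * \<delta> \<le> 1/3" "h = real (Suc p) * \<delta>" by (rule small_step[OF h])
  have p\<delta>: "0 < real p * \<delta>" using \<delta> by simp
  obtain \<rho> where \<rho>: "\<rho> > 0" "\<And>x. norm x \<le> R \<Longrightarrow> 1 - 1/2 < prob {\<omega> \<in> space M. X x (real p * \<delta>) \<omega> \<in> ball 0 \<rho>}"
    using X_tight[OF p\<delta>, of "1/2" R] by auto
  \<comment> \<open>The radius \<open>max R \<rho>\<close> covers the intermediate positions as well
    as the target centres.\<close>
  obtain \<alpha> where \<alpha>: "\<alpha> > 0" "\<And>x y r. norm x \<le> max R \<rho> \<Longrightarrow> norm y \<le> max R \<rho> \<Longrightarrow> 0 < r \<Longrightarrow> r \<le> 1 \<Longrightarrow>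
      \<alpha> * r ^ DIM('a) \<le> prob {\<omega> \<in> space M. X x \<delta> \<omega> \<in> ball y r}"
    using X_ball_lower_small[OF \<delta>(2,3) order_trans[OF R max.cobounded1, of \<rho>]] by blast
  show ?thesis
  proof (intro exI[of _ "\<alpha> * (1/2) ^ DIM('a) / 2"] conjI allI impI)
    fix x y :: 'a and r :: real assume x: "norm x \<le> R" and y: "norm y \<le> R" and r: "0 < r" "r \<le> 1"
    let ?G = "\<lambda>u. \<integral>\<omega>'. bump y (r / 2) (X u \<delta> \<omega>') \<partial>M"
    let ?a = "\<alpha> * (r / 2) ^ DIM('a)"
    have G: "?a \<le> ?G u" if u: "u \<in> ball 0 \<rho>" for u
    proof -
      have "norm u \<le> max R \<rho>" "norm y \<le> max R \<rho>" using u y by auto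
      then show ?thesis
        using integral_bump_X_bounds(1)[OF \<delta>(2), where r = "r / 2" and x = u and j = 1 and y = y] \<alpha>(2)[of u y "r / 2"] r by simp
    qed
    have b: "ball 0 \<rho> \<in> sets (borel :: 'a measure)" by simp
    have "\<alpha> * (1/2) ^ DIM('a) / 2 * r ^ DIM('a) = 1/2 * ?a" by (simp add: power_divide)
    also have "\<dots> \<le> prob {\<omega> \<in> space M. X x (real p * \<delta>) \<omega> \<in> ball 0 \<rho>} * ?a"
      using \<rho>(2)[OF x] \<alpha>(1) r by (intro mult_right_mono) auto
    also have "\<dots> = (\<integral>\<omega>. indicator (ball 0 \<rho>) (X x (real p * \<delta>) \<omega>) * ?a \<partial>M)"
      by (simp only: integral_indicator_X(2)[OF \<delta>(2) b] integral_mult_left_zero)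
    also have "\<dots> \<le> (\<integral>\<omega>. ?G (X x (real p * \<delta>) \<omega>) \<partial>M)"
    proof (rule integral_mono)
      show "integrable M (\<lambda>\<omega>. indicator (ball 0 \<rho>) (X x (real p * \<delta>) \<omega>) * ?a)"
        by (intro integrable_mult_left integral_indicator_X(1) \<delta>(2) b)
      show "integrable M (\<lambda>\<omega>. ?G (X x (real p * \<delta>) \<omega>))"
        using integral_bump_flow_bounds(2,3)[OF \<delta>(2)]
          measurable_compose[OF measurable_X_section[OF \<delta>(2)] integral_bump_flow_bounds(1)[OF \<delta>(2)]]
        by (intro integrable_const_bound[of _ 1]) auto
      fix \<omega> show "indicator (ball 0 \<rho>) (X x (real p * \<delta>) \<omega>) * ?a \<le> ?G (X x (real p * \<delta>) \<omega>)"
        using G integral_bump_flow_bounds(2)[OF \<delta>(2)] by (cases "X x (real p * \<delta>) \<omega> \<in> ball 0 \<rho>") auto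
    qed
    also have "\<dots> \<le> prob {\<omega> \<in> space M. X x h \<omega> \<in> ball y r}"
      unfolding \<delta>(4) chapman_kolmogorov_bump[OF \<delta>(2), symmetric]
      using integral_bump_X_bounds(2)[OF \<delta>(2), where r = "r / 2" and x = x and j = "Suc p" and y = y] r by simp
    finally show "\<alpha> * (1/2) ^ DIM('a) / 2 * r ^ DIM('a) \<le> prob {\<omega> \<in> space M. X x h \<omega> \<in> ball y r}" .
  qed (use \<alpha> in auto)
qed

end

section \<open>The extreme value law\<close>

text \<open>The ball is open and the inequality weak, so the boundary counts as no exceedance; the
  infinite value at x0 matches the fact that the centre always lies in the ball.\<close>

lemma g_obs_le_iff: "g_obs x0 y \<le> ereal u \<longleftrightarrow> y \<notin> ball x0 (exp (- u))"
proof (cases "y = x0")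
  case False
  then have "0 < dist y x0" by simp
  then have "- ln (dist y x0) \<le> u \<longleftrightarrow> exp (- u) \<le> dist y x0"
    by (metis ln_ge_iff minus_le_iff)
  then show ?thesis using False by (simp add: g_obs_def dist_commute not_less)
qed (simp add: g_obs_def)

section \<open>The stationary solution observed at multiples of h\<close>

locale stationary_sde = sde M W b K X
  for M :: "'w measure" and W :: "real \<Rightarrow> 'w \<Rightarrow> 'a::euclidean_space" and b K X +
  fixes \<mu> :: "'a measure" and h :: real
  assumes inv: "invariant_measure M X \<mu>" and h: "0 < h"

sublocale stationary_sde \<subseteq> random_map M \<mu> "\<lambda>x. X x h"
proof (intro random_map.intro random_map_axioms.intro prob_space_axioms)
  show "prob_space \<mu>" and "sets \<mu> = sets borel" using inv by (auto simp: invariant_measure_def)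
  show "(\<lambda>(x, \<omega>). X x h \<omega>) \<in> borel \<Otimes>\<^sub>M M \<rightarrow>\<^sub>M borel" using measurable_X[OF h, of 1] by simp
  show "distr (M \<Otimes>\<^sub>M \<mu>) borel (\<lambda>(\<omega>, x). X x h \<omega>) = \<mu>"
    using inv h by (simp add: invariant_measure_def)
qed

context stationary_sde
begin

lemma bounded: "\<exists>C. bounded_random_map M \<mu> (\<lambda>x. X x h) C"
proof -
  have mX: "X x h \<in> M \<rightarrow>\<^sub>M borel" for x using measurable_X_section[OF h, of x 1] by simp
  have law: "measure (distr M borel (X x h)) A = prob {\<omega> \<in> space M. X x h \<omega> \<in> A}"
    if "A \<in> sets borel" for x A
    using that mX by (simp add: measure_distr vimage_def Int_def conj_commute)
  obtain C where C: "C > 0" "\<And>x y r. 0 < r \<Longrightarrow> prob {\<omega> \<in> space M. X x h \<omega> \<in> ball y r} \<le> C * r ^ DIM('a)"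
    using X_ball_upper[OF h] by blast
  have "bounded_random_map M \<mu> (\<lambda>x. X x h) C"
  proof
    show "measure (distr M borel (X x h)) (ball y r) \<le> C * r ^ DIM('a)" if "0 < r" for x y r
      using C(2)[OF that] law[of "ball y r" x] by simp
    fix R :: real
    obtain \<alpha> where \<alpha>: "\<alpha> > 0" "\<And>x y r. norm x \<le> \<bar>R\<bar> \<Longrightarrow> norm y \<le> \<bar>R\<bar> \<Longrightarrow> 0 < r \<Longrightarrow> r \<le> 1 \<Longrightarrow>
           \<alpha> * r ^ DIM('a) \<le> prob {\<omega> \<in> space M. X x h \<omega> \<in> ball y r}"
      using X_ball_lower[OF h abs_ge_zero[of R]] by blast
    show "\<exists>\<alpha>>0. \<forall>x\<in>ball 0 R. \<forall>y\<in>ball 0 R. \<forall>r. 0 < r \<longrightarrow> r \<le> 1 \<longrightarrow>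
        \<alpha> * r ^ DIM('a) \<le> measure (distr M borel (X x h)) (ball y r)"
    proof (intro exI[of _ \<alpha>] conjI ballI allI impI \<alpha>(1))
      fix x y :: 'a and r :: real assume "x \<in> ball 0 R" "y \<in> ball 0 R" and r: "0 < r" "r \<le> 1"
      then have "norm x \<le> \<bar>R\<bar>" "norm y \<le> \<bar>R\<bar>" by auto
      then show "\<alpha> * r ^ DIM('a) \<le> measure (distr M borel (X x h)) (ball y r)"
        using \<alpha>(2)[of x y r] r law[of "ball y r" x] by simp
    qed
    fix \<epsilon> :: real assume \<epsilon>: "0 < \<epsilon>"
    obtain \<rho> where \<rho>: "\<And>x. norm x \<le> R \<Longrightarrow> 1 - \<epsilon> < prob {\<omega> \<in> space M. X x h \<omega> \<in> ball 0 \<rho>}"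
      using X_tight[OF h \<epsilon>, of R] by blast
    show "\<exists>R'. \<forall>x\<in>ball 0 R. measure (distr M borel (X x h)) (- ball 0 R') \<le> \<epsilon>"
    proof (intro exI[of _ \<rho>] ballI)
      fix x :: 'a assume "x \<in> ball 0 R"
      then have x: "norm x \<le> R" by simp
      interpret D: prob_space "distr M borel (X x h)" by (rule prob_space_distr[OF mX])
      have "measure (distr M borel (X x h)) (- ball 0 \<rho>) = 1 - measure (distr M borel (X x h)) (ball 0 \<rho>)"
        using D.prob_compl[of "ball 0 \<rho>"] by (simp add: Compl_eq_Diff_UNIV)
      then show "measure (distr M borel (X x h)) (- ball 0 \<rho>) \<le> \<epsilon>"
        using \<rho>[OF x] law[of "ball 0 \<rho>" x] by simp
    qed
  qed (fact C(1))
  then show ?thesis by blast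
qed

text \<open>Here the operator recursion meets the process: the constraint at time 0 is deterministic
  because the path starts at x, and the Markov property restarts the remaining ones at time
  h.\<close>

lemma survive_eq_integral:
  assumes r: "0 < r"
  shows "survive (ball x0 r) n x = (\<integral>\<omega>. (\<Prod>j<n. indicator (- ball x0 r) (X x (real j * h) \<omega>)) \<partial>M)"
proof (induction n arbitrary: x)
  case (Suc n)
  let ?I = "indicat_real (- ball x0 r)"
  have "survive (ball x0 r) (Suc n) x
      = ?I x * (\<integral>\<omega>. \<integral>\<omega>'. (\<Prod>j<n. ?I (X (X x h \<omega>) (real j * h) \<omega>')) \<partial>M \<partial>M)"
    by (simp add: Op_def Suc)
  also have "\<dots> = ?I x * (\<integral>\<omega>. (\<Prod>j<n. ?I (X x (real (Suc j) * h) \<omega>)) \<partial>M)"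
    by (simp only: markov_outside_ball[OF h r])
  also have "\<dots> = (\<integral>\<omega>. ?I x * (\<Prod>j<n. ?I (X x (real (Suc j) * h) \<omega>)) \<partial>M)"
    by (simp only: integral_mult_right_zero)
  also have "\<dots> = (\<integral>\<omega>. (\<Prod>j<Suc n. ?I (X x (real j * h) \<omega>)) \<partial>M)"
    by (rule Bochner_Integration.integral_cong[OF refl])
      (simp add: prod.lessThan_Suc_shift X_0 del: prod.lessThan_Suc)
  finally show ?case .
qed (simp add: prob_space)

lemma measure_no_exceedance:
  "measure (M \<Otimes>\<^sub>M \<mu>) {(\<omega>, x) \<in> space (M \<Otimes>\<^sub>M \<mu>). \<forall>k<n. g_obs x0 (X x (real k * h) \<omega>) \<le> ereal u}
     = (\<integral>x. survive (ball x0 (exp (- u))) n x \<partial>\<mu>)"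
proof -
  interpret P: pair_prob_space M \<mu> ..
  let ?I = "indicat_real (- ball x0 (exp (- u)))"
  let ?S = "{(\<omega>, x) \<in> space (M \<Otimes>\<^sub>M \<mu>). \<forall>k<n. g_obs x0 (X x (real k * h) \<omega>) \<le> ereal u}"
  have mX: "(\<lambda>(\<omega>, x). X x (real k * h) \<omega>) \<in> M \<Otimes>\<^sub>M \<mu> \<rightarrow>\<^sub>M borel" for k
  proof -
    have "(\<lambda>(\<omega>, x). X x (real k * h) \<omega>) = (\<lambda>(x, \<omega>). X x (real k * h) \<omega>) \<circ> (\<lambda>(\<omega>, x). (x, \<omega>))" by auto
    also have "\<dots> \<in> M \<Otimes>\<^sub>M borel \<rightarrow>\<^sub>M borel"
      by (rule measurable_comp[OF _ measurable_X[OF h]]) measurable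
    finally show ?thesis
      using sets_pair_measure_cong[OF refl sets_mu, of M] by (simp cong: measurable_cong_sets)
  qed
  have mI: "?I \<in> borel_measurable borel" by (intro borel_measurable_indicator) simp
  have eq: "indicat_real ?S p = (case p of (\<omega>, x) \<Rightarrow> \<Prod>k<n. ?I (X x (real k * h) \<omega>))"
    if "p \<in> space (M \<Otimes>\<^sub>M \<mu>)" for p
    using that by (cases p) (auto simp: g_obs_le_iff indicator_def prod_zero_iff simp del: mem_ball)
  have m: "(\<lambda>(\<omega>, x). \<Prod>k<n. ?I (X x (real k * h) \<omega>)) \<in> borel_measurable (M \<Otimes>\<^sub>M \<mu>)"
  proof -
    have "(\<lambda>p. \<Prod>k<n. ?I (case p of (\<omega>, x) \<Rightarrow> X x (real k * h) \<omega>)) \<in> borel_measurable (M \<Otimes>\<^sub>M \<mu>)"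
      by (intro borel_measurable_prod measurable_compose[OF mX mI])
    then show ?thesis by (simp add: case_prod_beta')
  qed
  \<comment> \<open>Describing the event by a real-valued product yields its measurability, without
    which its measure could not be written as an integral of the indicator.\<close>
  have "?S = {p \<in> space (M \<Otimes>\<^sub>M \<mu>). indicat_real ?S p = 1}" by (auto simp: indicator_def)
  also have "\<dots> = {p \<in> space (M \<Otimes>\<^sub>M \<mu>). (case p of (\<omega>, x) \<Rightarrow> \<Prod>k<n. ?I (X x (real k * h) \<omega>)) = 1}"
    using eq by auto
  also have "\<dots> \<in> sets (M \<Otimes>\<^sub>M \<mu>)" using m by measurable
  finally have S: "?S \<in> sets (M \<Otimes>\<^sub>M \<mu>)" .
  have "measure (M \<Otimes>\<^sub>M \<mu>) ?S = (\<integral>p. indicat_real ?S p \<partial>(M \<Otimes>\<^sub>M \<mu>))"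
    using S sets.sets_into_space[OF S] by (simp add: Int_absorb2)
  also have "\<dots> = (\<integral>(\<omega>, x). (\<Prod>k<n. ?I (X x (real k * h) \<omega>)) \<partial>(M \<Otimes>\<^sub>M \<mu>))"
    by (rule Bochner_Integration.integral_cong[OF refl eq])
  also have "\<dots> = (\<integral>x. \<integral>\<omega>. (\<Prod>k<n. ?I (X x (real k * h) \<omega>)) \<partial>M \<partial>\<mu>)"
    by (intro P.integral_snd[symmetric] P.integrable_const_bound[of _ 1] m)
      (auto intro!: prod_unit_interval)
  finally show ?thesis by (simp add: survive_eq_integral)
qed

end

theorem theorem2:
  fixes M :: "'w measure" and W :: "real \<Rightarrow> 'w \<Rightarrow> 'a::euclidean_space"
    and b :: "'a \<Rightarrow> 'a" and X :: "'a \<Rightarrow> real \<Rightarrow> 'w \<Rightarrow> 'a" and \<mu> :: "'a measure"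
    and K R1 R2 h \<tau> :: real and x0 :: 'a and u :: "nat \<Rightarrow> real"
  assumes BM: "brownian_motion M W"
    and H: "\<And>x y. norm (b x - b y) \<le> K * norm (x - y)"
    and AD: "R2 > 0" "\<And>x. b x \<bullet> x \<le> R1 - R2 * (norm x)\<^sup>2"
    and sol: "sde_solution M b W X"
    and inv: "invariant_measure M X \<mu>"
    and h: "h > 0" and tau: "\<tau> > 0"
    and lim: "(\<lambda>n. real n * measure \<mu> (ball x0 (exp (- u n)))) \<longlonglongrightarrow> \<tau>"
  shows "(\<lambda>n. measure (M \<Otimes>\<^sub>M \<mu>)
            {(\<omega>, x) \<in> space (M \<Otimes>\<^sub>M \<mu>). \<forall>k<n. g_obs x0 (X x (real k * h) \<omega>) \<le> ereal (u n)})
         \<longlonglongrightarrow> exp (- \<tau>)"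
proof -
  have "prob_space M" using BM by (simp add: brownian_motion_def)
  then interpret stationary_sde M W b K X \<mu> h
    using BM H sol inv h
    by (auto simp: stationary_sde_def stationary_sde_axioms_def sde_def sde_axioms_def brownian_def brownian_axioms_def)
  obtain C where "bounded_random_map M \<mu> (\<lambda>x. X x h) C" using bounded by blast
  then interpret bounded_random_map M \<mu> "\<lambda>x. X x h" C .
  show ?thesis
    unfolding measure_no_exceedance
    by (rule survive_shrinking_ball_tendsto[OF exp_gt_zero lim])
qed

end
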